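(* The Hardy space $H^2(D'_\beta)$ admits an orthogonal decomposition $$H^2(D'_\beta)=\bigoplus_{j\in\mathbb Z}\mathcal H^2_j,\qquad \mathcal H^2_j=\{F\in H^2(D'_\beta): F(z_1,e^{i\theta}z_2)=e^{ij\theta}F(z_1,z_2)\ \text{for all }\theta\in\mathbb R\}.$$ Moreover, for each $j\in\mathbb Z$ the subspace $\mathcal H^2_j$ is isometric to the Hardy space of the strip $H^2(S_\beta)$ equipped with the weighted norm $\|\cdot\|_{H^2_j(S_\beta)}$ depending on $j$.
   Context: Fix $\beta>\frac{\pi}{2}$, and let $$D'_\beta=\{(z_1,z_2)\in\mathbb C^2: |\operatorname{Im}z_1-\log|z_2|^2|<\tfrac{\pi}{2},\ |\log|z_2|^2|<\beta-\tfrac{\pi}{2}\}.$$ Let $\mathbb T=\mathbb R/\mathbb Z$. For $F$ holomorphic on $D'_\beta$ and $(t,s)\in[0,\frac\pi2)\times[0,\beta-\frac\pi2)$, put $F_{t,s}=(F_{1,t,s},\dots,F_{4,t,s})$, functions of $(x,\theta)\in\mathbb R\times\mathbb T$, with $F_{1,t,s}(x,\theta)=F(x+i(s+t),e^{s/2}e^{2\pi i\theta})$, $F_{2,t,s}(x,\theta)=F(x+i(s-t),e^{s/2}e^{2\pi i\theta})$, $F_{3,t,s}(x,\theta)=F(x-i(s+t),e^{-s/2}e^{2\pi i\theta})$, $F_{4,t,s}(x,\theta)=F(x-i(s-t),e^{-s/2}e^{2\pi i\theta})$. $H^2(D'_\beta)$ is the space of holomorphic $F$ on $D'_\beta$ with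 $\|F\|^2_{H^2(D'_\beta)}=\sup_{(t,s)}\sum_{\ell=1}^4\|F_{\ell,t,s}\|^2_{L^2(\mathbb R\times\mathbb T)}<\infty$. Its inner product is $\langle F,G\rangle_{H^2(D'_\beta)}=\sum_{\ell=1}^4\langle\widetilde F_\ell,\widetilde G_\ell\rangle_{L^2(\mathbb R\times\mathbb T)}$, where $\widetilde F=(\widetilde F_1,\dots,\widetilde F_4)$ is the boundary value of $F$, i.e. the limit in $L^2$ of $F_{t,s}$ as $(t,s)\to(\frac\pi2,\beta-\frac\pi2)$. $S_\beta=\{x+iy\in\mathbb C:|y|<\beta\}$, and $H^2(S_\beta)$ is the space of holomorphic $f$ on $S_\beta$ with $\sup_{0\le y<\beta}\big[\int_{\mathbb R}|f(x+iy)|^2dx+\int_{\mathbb R}|f(x-iy)|^2dx\big]<\infty$. For $f\in H^2(S_\beta)$ let $f_0=f|_{\mathbb R}$ and $\widehat{f_0}(\xi)=\int_{\mathbb R}f_0(x)e^{-ix\xi}dx$; the weighted norm is $$\|f\|^2_{H^2_j(S_\beta)}=\frac2\pi\int_{\mathbb R}|\widehat{f_0}(\xi)|^2\cosh(\pi\xi)\cosh\big[(2\beta-\pi)(\xi-\tfrac j2)\big]\,d\xi .$$ *)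

theory Defs
  imports "HOL-Complex_Analysis.Complex_Analysis"
begin

text \<open>
  Every function space below consists of functions that vanish outside the domain in question, so
  that elements of the space are determined by their values on the domain, and the vector space
  operations are pointwise. Squared norms take values in \<^typ>\<open>ennreal\<close>; the value
  \<open>\<infinity>\<close> marks a function outside the space.
\<close>

section \<open>Subspaces, linear maps and orthogonal direct sums of spaces of functions\<close>

definition lin_subspace :: "('a \<Rightarrow> complex) set \<Rightarrow> bool" where
  "lin_subspace V \<longleftrightarrow> (\<lambda>z. 0) \<in> V \<and> (\<forall>f\<in>V. \<forall>g\<in>V. (\<lambda>z. f z + g z) \<in> V)
     \<and> (\<forall>c. \<forall>f\<in>V. (\<lambda>z. c * f z) \<in> V)"

definition lin_map_on :: "('a \<Rightarrow> complex) set \<Rightarrow> (('a \<Rightarrow> complex) \<Rightarrow> 'b \<Rightarrow> complex) \<Rightarrow> bool" where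
  "lin_map_on V T \<longleftrightarrow> (\<forall>f\<in>V. \<forall>g\<in>V. T (\<lambda>z. f z + g z) = (\<lambda>w. T f w + T g w))
     \<and> (\<forall>c. \<forall>f\<in>V. T (\<lambda>z. c * f z) = (\<lambda>w. c * T f w))"

definition isometric_iso ::
  "('a \<Rightarrow> complex) set \<Rightarrow> (('a \<Rightarrow> complex) \<Rightarrow> ennreal) \<Rightarrow>
   ('b \<Rightarrow> complex) set \<Rightarrow> (('b \<Rightarrow> complex) \<Rightarrow> ennreal) \<Rightarrow> bool" where
  "isometric_iso V nsqV W nsqW \<longleftrightarrow>
     (\<exists>T. lin_map_on V T \<and> bij_betw T V W \<and> (\<forall>f\<in>V. nsqW (T f) = nsqV f))"

text \<open>Unconditional convergence of \<open>\<Sum>j. G j\<close> to \<open>F\<close> in the norm whose square is \<open>nsq\<close>.\<close>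

definition norm_has_sum ::
  "(('a \<Rightarrow> complex) \<Rightarrow> ennreal) \<Rightarrow> ('i \<Rightarrow> 'a \<Rightarrow> complex) \<Rightarrow> ('a \<Rightarrow> complex) \<Rightarrow> bool" where
  "norm_has_sum nsq G F \<longleftrightarrow>
     ((\<lambda>A. nsq (\<lambda>z. F z - (\<Sum>j\<in>A. G j z))) \<longlongrightarrow> 0) (finite_subsets_at_top UNIV)"

text \<open>
  \<open>H\<close> is the Hilbert space direct sum of the pairwise orthogonal closed subspaces \<open>V j\<close>: each
  element of \<open>H\<close> is in a unique way a norm convergent sum of elements of the \<open>V j\<close>, and each
  square summable choice of elements of the \<open>V j\<close> has a sum in \<open>H\<close>.
\<close>

definition orthogonal_direct_sum ::
  "('a \<Rightarrow> complex) set \<Rightarrow> (('a \<Rightarrow> complex) \<Rightarrow> ennreal) \<Rightarrow>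
   (('a \<Rightarrow> complex) \<Rightarrow> ('a \<Rightarrow> complex) \<Rightarrow> complex) \<Rightarrow> ('i \<Rightarrow> ('a \<Rightarrow> complex) set) \<Rightarrow> bool" where
  "orthogonal_direct_sum H nsq ip V \<longleftrightarrow>
     lin_subspace H \<and>
     (\<forall>j. V j \<subseteq> H \<and> lin_subspace (V j)) \<and>
     (\<forall>j. \<forall>F\<in>H. \<forall>X. (\<forall>n::nat. X n \<in> V j) \<and> (\<lambda>n. nsq (\<lambda>z. F z - X n z)) \<longlonglongrightarrow> 0 \<longrightarrow> F \<in> V j) \<and>
     (\<forall>j k. j \<noteq> k \<longrightarrow> (\<forall>F\<in>V j. \<forall>G\<in>V k. ip F G = 0)) \<and>
     (\<forall>F\<in>H. \<exists>!G. (\<forall>j. G j \<in> V j) \<and> norm_has_sum nsq G F) \<and>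
     (\<forall>G. (\<forall>j. G j \<in> V j) \<and> (\<Sum>\<^sub>\<infinity>j. nsq (G j)) < \<infinity> \<longrightarrow> (\<exists>F\<in>H. norm_has_sum nsq G F))"

section \<open>Square integrable functions\<close>

definition nsq_L2 :: "'a measure \<Rightarrow> ('a \<Rightarrow> complex) \<Rightarrow> ennreal" where
  "nsq_L2 M g = (\<integral>\<^sup>+p. ennreal ((cmod (g p))\<^sup>2) \<partial>M)"

definition in_L2 :: "'a measure \<Rightarrow> ('a \<Rightarrow> complex) \<Rightarrow> bool" where
  "in_L2 M g \<longleftrightarrow> g \<in> borel_measurable M \<and> nsq_L2 M g < \<infinity>"

definition ip_L2 :: "'a measure \<Rightarrow> ('a \<Rightarrow> complex) \<Rightarrow> ('a \<Rightarrow> complex) \<Rightarrow> complex" where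
  "ip_L2 M g h = (\<integral>p. g p * cnj (h p) \<partial>M)"

text \<open>The circle \<open>\<real>/\<int>\<close> is represented by its fundamental domain \<open>[0,1)\<close>.\<close>

definition line_circle :: "(real \<times> real) measure" where
  "line_circle = lborel \<Otimes>\<^sub>M restrict_space lborel {0..<1}"

section \<open>The Hardy space of the worm domain\<close>

text \<open>The condition \<open>z\<^sub>2 \<noteq> 0\<close> is needed explicitly because \<open>ln 0 = 0\<close> in HOL.\<close>

definition worm :: "real \<Rightarrow> (complex \<times> complex) set" where
  "worm \<beta> = {(z1, z2). z2 \<noteq> 0 \<and> \<bar>Im z1 - ln ((cmod z2)\<^sup>2)\<bar> < pi / 2
                         \<and> \<bar>ln ((cmod z2)\<^sup>2)\<bar> < \<beta> - pi / 2}"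

definition holomorphic2_on :: "(complex \<times> complex \<Rightarrow> complex) \<Rightarrow> (complex \<times> complex) set \<Rightarrow> bool" where
  "holomorphic2_on F D \<longleftrightarrow>
     (\<forall>z\<in>D. \<exists>a b. (F has_derivative (\<lambda>h. a * fst h + b * snd h)) (at z within D))"

definition slice ::
  "(complex \<times> complex \<Rightarrow> complex) \<Rightarrow> nat \<Rightarrow> real \<Rightarrow> real \<Rightarrow> real \<times> real \<Rightarrow> complex" where
  "slice F l t s = (\<lambda>(x, \<theta>).
     if l = 1 then F (Complex x (s + t), of_real (exp (s / 2)) * cis (2 * pi * \<theta>))
     else if l = 2 then F (Complex x (s - t), of_real (exp (s / 2)) * cis (2 * pi * \<theta>))
     else if l = 3 then F (Complex x (- (s + t)), of_real (exp (- s / 2)) * cis (2 * pi * \<theta>))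
     else F (Complex x (- (s - t)), of_real (exp (- s / 2)) * cis (2 * pi * \<theta>)))"

definition worm_params :: "real \<Rightarrow> (real \<times> real) set" where
  "worm_params \<beta> = {0..<pi / 2} \<times> {0..<\<beta> - pi / 2}"

definition nsq_worm :: "real \<Rightarrow> (complex \<times> complex \<Rightarrow> complex) \<Rightarrow> ennreal" where
  "nsq_worm \<beta> F = (SUP (t, s)\<in>worm_params \<beta>. \<Sum>l=1..4. nsq_L2 line_circle (slice F l t s))"

definition H2_worm :: "real \<Rightarrow> (complex \<times> complex \<Rightarrow> complex) set" where
  "H2_worm \<beta> = {F. holomorphic2_on F (worm \<beta>) \<and> (\<forall>z. z \<notin> worm \<beta> \<longrightarrow> F z = 0)
                    \<and> nsq_worm \<beta> F < \<infinity>}"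

definition is_boundary_value ::
  "real \<Rightarrow> (complex \<times> complex \<Rightarrow> complex) \<Rightarrow> nat \<Rightarrow> (real \<times> real \<Rightarrow> complex) \<Rightarrow> bool" where
  "is_boundary_value \<beta> F l g \<longleftrightarrow> in_L2 line_circle g \<and>
     ((\<lambda>(t, s). nsq_L2 line_circle (\<lambda>p. slice F l t s p - g p)) \<longlongrightarrow> 0)
       (at (pi / 2, \<beta> - pi / 2) within worm_params \<beta>)"

text \<open>\<open>L\<^sup>2\<close> limits are unique only almost everywhere; \<open>SOME\<close> picks a representative.\<close>

definition boundary_value ::
  "real \<Rightarrow> (complex \<times> complex \<Rightarrow> complex) \<Rightarrow> nat \<Rightarrow> real \<times> real \<Rightarrow> complex" where
  "boundary_value \<beta> F l = (SOME g. is_boundary_value \<beta> F l g)"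

definition ip_worm ::
  "real \<Rightarrow> (complex \<times> complex \<Rightarrow> complex) \<Rightarrow> (complex \<times> complex \<Rightarrow> complex) \<Rightarrow> complex" where
  "ip_worm \<beta> F G = (\<Sum>l=1..4. ip_L2 line_circle (boundary_value \<beta> F l) (boundary_value \<beta> G l))"

definition H2_worm_comp :: "real \<Rightarrow> int \<Rightarrow> (complex \<times> complex \<Rightarrow> complex) set" where
  "H2_worm_comp \<beta> j = {F \<in> H2_worm \<beta>. \<forall>(z1, z2)\<in>worm \<beta>. \<forall>\<theta>::real.
     F (z1, cis \<theta> * z2) = cis (of_int j * \<theta>) * F (z1, z2)}"

section \<open>The Hardy space of the strip\<close>

definition strip :: "real \<Rightarrow> complex set" where
  "strip \<beta> = {z. \<bar>Im z\<bar> < \<beta>}"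

definition H2_strip :: "real \<Rightarrow> (complex \<Rightarrow> complex) set" where
  "H2_strip \<beta> = {f. f holomorphic_on strip \<beta> \<and> (\<forall>z. z \<notin> strip \<beta> \<longrightarrow> f z = 0) \<and>
     (SUP y\<in>{0..<\<beta>}. nsq_L2 lborel (\<lambda>x. f (Complex x y)) + nsq_L2 lborel (\<lambda>x. f (Complex x (- y)))) < \<infinity>}"

text \<open>
  The restriction to \<open>\<real>\<close> of a function in \<open>H\<^sup>2\<close> of the strip is square integrable but
  need not be integrable, as \<open>(exp (\<i> z) - 1) / z\<close> shows. The Fourier integral is therefore
  understood in the sense of Plancherel, as the \<open>L\<^sup>2\<close> limit of the integrals over \<open>[-R,R]\<close>.
\<close>

definition is_fourier_L2 :: "(real \<Rightarrow> complex) \<Rightarrow> (real \<Rightarrow> complex) \<Rightarrow> bool" where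
  "is_fourier_L2 f g \<longleftrightarrow> in_L2 lborel g \<and>
     ((\<lambda>R. nsq_L2 lborel (\<lambda>\<xi>. (LINT x:{-R..R}|lborel. f x * cis (- (x * \<xi>))) - g \<xi>)) \<longlongrightarrow> 0) at_top"

definition fourier_L2 :: "(real \<Rightarrow> complex) \<Rightarrow> real \<Rightarrow> complex" where
  "fourier_L2 f = (SOME g. is_fourier_L2 f g)"

definition nsq_strip_weighted :: "real \<Rightarrow> int \<Rightarrow> (complex \<Rightarrow> complex) \<Rightarrow> ennreal" where
  "nsq_strip_weighted \<beta> j f = ennreal (2 / pi) *
     (\<integral>\<^sup>+\<xi>. ennreal ((cmod (fourier_L2 (\<lambda>x. f (complex_of_real x)) \<xi>))\<^sup>2
            * cosh (pi * \<xi>) * cosh ((2 * \<beta> - pi) * (\<xi> - of_int j / 2))) \<partial>lborel)"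

end

theory Submission
  imports Defs "HOL-Probability.Characteristic_Functions"
begin

text \<open>
  The circle acts on the worm domain by rotating \<open>z2\<close>, and the components are the weight spaces of
  this action. The theorem is the Fourier decomposition of the action, together with a description
  of each weight space by Plancherel's theorem in the variable \<open>z1\<close>.

  \<^emph>\<open>One component.\<close> For \<open>F\<close> of degree \<open>j\<close> the quotient \<open>F / z2 ^ j\<close> is constant on the annulus over each
  \<open>z1\<close> (\<open>equivariant_quotient_const\<close>), so \<open>F = f z1 * z2 ^ j\<close> with \<open>f\<close> holomorphic on the projection of the
  domain, which is the strip. If \<open>g\<close> is the Fourier transform of \<open>f\<close> on the real line, then the transform
  on the line of height \<open>y\<close> is \<open>exp (- y \<xi>) * g \<xi>\<close> (\<open>fourier_line_shift\<close>, by moving the contour). The four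
  slices with parameters \<open>(t, s)\<close> thus have squared norms that add up to \<open>2 / pi\<close> times the integral of
  \<open>\<bar>g \<xi>\<bar>\<^sup>2 * cosh (2 t \<xi>) * cosh (2 s (\<xi> - j / 2))\<close> (\<open>slice_sum_lift\<close>). This increases in both parameters,
  and its limit at the corner \<open>(pi / 2, \<beta> - pi / 2)\<close> is the weighted norm of \<open>f\<close> (\<open>nsq_worm_lift\<close>).

  \<^emph>\<open>The decomposition.\<close> The Fourier coefficient of degree \<open>j\<close> along the circles gives a projection onto
  the component of degree \<open>j\<close>. Bessel's inequality holds on each slice; since the slice norms of all
  components tend to their norms along one common sequence of parameters, it holds for the norms as
  well (\<open>Bessel_worm\<close>). Conversely every square summable family of elements of the components has a sum
  (\<open>sum_in_H2_worm\<close>): the series converges locally uniformly, because the norm controls a whole range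
  of levels around a point and thereby gains exponential decay in \<open>\<bar>j\<bar>\<close> (\<open>comp_point_bound\<close>). The projections
  of \<open>F\<close> therefore have a sum, and it is \<open>F\<close> because a continuous function on the circle is determined by
  its Fourier coefficients.

  \<^emph>\<open>Orthogonality.\<close> The inner product is defined by boundary values. For an element of degree \<open>j\<close> they
  exist, as the lines of \<open>f\<close> converge in \<open>L\<^sup>2\<close> up to the boundary of the strip (\<open>H2_strip_L2_limit\<close>), and
  they are a function of \<open>x\<close> times the character of degree \<open>j\<close>; distinct characters are orthogonal.
\<close>

section \<open>Square integrable functions\<close>

lemma nsq_L2_add_le_weighted:
  assumes "d > 0" and [measurable]: "f \<in> borel_measurable M" "g \<in> borel_measurable M"
  shows "nsq_L2 M (\<lambda>p. f p + g p) \<le> ennreal (1 + d) * nsq_L2 M f + ennreal (1 + 1 / d) * nsq_L2 M g"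
proof -
  have *: "(cmod (a + b))\<^sup>2 \<le> (1 + d) * (cmod a)\<^sup>2 + (1 + 1 / d) * (cmod b)\<^sup>2" for a b :: complex
  proof -
    have "2 * (cmod a * cmod b) \<le> d * (cmod a)\<^sup>2 + (cmod b)\<^sup>2 / d"
      using sum_squares_bound[of "sqrt d * cmod a" "cmod b / sqrt d"] assms(1)
      by (simp add: power_mult_distrib power_divide mult_ac)
    moreover have "(cmod (a + b))\<^sup>2 \<le> (cmod a + cmod b)\<^sup>2"
      by (intro power_mono norm_triangle_ineq) auto
    ultimately show ?thesis
      by (simp add: power2_sum algebra_simps)
  qed
  have "nsq_L2 M (\<lambda>p. f p + g p)
      \<le> (\<integral>\<^sup>+p. ennreal (1 + d) * ennreal ((cmod (f p))\<^sup>2) + ennreal (1 + 1 / d) * ennreal ((cmod (g p))\<^sup>2) \<partial>M)"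
    unfolding nsq_L2_def using assms(1) *
    by (intro nn_integral_mono) (simp add: ennreal_mult[symmetric] ennreal_plus[symmetric] del: ennreal_plus)
  also have "\<dots> = ennreal (1 + d) * nsq_L2 M f + ennreal (1 + 1 / d) * nsq_L2 M g"
    unfolding nsq_L2_def by (subst nn_integral_add) (auto simp: nn_integral_cmult)
  finally show ?thesis .
qed

lemma nsq_L2_add_le:
  assumes "f \<in> borel_measurable M" "g \<in> borel_measurable M"
  shows "nsq_L2 M (\<lambda>p. f p + g p) \<le> 2 * nsq_L2 M f + 2 * nsq_L2 M g"
  using nsq_L2_add_le_weighted[of 1, OF _ assms] by simp

lemma nsq_L2_cmult:
  assumes [measurable]: "f \<in> borel_measurable M"
  shows "nsq_L2 M (\<lambda>p. c * f p) = ennreal ((cmod c)\<^sup>2) * nsq_L2 M f"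
  unfolding nsq_L2_def by (simp add: norm_mult power_mult_distrib ennreal_mult' nn_integral_cmult)

lemma nsq_L2_minus: "nsq_L2 M (\<lambda>p. f p - g p) = nsq_L2 M (\<lambda>p. g p - f p)"
  by (simp add: nsq_L2_def norm_minus_commute)

lemma nsq_L2_diff_le:
  assumes "f \<in> borel_measurable M" "g \<in> borel_measurable M"
  shows "nsq_L2 M (\<lambda>p. f p - g p) \<le> 2 * nsq_L2 M f + 2 * nsq_L2 M g"
  using nsq_L2_add_le[of f M "\<lambda>p. - g p"] assms by (simp add: nsq_L2_def)

lemma nsq_L2_eq_0_iff:
  assumes [measurable]: "f \<in> borel_measurable M"
  shows "nsq_L2 M f = 0 \<longleftrightarrow> (AE p in M. f p = 0)"
  unfolding nsq_L2_def by (subst nn_integral_0_iff_AE) auto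

lemma nsq_L2_cong_AE: "(AE p in M. f p = g p) \<Longrightarrow> nsq_L2 M f = nsq_L2 M g"
  unfolding nsq_L2_def by (intro nn_integral_cong_AE) auto

lemma nsq_L2_triangle:
  assumes "f \<in> borel_measurable M" "g \<in> borel_measurable M" "h \<in> borel_measurable M"
  shows "nsq_L2 M (\<lambda>p. f p - h p) \<le> 2 * nsq_L2 M (\<lambda>p. f p - g p) + 2 * nsq_L2 M (\<lambda>p. g p - h p)"
  using nsq_L2_add_le[of "\<lambda>p. f p - g p" M "\<lambda>p. g p - h p"] assms by simp

lemma in_L2_diff: "in_L2 M f \<Longrightarrow> in_L2 M g \<Longrightarrow> in_L2 M (\<lambda>p. f p - g p)"
  unfolding in_L2_def using nsq_L2_diff_le[of f M g]
  by (auto simp: ennreal_mult_less_top intro!: le_less_trans[OF nsq_L2_diff_le])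

lemma in_L2_cmult: "in_L2 M f \<Longrightarrow> in_L2 M (\<lambda>p. c * f p)"
  unfolding in_L2_def by (auto simp: nsq_L2_cmult ennreal_mult_less_top)

lemma tendsto_0_ennreal_iff:
  fixes u :: "'i \<Rightarrow> ennreal"
  shows "(u \<longlongrightarrow> 0) F \<longleftrightarrow> (\<forall>e>0. eventually (\<lambda>i. u i \<le> ennreal e) F)"
proof
  assume *: "(u \<longlongrightarrow> 0) F"
  show "\<forall>e>0. eventually (\<lambda>i. u i \<le> ennreal e) F"
  proof (intro allI impI)
    fix e :: real assume "e > 0"
    then have "eventually (\<lambda>i. u i < ennreal e) F" using order_tendstoD(2)[OF *] by simp
    then show "eventually (\<lambda>i. u i \<le> ennreal e) F" by eventually_elim simp
  qed
next
  assume *: "\<forall>e>0. eventually (\<lambda>i. u i \<le> ennreal e) F"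
  show "(u \<longlongrightarrow> 0) F"
  proof (rule order_tendstoI)
    fix a :: ennreal assume "0 < a"
    then obtain b where "0 < b" "b < a" using dense by blast
    have "b < top" using \<open>b < a\<close> by (rule less_le_trans) simp
    then have "0 < enn2real b" "b = ennreal (enn2real b)"
      using \<open>0 < b\<close> by (simp_all add: enn2real_positive_iff)
    with * have "eventually (\<lambda>i. u i \<le> b) F" by metis
    then show "eventually (\<lambda>i. u i < a) F" by eventually_elim (use \<open>b < a\<close> in auto)
  qed auto
qed

lemma tendsto_0_ennreal_le:
  fixes u v :: "'i \<Rightarrow> ennreal"
  assumes "(v \<longlongrightarrow> 0) F" "eventually (\<lambda>i. u i \<le> v i) F"
  shows "(u \<longlongrightarrow> 0) F"
  using tendsto_sandwich[OF _ assms(2) tendsto_const assms(1)] by simp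

lemma tendsto_0_ennreal_cmult:
  fixes u :: "'i \<Rightarrow> ennreal"
  assumes "(u \<longlongrightarrow> 0) F" "c < \<infinity>"
  shows "((\<lambda>i. c * u i) \<longlongrightarrow> 0) F"
  using ennreal_tendsto_cmult[OF _ assms(1), of c] assms(2) by simp

lemma tendsto_0_ennreal_add:
  fixes u v :: "'i \<Rightarrow> ennreal"
  assumes "(u \<longlongrightarrow> 0) F" "(v \<longlongrightarrow> 0) F"
  shows "((\<lambda>i. u i + v i) \<longlongrightarrow> 0) F"
  using tendsto_add[OF assms] by simp

lemma nsq_L2_limit_unique:
  assumes "F \<noteq> bot" "eventually (\<lambda>i. u i \<in> borel_measurable M) F" "g \<in> borel_measurable M" "h \<in> borel_measurable M"
    and "((\<lambda>i. nsq_L2 M (\<lambda>p. u i p - g p)) \<longlongrightarrow> 0) F"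
    and "((\<lambda>i. nsq_L2 M (\<lambda>p. u i p - h p)) \<longlongrightarrow> 0) F"
  shows "AE p in M. g p = h p"
proof -
  have "((\<lambda>i. 2 * nsq_L2 M (\<lambda>p. u i p - g p) + 2 * nsq_L2 M (\<lambda>p. u i p - h p)) \<longlongrightarrow> 0) F"
    by (intro tendsto_0_ennreal_add tendsto_0_ennreal_cmult assms) auto
  moreover have "eventually (\<lambda>i. nsq_L2 M (\<lambda>p. g p - h p)
      \<le> 2 * nsq_L2 M (\<lambda>p. u i p - g p) + 2 * nsq_L2 M (\<lambda>p. u i p - h p)) F"
    using assms(2)
  proof eventually_elim
    case (elim i)
    then show ?case
      using nsq_L2_triangle[of g M "u i" h] assms(3,4) by (simp add: nsq_L2_minus[of M g])
  qed
  ultimately have "nsq_L2 M (\<lambda>p. g p - h p) \<le> 0"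
    by (rule tendsto_lowerbound[OF _ _ assms(1)])
  then have "AE p in M. g p - h p = 0"
    using assms(3,4) by (subst nsq_L2_eq_0_iff[symmetric]) auto
  then show ?thesis by auto
qed

text \<open>Letting first the index and then the weight \<open>d\<close> of the triangle inequality tend to their limits
  gives both inequalities between \<open>L\<close> and the norm of \<open>g\<close>, without square roots of extended reals.\<close>

lemma nsq_L2_tendsto_norm:
  assumes "F \<noteq> bot" and meas: "\<And>i. u i \<in> borel_measurable M" "g \<in> borel_measurable M"
    and lim: "((\<lambda>i. nsq_L2 M (\<lambda>p. u i p - g p)) \<longlongrightarrow> 0) F"
    and L: "((\<lambda>i. nsq_L2 M (u i)) \<longlongrightarrow> ennreal L) F" "0 \<le> L"
  shows "nsq_L2 M g = ennreal L"
proof -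
  have up: "nsq_L2 M g \<le> ennreal ((1 + d) * L)" if "d > 0" for d
  proof -
    have "((\<lambda>i. ennreal (1 + d) * nsq_L2 M (u i) + ennreal (1 + 1 / d) * nsq_L2 M (\<lambda>p. u i p - g p))
        \<longlongrightarrow> ennreal (1 + d) * ennreal L + ennreal (1 + 1 / d) * 0) F"
      by (intro tendsto_add ennreal_tendsto_cmult lim L) auto
    moreover have "nsq_L2 M g \<le> ennreal (1 + d) * nsq_L2 M (u i) + ennreal (1 + 1 / d) * nsq_L2 M (\<lambda>p. u i p - g p)" for i
      using nsq_L2_add_le_weighted[OF that, of "u i" M "\<lambda>p. g p - u i p"] meas
      by (simp add: nsq_L2_minus[of M g])
    ultimately have "nsq_L2 M g \<le> ennreal (1 + d) * ennreal L + ennreal (1 + 1 / d) * 0"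
      by (intro tendsto_lowerbound[OF _ _ assms(1)]) auto
    then show ?thesis using that L(2) by (simp add: ennreal_mult)
  qed
  then have fin: "nsq_L2 M g < \<infinity>"
    using up[of 1] by (auto intro: le_less_trans)
  define K where "K = enn2real (nsq_L2 M g)"
  have K: "nsq_L2 M g = ennreal K" "0 \<le> K" using fin by (auto simp: K_def)
  have up': "K \<le> (1 + d) * L" if "d > 0" for d
    using up[OF that] K L(2) that by simp
  have lo: "L \<le> (1 + d) * K" if "d > 0" for d
  proof -
    have "((\<lambda>i. ennreal (1 + d) * nsq_L2 M g + ennreal (1 + 1 / d) * nsq_L2 M (\<lambda>p. u i p - g p))
        \<longlongrightarrow> ennreal (1 + d) * nsq_L2 M g + ennreal (1 + 1 / d) * 0) F"
      by (intro tendsto_add ennreal_tendsto_cmult lim tendsto_const) auto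
    moreover have "nsq_L2 M (u i) \<le> ennreal (1 + d) * nsq_L2 M g + ennreal (1 + 1 / d) * nsq_L2 M (\<lambda>p. u i p - g p)" for i
      using nsq_L2_add_le_weighted[OF that, of g M "\<lambda>p. u i p - g p"] meas by simp
    ultimately have "ennreal L \<le> ennreal (1 + d) * nsq_L2 M g + ennreal (1 + 1 / d) * 0"
      by (intro tendsto_le[OF assms(1) _ L(1)]) auto
    then have "ennreal L \<le> ennreal ((1 + d) * K)"
      using that K by (simp add: ennreal_mult del: ennreal_plus)
    then show ?thesis using that K by (subst (asm) ennreal_le_iff) auto
  qed
  have "K \<le> L"
  proof (rule field_le_epsilon)
    fix e :: real assume "e > 0"
    have "K \<le> (1 + e / (L + 1)) * L" using up'[of "e / (L + 1)"] \<open>e > 0\<close> L(2) by simp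
    also have "\<dots> \<le> L + e" using \<open>e > 0\<close> L(2) by (simp add: field_simps)
    finally show "K \<le> L + e" .
  qed
  moreover have "L \<le> K"
  proof (rule field_le_epsilon)
    fix e :: real assume "e > 0"
    have "L \<le> (1 + e / (K + 1)) * K" using lo[of "e / (K + 1)"] \<open>e > 0\<close> K(2) by simp
    also have "\<dots> \<le> K + e" using \<open>e > 0\<close> K(2) by (simp add: field_simps)
    finally show "L \<le> K + e" .
  qed
  ultimately show ?thesis using K by simp
qed

lemma nsq_L2_Fatou:
  assumes [measurable]: "\<And>k. u k \<in> borel_measurable M"
    and "AE p in M. (\<lambda>k. u k p) \<longlonglongrightarrow> g p"
    and "\<And>k. k \<ge> K \<Longrightarrow> nsq_L2 M (u k) \<le> B"
  shows "nsq_L2 M g \<le> B"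
proof -
  have "nsq_L2 M g \<le> (\<integral>\<^sup>+p. liminf (\<lambda>k. ennreal ((cmod (u k p))\<^sup>2)) \<partial>M)"
    unfolding nsq_L2_def
  proof (intro nn_integral_mono_AE, use assms(2) in eventually_elim)
    case (elim p)
    then have "(\<lambda>k. ennreal ((cmod (u k p))\<^sup>2)) \<longlonglongrightarrow> ennreal ((cmod (g p))\<^sup>2)"
      by (intro tendsto_ennrealI tendsto_intros)
    then have "liminf (\<lambda>k. ennreal ((cmod (u k p))\<^sup>2)) = ennreal ((cmod (g p))\<^sup>2)"
      by (intro lim_imp_Liminf) auto
    then show ?case by simp
  qed
  also have "\<dots> \<le> liminf (\<lambda>k. nsq_L2 M (u k))"
    unfolding nsq_L2_def by (intro nn_integral_liminf) auto
  also have "\<dots> \<le> B"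
  proof -
    have "liminf (\<lambda>k. nsq_L2 M (u k)) \<le> liminf (\<lambda>k. B)"
      by (intro Liminf_mono eventually_sequentiallyI[of K] assms(3))
    then show ?thesis by (simp add: Liminf_const)
  qed
  finally show ?thesis .
qed

text \<open>Riesz--Fischer: when the step number \<open>k\<close> has squared norm at most \<open>(1 / 8) ^ k\<close>, the series of
  \<open>4 ^ k\<close> times the squared steps has a finite integral, hence is almost everywhere finite. So the
  steps decay geometrically almost everywhere and the sequence converges pointwise; Fatou's lemma
  then gives convergence in norm.\<close>

lemma L2_complete_fast:
  fixes u :: "nat \<Rightarrow> 'a \<Rightarrow> complex"
  assumes [measurable]: "\<And>k. u k \<in> borel_measurable M"
    and fast: "\<And>k m. k \<le> m \<Longrightarrow> nsq_L2 M (\<lambda>p. u m p - u k p) \<le> ennreal ((1 / 8) ^ k)"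
  obtains g where "g \<in> borel_measurable M"
    "\<And>k. nsq_L2 M (\<lambda>p. u k p - g p) \<le> ennreal ((1 / 8) ^ k)"
proof -
  define D where "D k p = ennreal (4 ^ k * (cmod (u (Suc k) p - u k p))\<^sup>2)" for k p
  have [measurable]: "D k \<in> borel_measurable M" for k unfolding D_def by measurable
  have "(\<integral>\<^sup>+p. (\<Sum>k. D k p) \<partial>M) = (\<Sum>k. \<integral>\<^sup>+p. D k p \<partial>M)"
    by (intro nn_integral_suminf) auto
  also have "\<dots> \<le> (\<Sum>k. ennreal ((1 / 2) ^ k))"
  proof (intro suminf_le summableI)
    fix k
    have "(\<integral>\<^sup>+p. D k p \<partial>M) = ennreal (4 ^ k) * nsq_L2 M (\<lambda>p. u (Suc k) p - u k p)"
      unfolding D_def nsq_L2_def by (simp add: ennreal_mult nn_integral_cmult)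
    also have "\<dots> \<le> ennreal (4 ^ k) * ennreal ((1 / 8) ^ k)"
      by (intro mult_left_mono fast) auto
    also have "\<dots> = ennreal ((1 / 2) ^ k)"
      by (simp add: ennreal_mult[symmetric] power_mult_distrib[symmetric])
    finally show "(\<integral>\<^sup>+p. D k p \<partial>M) \<le> ennreal ((1 / 2) ^ k)" .
  qed
  also have "\<dots> = ennreal (\<Sum>k. (1 / 2) ^ k)"
    by (intro suminf_ennreal2) (auto intro: summable_geometric)
  finally have "(\<integral>\<^sup>+p. (\<Sum>k. D k p) \<partial>M) < \<infinity>"
    by (auto intro: le_less_trans)
  then have fin: "AE p in M. (\<Sum>k. D k p) \<noteq> \<infinity>"
    by (intro nn_integral_PInf_AE) auto
  have conv: "AE p in M. convergent (\<lambda>k. u k p)"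
    using fin
  proof eventually_elim
    case (elim p)
    define C where "C = enn2real (\<Sum>k. D k p)"
    have C: "(\<Sum>k. D k p) = ennreal C" "0 \<le> C"
      using elim by (simp_all add: C_def ennreal_enn2real_if)
    have "cmod (u (Suc k) p - u k p) \<le> sqrt C * (1 / 2) ^ k" for k
    proof -
      have "D k p \<le> (\<Sum>k. D k p)"
        using sum_le_suminf[of "\<lambda>k. D k p" "{k}"] by (simp add: summableI)
      then have "ennreal (4 ^ k * (cmod (u (Suc k) p - u k p))\<^sup>2) \<le> ennreal C"
        unfolding C(1) by (simp only: D_def)
      then have "4 ^ k * (cmod (u (Suc k) p - u k p))\<^sup>2 \<le> C"
        using C(2) by (simp only: ennreal_le_iff)
      moreover have "((2::real) ^ k)\<^sup>2 = 4 ^ k"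
        by (simp add: power2_eq_square power_mult_distrib[symmetric])
      ultimately have *: "(2 ^ k * cmod (u (Suc k) p - u k p))\<^sup>2 \<le> C"
        by (simp only: power_mult_distrib)
      have "2 ^ k * cmod (u (Suc k) p - u k p) \<le> sqrt C"
        using real_le_rsqrt[OF *] .
      then show ?thesis by (simp add: field_simps)
    qed
    then have "summable (\<lambda>k. u (Suc k) p - u k p)"
      by (rule summable_comparison_test'[of "\<lambda>k. sqrt C * (1 / 2) ^ k" 0, rotated])
         (simp add: summable_mult summable_geometric)
    then have "(\<lambda>n. \<Sum>k<n. u (Suc k) p - u k p) \<longlonglongrightarrow> (\<Sum>k. u (Suc k) p - u k p)"
      by (rule summable_LIMSEQ)
    then have "(\<lambda>n. u n p - u 0 p) \<longlonglongrightarrow> (\<Sum>k. u (Suc k) p - u k p)"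
      unfolding sum_lessThan_telescope[of "\<lambda>k. u k p"] .
    from tendsto_add[OF this tendsto_const[of "u 0 p"]]
    have "(\<lambda>n. u n p) \<longlonglongrightarrow> (\<Sum>k. u (Suc k) p - u k p) + u 0 p" by simp
    then show ?case by (rule convergentI)
  qed
  define g where "g p = lim (\<lambda>k. u k p)" for p
  have g: "g \<in> borel_measurable M"
    unfolding g_def by (intro borel_measurable_lim_metric) auto
  have lim: "AE p in M. (\<lambda>k. u k p) \<longlonglongrightarrow> g p"
    using conv by eventually_elim (simp add: g_def convergent_LIMSEQ_iff)
  have "nsq_L2 M (\<lambda>p. u k p - g p) \<le> ennreal ((1 / 8) ^ k)" for k
  proof (rule nsq_L2_Fatou[of "\<lambda>m p. u k p - u m p" _ _ k])
    show "AE p in M. (\<lambda>m. u k p - u m p) \<longlonglongrightarrow> u k p - g p"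
      using lim by eventually_elim (intro tendsto_intros)
    show "nsq_L2 M (\<lambda>p. u k p - u m p) \<le> ennreal ((1 / 8) ^ k)" if "k \<le> m" for m
      using fast[OF that] by (simp add: nsq_L2_minus[of M "u k"])
  qed auto
  with g show ?thesis by (rule that)
qed

text \<open>Completeness for arbitrary filters: the limits needed below run over truncation radii and
  over heights in a strip.\<close>

lemma L2_complete:
  fixes u :: "'i \<Rightarrow> 'a \<Rightarrow> complex"
  assumes F: "F \<noteq> bot" and meas: "\<And>i. u i \<in> borel_measurable M"
    and fin: "eventually (\<lambda>i. nsq_L2 M (u i) < \<infinity>) F"
    and cauchy: "\<And>e. e > 0 \<Longrightarrow> \<exists>P. eventually P F \<and> (\<forall>i j. P i \<longrightarrow> P j \<longrightarrow> nsq_L2 M (\<lambda>p. u i p - u j p) \<le> ennreal e)"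
  obtains g where "in_L2 M g" "((\<lambda>i. nsq_L2 M (\<lambda>p. u i p - g p)) \<longlongrightarrow> 0) F"
proof -
  have "\<exists>P. \<forall>k::nat. eventually (P k) F \<and> (\<forall>i j. P k i \<longrightarrow> P k j \<longrightarrow> nsq_L2 M (\<lambda>p. u i p - u j p) \<le> ennreal ((1 / 8) ^ k))"
    by (intro choice allI cauchy) auto
  then obtain P where P: "\<And>k::nat. eventually (P k) F"
    "\<And>k i j. P k i \<Longrightarrow> P k j \<Longrightarrow> nsq_L2 M (\<lambda>p. u i p - u j p) \<le> ennreal ((1 / 8) ^ k)"
    by blast
  have "\<exists>i. \<forall>m\<le>k. P m i \<and> nsq_L2 M (u i) < \<infinity>" for k
  proof -
    have "eventually (\<lambda>i. \<forall>m\<in>{..k}. P m i \<and> nsq_L2 M (u i) < \<infinity>) F"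
      using P(1) fin by (intro eventually_ball_finite ballI eventually_conj) auto
    then show ?thesis using eventually_happens'[OF F] by blast
  qed
  then have "\<exists>i. \<forall>k. \<forall>m\<le>k. P m (i k) \<and> nsq_L2 M (u (i k)) < \<infinity>"
    by (intro choice allI)
  then obtain i where i: "\<And>k m. m \<le> k \<Longrightarrow> P m (i k)" "\<And>k. nsq_L2 M (u (i k)) < \<infinity>"
    by blast
  obtain g where g: "g \<in> borel_measurable M"
    "\<And>k. nsq_L2 M (\<lambda>p. u (i k) p - g p) \<le> ennreal ((1 / 8) ^ k)"
    by (rule L2_complete_fast[of "\<lambda>k. u (i k)" M]) (use P(2) i meas in auto)
  have "nsq_L2 M g \<le> 2 * nsq_L2 M (\<lambda>p. g p - u (i 0) p) + 2 * nsq_L2 M (u (i 0))"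
    using nsq_L2_triangle[of g M "u (i 0)" "\<lambda>p. 0"] meas g(1) by simp
  also have "\<dots> < \<infinity>"
    using g(2)[of 0] i(2)[of 0]
    by (auto simp: nsq_L2_minus[of M g] ennreal_mult_less_top intro: le_less_trans)
  finally have gL2: "in_L2 M g" using g(1) by (simp add: in_L2_def)
  have "((\<lambda>i. nsq_L2 M (\<lambda>p. u i p - g p)) \<longlongrightarrow> 0) F"
    unfolding tendsto_0_ennreal_iff
  proof (intro allI impI)
    fix e :: real assume "e > 0"
    then obtain k where k: "(1 / 8 :: real) ^ k < e / 4"
      using real_arch_pow_inv[of "e / 4" "1 / 8"] by auto
    show "eventually (\<lambda>i. nsq_L2 M (\<lambda>p. u i p - g p) \<le> ennreal e) F"
      using P(1)[of k]
    proof eventually_elim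
      case (elim l)
      have "nsq_L2 M (\<lambda>p. u l p - g p)
          \<le> 2 * nsq_L2 M (\<lambda>p. u l p - u (i k) p) + 2 * nsq_L2 M (\<lambda>p. u (i k) p - g p)"
        by (intro nsq_L2_triangle meas g(1))
      also have "\<dots> \<le> 2 * ennreal ((1 / 8) ^ k) + 2 * ennreal ((1 / 8) ^ k)"
        by (intro add_mono mult_left_mono g(2) P(2) elim i(1)) auto
      also have "\<dots> = ennreal (4 * (1 / 8) ^ k)"
        by (subst (1 2) ennreal_numeral[symmetric], subst (1 2) ennreal_mult[symmetric])
           (auto simp: ennreal_plus[symmetric] simp del: ennreal_plus)
      also have "\<dots> \<le> ennreal e" using k by (intro ennreal_leI) auto
      finally show ?case .
    qed
  qed
  with gL2 show ?thesis by (rule that)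
qed

section \<open>The Plancherel theorem for continuous functions\<close>

lemma borel_measurable_cnj [measurable]: "cnj \<in> borel_measurable borel"
  by (intro borel_measurable_continuous_onI continuous_intros)

lemma gaussian_Fourier_integral:
  assumes "c > 0"
  shows "(LINT \<xi>|lborel. complex_of_real (std_normal_density (\<xi> / c)) * cis (u * \<xi>))
         = of_real (c * exp (- ((u * c)\<^sup>2) / 2))"
proof -
  have "(LINT \<xi>|lborel. complex_of_real (std_normal_density (\<xi> / c)) * cis (u * \<xi>))
      = \<bar>c\<bar> *\<^sub>R (LINT v|lborel. complex_of_real (std_normal_density ((0 + c * v) / c)) * cis (u * (0 + c * v)))"
    using assms by (intro lborel_integral_real_affine) auto
  also have "\<dots> = \<bar>c\<bar> *\<^sub>R (LINT v|lborel. std_normal_density v *\<^sub>R cis (u * c * v))"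
    using assms by (simp add: scaleR_conv_of_real mult_ac)
  also have "(LINT v|lborel. std_normal_density v *\<^sub>R cis (u * c * v)) = char std_normal_distribution (u * c)"
    unfolding char_def by (subst integral_density) (auto simp: cis_conv_exp mult_ac)
  also have "\<dots> = of_real (exp (- ((u * c)\<^sup>2) / 2))"
    by (simp add: char_std_normal_distribution)
  finally show ?thesis using assms by (simp add: scaleR_conv_of_real)
qed

lemma lborel_Fubini_bounded_kernel:
  fixes a b :: "real \<Rightarrow> complex"
  assumes a: "integrable lborel a" and b: "integrable lborel b"
    and [measurable]: "(\<lambda>(x, y). k x y) \<in> borel_measurable (borel \<Otimes>\<^sub>M borel)"
    and k: "\<And>x y. cmod (k x y) \<le> 1"
  shows "(LINT y|lborel. LINT x|lborel. a x * b y * k x y) = (LINT x|lborel. LINT y|lborel. a x * b y * k x y)"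
proof (rule lborel_pair.Fubini_integral)
  have [measurable]: "a \<in> borel_measurable borel" "b \<in> borel_measurable borel"
    using a b by (auto dest: borel_measurable_integrable)
  have "integrable (lborel \<Otimes>\<^sub>M lborel) (\<lambda>(x, y). a x * b y)"
    using a b by (intro lborel_pair.Fubini_integrable) (auto simp: norm_mult)
  then show "integrable (lborel \<Otimes>\<^sub>M lborel) (\<lambda>(x, y). a x * b y * k x y)"
    by (rule Bochner_Integration.integrable_bound)
       (auto simp: norm_mult intro!: AE_I2 mult_left_le k)
qed

definition fourier_int :: "(real \<Rightarrow> complex) \<Rightarrow> real \<Rightarrow> complex" where
  "fourier_int g \<xi> = (LINT x|lborel. g x * cis (- (x * \<xi>)))"

lemma fourier_int_measurable [measurable]:
  assumes [measurable]: "g \<in> borel_measurable borel"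
  shows "fourier_int g \<in> borel_measurable borel"
  unfolding fourier_int_def cis_conv_exp by measurable

lemma cmod_fourier_int_le: "cmod (fourier_int g \<xi>) \<le> (LINT x|lborel. cmod (g x))"
  unfolding fourier_int_def
  by (rule order_trans[OF integral_norm_bound]) (simp add: norm_mult)

lemma LINT_std_normal_density: "(LINT v|lborel. std_normal_density v) = 1"
  using integral_std_normal_moment_even[of 0] by simp

text \<open>Damping the squared modulus of the transform by a Gaussian of width \<open>n\<close> makes the triple integral
  absolutely convergent. Integrating over \<open>\<xi>\<close> first replaces the Gaussian by its own transform, which
  has width \<open>1 / n\<close>, so \<open>g\<close> gets paired with a local average of itself.\<close>

lemma fourier_int_gaussian_damped:
  assumes int: "integrable lborel g" and n: "(n::real) > 0"
  shows "(LINT \<xi>|lborel. of_real (sqrt (2 * pi) * std_normal_density (\<xi> / n)) * (fourier_int g \<xi> * cnj (fourier_int g \<xi>)))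
       = of_real (2 * pi) * (LINT x|lborel. g x * (LINT v|lborel. std_normal_density v *\<^sub>R cnj (g (x + v / n))))"
    (is "?I = _")
proof -
  have [measurable]: "g \<in> borel_measurable borel" using borel_measurable_integrable[OF int] by simp
  define m where "m \<xi> = complex_of_real (sqrt (2 * pi) * std_normal_density (\<xi> / n))" for \<xi>
  have [measurable]: "m \<in> borel_measurable borel" unfolding m_def by measurable
  have m_int: "integrable lborel m"
  proof -
    have "integrable lborel (\<lambda>\<xi>. std_normal_density (0 + (1 / n) * \<xi>))"
      using n by (intro lborel_integrable_real_affine integrable_normal_density) auto
    then show ?thesis unfolding m_def
      by (intro integrable_of_real Bochner_Integration.integrable_mult_right) simp
  qed
  define h where "h \<xi> = m \<xi> * cnj (fourier_int g \<xi>)" for \<xi>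
  have h_int: "integrable lborel h"
  proof (rule Bochner_Integration.integrable_bound[where f = "\<lambda>\<xi>. (LINT x|lborel. cmod (g x)) * m \<xi>"])
    show "AE \<xi> in lborel. norm (h \<xi>) \<le> norm ((LINT x|lborel. cmod (g x)) * m \<xi>)"
      unfolding h_def norm_mult
      by (intro AE_I2) (auto simp: mult.commute[of "cmod (m _)"] intro!: mult_right_mono cmod_fourier_int_le)
    show "h \<in> borel_measurable lborel"
      unfolding h_def[abs_def] by measurable
  qed (use m_int in auto)
  have meas_cis: "(\<lambda>(x, \<xi>). cis (- (x * \<xi>))) \<in> borel_measurable (borel \<Otimes>\<^sub>M borel)"
    "\<And>x0. (\<lambda>(x, \<xi>). cis ((x - x0) * \<xi>)) \<in> borel_measurable (borel \<Otimes>\<^sub>M borel)"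
    unfolding cis_conv_exp by measurable
  have inner: "(LINT \<xi>|lborel. h \<xi> * cis (- (x * \<xi>)))
      = of_real (2 * pi) * (LINT v|lborel. std_normal_density v *\<^sub>R cnj (g (x + v / n)))" for x
  proof -
    have "(LINT \<xi>|lborel. h \<xi> * cis (- (x * \<xi>)))
        = (LINT \<xi>|lborel. LINT y|lborel. cnj (g y) * m \<xi> * cis ((y - x) * \<xi>))"
    proof (intro Bochner_Integration.integral_cong refl)
      fix \<xi>
      have "cnj (fourier_int g \<xi>) = (LINT y|lborel. cnj (g y) * cis (y * \<xi>))"
        unfolding fourier_int_def by (subst Bochner_Integration.integral_cnj[symmetric]) (simp add: cis_cnj)
      then have "h \<xi> * cis (- (x * \<xi>)) = (LINT y|lborel. (m \<xi> * cis (- (x * \<xi>))) * (cnj (g y) * cis (y * \<xi>)))"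
        unfolding h_def by (subst integral_mult_right_zero) (simp add: mult_ac)
      also have "\<dots> = (LINT y|lborel. cnj (g y) * m \<xi> * cis ((y - x) * \<xi>))"
      proof (intro Bochner_Integration.integral_cong refl)
        fix y
        have "cis (- (x * \<xi>)) * cis (y * \<xi>) = cis ((y - x) * \<xi>)"
          by (simp add: cis_mult algebra_simps)
        then show "(m \<xi> * cis (- (x * \<xi>))) * (cnj (g y) * cis (y * \<xi>)) = cnj (g y) * m \<xi> * cis ((y - x) * \<xi>)"
          by (metis (no_types, lifting) mult.assoc mult.commute)
      qed
      finally show "h \<xi> * cis (- (x * \<xi>)) = (LINT y|lborel. cnj (g y) * m \<xi> * cis ((y - x) * \<xi>))" .
    qed
    also have "\<dots> = (LINT y|lborel. LINT \<xi>|lborel. cnj (g y) * m \<xi> * cis ((y - x) * \<xi>))"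
      using int m_int meas_cis(2)[of x] by (intro lborel_Fubini_bounded_kernel) auto
    also have "\<dots> = (LINT y|lborel. cnj (g y) * of_real (sqrt (2 * pi) * (n * exp (- (((y - x) * n)\<^sup>2) / 2))))"
    proof (intro Bochner_Integration.integral_cong refl)
      fix y
      have "(LINT \<xi>|lborel. cnj (g y) * m \<xi> * cis ((y - x) * \<xi>))
          = cnj (g y) * of_real (sqrt (2 * pi)) * (LINT \<xi>|lborel. of_real (std_normal_density (\<xi> / n)) * cis ((y - x) * \<xi>))"
        unfolding m_def by (subst integral_mult_right_zero[symmetric]) (simp add: mult_ac)
      then show "(LINT \<xi>|lborel. cnj (g y) * m \<xi> * cis ((y - x) * \<xi>))
          = cnj (g y) * of_real (sqrt (2 * pi) * (n * exp (- (((y - x) * n)\<^sup>2) / 2)))"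
        unfolding gaussian_Fourier_integral[OF n] by simp
    qed
    also have "\<dots> = \<bar>1 / n\<bar> *\<^sub>R (LINT v|lborel. cnj (g (x + (1 / n) * v)) *
                     of_real (sqrt (2 * pi) * (n * exp (- (((x + (1 / n) * v - x) * n)\<^sup>2) / 2))))"
      using n by (intro lborel_integral_real_affine) auto
    also have "\<dots> = (LINT v|lborel. of_real (2 * pi) * (std_normal_density v *\<^sub>R cnj (g (x + v / n))))"
    proof (subst integral_scaleR_right[symmetric], intro Bochner_Integration.integral_cong refl)
      fix v
      have e: "(x + (1 / n) * v - x) * n = v" using n by simp
      have s: "sqrt (2 * pi) = 2 * pi * (1 / sqrt (2 * pi))"
        by (simp add: real_div_sqrt)
      have "sqrt (2 * pi) * exp (- (v\<^sup>2) / 2) = 2 * pi * std_normal_density v"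
        unfolding std_normal_density_def by (subst s) simp
      moreover have scale: "r *\<^sub>R (z * of_real a) = of_real (r * a) * z" for r a and z :: complex
        by (simp add: scaleR_conv_of_real)
      ultimately have k: "\<bar>1 / n\<bar> * (sqrt (2 * pi) * (n * exp (- (v\<^sup>2) / 2))) = 2 * pi * std_normal_density v"
        using n by simp
      show "\<bar>1 / n\<bar> *\<^sub>R (cnj (g (x + (1 / n) * v)) *
                     of_real (sqrt (2 * pi) * (n * exp (- (((x + (1 / n) * v - x) * n)\<^sup>2) / 2))))
          = of_real (2 * pi) * (std_normal_density v *\<^sub>R cnj (g (x + v / n)))"
        unfolding e scale k by (simp add: scaleR_conv_of_real)
    qed
    finally show ?thesis by (simp only: integral_mult_right_zero)
  qed
  have "?I = (LINT \<xi>|lborel. LINT x|lborel. g x * h \<xi> * cis (- (x * \<xi>)))"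
  proof (intro Bochner_Integration.integral_cong refl)
    fix \<xi>
    have "(LINT x|lborel. g x * h \<xi> * cis (- (x * \<xi>))) = h \<xi> * fourier_int g \<xi>"
      unfolding fourier_int_def by (subst integral_mult_right_zero[symmetric]) (simp add: mult_ac)
    then show "of_real (sqrt (2 * pi) * std_normal_density (\<xi> / n)) * (fourier_int g \<xi> * cnj (fourier_int g \<xi>))
        = (LINT x|lborel. g x * h \<xi> * cis (- (x * \<xi>)))"
      by (simp add: h_def m_def mult_ac)
  qed
  also have "\<dots> = (LINT x|lborel. LINT \<xi>|lborel. g x * h \<xi> * cis (- (x * \<xi>)))"
    using int h_int meas_cis(1) by (intro lborel_Fubini_bounded_kernel) auto
  also have "\<dots> = (LINT x|lborel. g x * (LINT \<xi>|lborel. h \<xi> * cis (- (x * \<xi>))))"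
    by (simp add: mult.assoc)
  also have "\<dots> = (LINT x|lborel. of_real (2 * pi) * (g x * (LINT v|lborel. std_normal_density v *\<^sub>R cnj (g (x + v / n)))))"
    unfolding inner by (simp add: mult_ac)
  finally show ?thesis by (simp only: integral_mult_right_zero)
qed

text \<open>As the damping is removed, the averages converge to \<open>g\<close> at every continuity point, and the damped
  integrals increase to the full one.\<close>

lemma Plancherel_bounded_support:
  assumes [measurable]: "g \<in> borel_measurable borel"
    and bound: "\<And>x. cmod (g x) \<le> B" and supp: "\<And>x. x \<notin> {-R..R} \<Longrightarrow> g x = 0"
    and cont: "AE x in lborel. isCont g x"
  shows "nsq_L2 lborel (fourier_int g) = ennreal (2 * pi) * nsq_L2 lborel g"
proof -
  have B: "0 \<le> B" using bound[of 0] norm_ge_zero order_trans by blast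
  have gB: "cmod (g x) \<le> B * indicator {-R..R} x" for x
    using bound[of x] supp[of x] by (auto simp: indicator_def)
  have ind: "integrable lborel (\<lambda>x. c * indicator {-R..R} x :: real)" for c
    by (intro Bochner_Integration.integrable_mult_right integrable_real_indicator)
       (use emeasure_bounded_finite[of "{-R..R}"] in auto)
  have int: "integrable lborel g"
    by (rule Bochner_Integration.integrable_bound[OF ind[of B]]) (use gB B in \<open>auto intro!: AE_I2\<close>)
  define J where "J n x = (LINT v|lborel. std_normal_density v *\<^sub>R cnj (g (x + v / real (Suc n))))" for n x
  have J_lim: "(\<lambda>n. J n x) \<longlonglongrightarrow> cnj (g x)" if x: "isCont g x" for x
  proof -
    have "(\<lambda>n. J n x) \<longlonglongrightarrow> (LINT v|lborel. std_normal_density v *\<^sub>R cnj (g x))"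
      unfolding J_def
    proof (rule integral_dominated_convergence[where w = "\<lambda>v. std_normal_density v * B"])
      show "AE v in lborel. (\<lambda>n. std_normal_density v *\<^sub>R cnj (g (x + v / real (Suc n)))) \<longlonglongrightarrow> std_normal_density v *\<^sub>R cnj (g x)"
      proof (intro AE_I2 tendsto_intros isCont_tendsto_compose[OF x])
        fix v
        have "(\<lambda>n. x + v * (1 / real (Suc n))) \<longlonglongrightarrow> x + v * 0"
          by (intro tendsto_intros LIMSEQ_Suc[OF lim_1_over_n])
        then show "(\<lambda>n. x + v / real (Suc n)) \<longlonglongrightarrow> x" by simp
      qed
    qed (use bound in \<open>auto intro!: AE_I2 mult_left_mono\<close>)
    then show ?thesis by (simp add: LINT_std_normal_density)
  qed
  have J_bound: "cmod (J n x) \<le> B" for n x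
  proof -
    have "cmod (J n x) \<le> (LINT v|lborel. std_normal_density v * B)"
      unfolding J_def
    proof (rule order_trans[OF Bochner_Integration.integral_norm_bound], rule integral_mono')
      show "cmod (std_normal_density v *\<^sub>R cnj (g (x + v / real (Suc n)))) \<le> std_normal_density v * B" for v
        using bound[of "x + v / real (Suc n)"] by (auto intro!: mult_left_mono)
    qed (use B in auto)
    then show ?thesis by (simp add: LINT_std_normal_density)
  qed
  have [measurable]: "J n \<in> borel_measurable borel" for n unfolding J_def by measurable
  have "(\<lambda>n. LINT x|lborel. g x * J n x) \<longlonglongrightarrow> (LINT x|lborel. g x * cnj (g x))"
  proof (rule integral_dominated_convergence[where w = "\<lambda>x. (B * B) * indicator {-R..R} x"])
    show "AE x in lborel. (\<lambda>n. g x * J n x) \<longlonglongrightarrow> g x * cnj (g x)"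
      using cont by eventually_elim (intro tendsto_intros J_lim)
    show "AE x in lborel. cmod (g x * J n x) \<le> (B * B) * indicator {-R..R} x" for n
    proof (intro AE_I2)
      fix x
      have "cmod (g x * J n x) \<le> (B * indicator {-R..R} x) * B"
        unfolding norm_mult by (intro mult_mono gB J_bound) (auto simp: B)
      then show "cmod (g x * J n x) \<le> (B * B) * indicator {-R..R} x" by (simp add: mult_ac)
    qed
  qed (use ind in auto)
  then have "(\<lambda>n. Re (of_real (2 * pi) * (LINT x|lborel. g x * J n x))) \<longlonglongrightarrow> Re (of_real (2 * pi) * (LINT x|lborel. g x * cnj (g x)))"
    by (intro tendsto_intros)
  moreover have "(LINT x|lborel. g x * cnj (g x)) = of_real (LINT x|lborel. (cmod (g x))\<^sup>2)"
    by (subst integral_complex_of_real[symmetric]) (simp only: complex_norm_square)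
  ultimately have lim: "(\<lambda>n. Re (of_real (2 * pi) * (LINT x|lborel. g x * J n x))) \<longlonglongrightarrow> 2 * pi * (LINT x|lborel. (cmod (g x))\<^sup>2)"
    by simp
  define w where "w n \<xi> = exp (- (\<xi> / real (Suc n))\<^sup>2 / 2)" for n \<xi>
  have w_eq: "w n \<xi> = sqrt (2 * pi) * std_normal_density (\<xi> / real (Suc n))" for n \<xi>
    unfolding w_def std_normal_density_def by simp
  have [measurable]: "w n \<in> borel_measurable borel" for n unfolding w_def by measurable
  have w_int: "integrable lborel (w n)" for n
  proof -
    have "integrable lborel (\<lambda>\<xi>. std_normal_density (0 + (1 / real (Suc n)) * \<xi>))"
      by (intro lborel_integrable_real_affine integrable_normal_density) auto
    then show ?thesis unfolding w_eq[abs_def]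
      by (intro Bochner_Integration.integrable_mult_right) simp
  qed
  define C where "C = (LINT x|lborel. cmod (g x))"
  have damped: "(\<integral>\<^sup>+\<xi>. ennreal (w n \<xi> * (cmod (fourier_int g \<xi>))\<^sup>2) \<partial>lborel)
      = ennreal (Re (of_real (2 * pi) * (LINT x|lborel. g x * J n x)))" for n
  proof -
    have "integrable lborel (\<lambda>\<xi>. w n \<xi> * (cmod (fourier_int g \<xi>))\<^sup>2)"
    proof (rule Bochner_Integration.integrable_bound[where f = "\<lambda>\<xi>. w n \<xi> * C\<^sup>2"])
      show "AE \<xi> in lborel. norm (w n \<xi> * (cmod (fourier_int g \<xi>))\<^sup>2) \<le> norm (w n \<xi> * C\<^sup>2)"
        using cmod_fourier_int_le[of g]
        by (intro AE_I2) (auto simp: C_def w_def abs_mult intro!: mult_left_mono power_mono)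
    qed (use w_int in auto)
    then have "(\<integral>\<^sup>+\<xi>. ennreal (w n \<xi> * (cmod (fourier_int g \<xi>))\<^sup>2) \<partial>lborel)
        = ennreal (LINT \<xi>|lborel. w n \<xi> * (cmod (fourier_int g \<xi>))\<^sup>2)"
      by (intro nn_integral_eq_integral) (auto simp: w_def)
    moreover have "Re (complex_of_real (LINT \<xi>|lborel. w n \<xi> * (cmod (fourier_int g \<xi>))\<^sup>2))
        = Re (of_real (2 * pi) * (LINT x|lborel. g x * J n x))"
    proof (rule arg_cong[of _ _ Re])
      have "complex_of_real (LINT \<xi>|lborel. w n \<xi> * (cmod (fourier_int g \<xi>))\<^sup>2)
          = (LINT \<xi>|lborel. of_real (sqrt (2 * pi) * std_normal_density (\<xi> / real (Suc n))) * (fourier_int g \<xi> * cnj (fourier_int g \<xi>)))"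
        unfolding complex_norm_square[symmetric]
        by (subst integral_complex_of_real[symmetric]) (simp add: w_eq)
      also have "\<dots> = of_real (2 * pi) * (LINT x|lborel. g x * J n x)"
        unfolding J_def by (rule fourier_int_gaussian_damped[OF int]) simp
      finally show "complex_of_real (LINT \<xi>|lborel. w n \<xi> * (cmod (fourier_int g \<xi>))\<^sup>2)
          = of_real (2 * pi) * (LINT x|lborel. g x * J n x)" .
    qed
    ultimately show ?thesis by simp
  qed
  have "incseq (\<lambda>n. ennreal (w n \<xi> * (cmod (fourier_int g \<xi>))\<^sup>2))" for \<xi>
  proof (intro incseq_SucI ennreal_leI mult_right_mono)
    fix n
    have "(\<xi> / real (Suc (Suc n)))\<^sup>2 \<le> (\<xi> / real (Suc n))\<^sup>2"
      unfolding power_divide by (rule divide_left_mono) (auto intro!: power_mono)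
    then show "w n \<xi> \<le> w (Suc n) \<xi>" by (simp add: w_def)
  qed auto
  moreover have "(\<lambda>n. ennreal (w n \<xi> * (cmod (fourier_int g \<xi>))\<^sup>2)) \<longlonglongrightarrow> ennreal ((cmod (fourier_int g \<xi>))\<^sup>2)" for \<xi>
  proof -
    have "(\<lambda>n. exp (- (\<xi> * (1 / real (Suc n)))\<^sup>2 / 2) * (cmod (fourier_int g \<xi>))\<^sup>2)
        \<longlonglongrightarrow> exp (- (\<xi> * 0)\<^sup>2 / 2) * (cmod (fourier_int g \<xi>))\<^sup>2"
      by (intro tendsto_intros LIMSEQ_Suc[OF lim_1_over_n]) auto
    then show ?thesis by (intro tendsto_ennrealI) (simp add: w_def)
  qed
  ultimately have "(\<lambda>n. \<integral>\<^sup>+\<xi>. ennreal (w n \<xi> * (cmod (fourier_int g \<xi>))\<^sup>2) \<partial>lborel)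
      \<longlonglongrightarrow> nsq_L2 lborel (fourier_int g)"
    unfolding nsq_L2_def
    by (intro nn_integral_LIMSEQ) (auto simp: incseq_def le_fun_def)
  moreover have "(\<lambda>n. \<integral>\<^sup>+\<xi>. ennreal (w n \<xi> * (cmod (fourier_int g \<xi>))\<^sup>2) \<partial>lborel)
      \<longlonglongrightarrow> ennreal (2 * pi * (LINT x|lborel. (cmod (g x))\<^sup>2))"
    unfolding damped by (intro tendsto_ennrealI lim)
  ultimately have "nsq_L2 lborel (fourier_int g) = ennreal (2 * pi * (LINT x|lborel. (cmod (g x))\<^sup>2))"
    by (rule LIMSEQ_unique)
  moreover have "nsq_L2 lborel g = ennreal (LINT x|lborel. (cmod (g x))\<^sup>2)"
    unfolding nsq_L2_def
  proof (intro nn_integral_eq_integral)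
    have "norm ((cmod (g x))\<^sup>2) \<le> (B * B) * indicator {-R..R} x" for x
      using mult_mono[OF gB[of x] gB[of x]] B by (auto simp: power2_eq_square indicator_def split: if_splits)
    then show "integrable lborel (\<lambda>x. (cmod (g x))\<^sup>2)"
      by (intro Bochner_Integration.integrable_bound[OF ind[of "B * B"]]) (auto intro!: AE_I2 order_trans[OF _ abs_ge_self])
  qed auto
  ultimately show ?thesis by (simp add: ennreal_mult)
qed

definition truncate :: "real \<Rightarrow> (real \<Rightarrow> complex) \<Rightarrow> real \<Rightarrow> complex" where
  "truncate R f x = (if \<bar>x\<bar> \<le> R then f x else 0)"

lemma truncate_measurable [measurable]:
  assumes [measurable]: "f \<in> borel_measurable borel"
  shows "truncate R f \<in> borel_measurable borel"
  unfolding truncate_def by measurable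

lemma fourier_int_truncate:
  "fourier_int (truncate R f) \<xi> = (LINT x:{-R..R}|lborel. f x * cis (- (x * \<xi>)))"
  unfolding fourier_int_def set_lebesgue_integral_def truncate_def
  by (intro Bochner_Integration.integral_cong) (auto simp: indicator_def)

lemma integrable_truncate:
  assumes "continuous_on UNIV f"
  shows "integrable lborel (truncate R f)"
proof -
  have "integrable lborel (\<lambda>x. indicator {-R..R} x *\<^sub>R f x)"
    by (intro borel_integrable_compact continuous_on_subset[OF assms]) auto
  also have "(\<lambda>x. indicator {-R..R} x *\<^sub>R f x) = truncate R f"
    by (auto simp: truncate_def indicator_def fun_eq_iff)
  finally show ?thesis .
qed

lemma isCont_truncate:
  assumes "continuous_on UNIV f" "\<bar>x\<bar> \<noteq> R"
  shows "isCont (truncate R f) x"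
proof (cases "\<bar>x\<bar> < R")
  case True
  have "eventually (\<lambda>y. y \<in> {-R<..<R}) (nhds x)"
    using True by (intro eventually_nhds_in_open) (auto simp: abs_less_iff)
  then have "eventually (\<lambda>y. truncate R f y = f y) (nhds x)"
    by eventually_elim (auto simp: truncate_def)
  moreover have "isCont f x" using assms(1) continuous_on_eq_continuous_at open_UNIV by blast
  ultimately show ?thesis by (simp add: isCont_cong)
next
  case False
  then have "x \<in> - {-R..R}" using assms(2) by auto
  then have "eventually (\<lambda>y. y \<in> - {-R..R}) (nhds x)"
    by (intro eventually_nhds_in_open) auto
  then have "eventually (\<lambda>y. truncate R f y = 0) (nhds x)"
    by eventually_elim (auto simp: truncate_def abs_le_iff)
  then show ?thesis using isCont_cong[of "truncate R f" "\<lambda>y. 0" x] by simp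
qed

lemma fourier_int_diff:
  assumes "integrable lborel f" "integrable lborel g"
  shows "fourier_int (\<lambda>x. f x - g x) \<xi> = fourier_int f \<xi> - fourier_int g \<xi>"
proof -
  have "integrable lborel (\<lambda>x. f x * cis (- (x * \<xi>)))" if "integrable lborel f" for f
  proof (rule Bochner_Integration.integrable_bound[OF that])
    have [measurable]: "f \<in> borel_measurable borel" using borel_measurable_integrable[OF that] by simp
    show "(\<lambda>x. f x * cis (- (x * \<xi>))) \<in> borel_measurable lborel"
      unfolding cis_conv_exp by measurable
  qed (simp add: norm_mult)
  with assms show ?thesis
    unfolding fourier_int_def by (simp add: left_diff_distrib Bochner_Integration.integral_diff)
qed

lemma bounded_truncate:
  assumes "continuous_on UNIV f"
  obtains B where "\<And>x. cmod (truncate R f x) \<le> B"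
proof -
  have "compact (f ` {-R..R})"
    by (intro compact_continuous_image continuous_on_subset[OF assms]) auto
  then obtain B where B: "\<And>y. y \<in> f ` {-R..R} \<Longrightarrow> cmod y \<le> B"
    using compact_imp_bounded bounded_iff by metis
  have "cmod (truncate R f x) \<le> max B 0" for x
    unfolding truncate_def using B[of "f x"] by (auto simp: abs_le_iff)
  then show ?thesis by (rule that)
qed

lemma AE_neq_abs: "AE x in lborel. \<bar>x\<bar> \<noteq> (R::real)"
proof -
  have "AE x in lborel. x \<noteq> R" "AE x in lborel. x \<noteq> -R"
    by (rule AE_lborel_singleton)+
  then show ?thesis by eventually_elim auto
qed

lemma Plancherel_truncate_diff:
  assumes f: "continuous_on UNIV f"
  shows "nsq_L2 lborel (\<lambda>\<xi>. fourier_int (truncate R f) \<xi> - fourier_int (truncate S f) \<xi>)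
       = ennreal (2 * pi) * nsq_L2 lborel (\<lambda>x. truncate R f x - truncate S f x)"
proof -
  have [measurable]: "f \<in> borel_measurable borel" using f by (rule borel_measurable_continuous_onI)
  obtain A B where AB: "\<And>x. cmod (truncate R f x) \<le> A" "\<And>x. cmod (truncate S f x) \<le> B"
    using bounded_truncate[OF f] by metis
  have "nsq_L2 lborel (fourier_int (\<lambda>x. truncate R f x - truncate S f x))
       = ennreal (2 * pi) * nsq_L2 lborel (\<lambda>x. truncate R f x - truncate S f x)"
  proof (rule Plancherel_bounded_support)
    show "cmod (truncate R f x - truncate S f x) \<le> A + B" for x
      using norm_triangle_ineq4 AB by (meson add_mono order_trans)
    show "truncate R f x - truncate S f x = 0" if "x \<notin> {- max R S..max R S}" for x
      using that by (auto simp: truncate_def)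
    show "AE x in lborel. isCont (\<lambda>x. truncate R f x - truncate S f x) x"
      using AE_neq_abs[of R] AE_neq_abs[of S]
      by eventually_elim (intro continuous_intros isCont_truncate f)
  qed measurable
  then show ?thesis
    by (simp add: fourier_int_diff[OF integrable_truncate[OF f] integrable_truncate[OF f], abs_def])
qed

lemma nsq_L2_truncate_tail:
  assumes f: "continuous_on UNIV f" and fin: "nsq_L2 lborel f < \<infinity>"
  shows "((\<lambda>R. nsq_L2 lborel (\<lambda>x. truncate R f x - f x)) \<longlongrightarrow> 0) at_top"
  unfolding tendsto_0_ennreal_iff
proof (intro allI impI)
  fix e :: real assume "e > 0"
  have [measurable]: "f \<in> borel_measurable borel" using f by (rule borel_measurable_continuous_onI)
  have "(\<lambda>n. nsq_L2 lborel (\<lambda>x. truncate (real n) f x - f x)) \<longlonglongrightarrow> (\<integral>\<^sup>+x. 0 \<partial>(lborel :: real measure))"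
    unfolding nsq_L2_def
  proof (rule nn_integral_dominated_convergence[where w = "\<lambda>x. ennreal ((cmod (f x))\<^sup>2)"])
    show "AE x in lborel. ennreal ((cmod (truncate (real n) f x - f x))\<^sup>2) \<le> ennreal ((cmod (f x))\<^sup>2)" for n
      by (intro AE_I2 ennreal_leI) (auto simp: truncate_def)
    show "AE x in lborel. (\<lambda>n. ennreal ((cmod (truncate (real n) f x - f x))\<^sup>2)) \<longlonglongrightarrow> 0"
    proof (intro AE_I2 tendsto_eventually)
      fix x
      have "eventually (\<lambda>n. \<bar>x\<bar> \<le> real n) sequentially"
        using eventually_ge_at_top[of "nat \<lceil>\<bar>x\<bar>\<rceil>"] by eventually_elim linarith
      then show "eventually (\<lambda>n. ennreal ((cmod (truncate (real n) f x - f x))\<^sup>2) = 0) sequentially"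
        by eventually_elim (simp add: truncate_def)
    qed
  qed (use fin in \<open>auto simp: nsq_L2_def\<close>)
  then have "(\<lambda>n. nsq_L2 lborel (\<lambda>x. truncate (real n) f x - f x)) \<longlonglongrightarrow> 0" by simp
  then have "eventually (\<lambda>n. nsq_L2 lborel (\<lambda>x. truncate (real n) f x - f x) \<le> ennreal e) sequentially"
    using \<open>e > 0\<close> unfolding tendsto_0_ennreal_iff by blast
  then obtain N where N: "nsq_L2 lborel (\<lambda>x. truncate (real N) f x - f x) \<le> ennreal e"
    by (auto simp: eventually_sequentially)
  show "eventually (\<lambda>R. nsq_L2 lborel (\<lambda>x. truncate R f x - f x) \<le> ennreal e) at_top"
    using eventually_ge_at_top[of "real N"]
  proof eventually_elim
    case (elim R)
    have "nsq_L2 lborel (\<lambda>x. truncate R f x - f x) \<le> nsq_L2 lborel (\<lambda>x. truncate (real N) f x - f x)"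
      unfolding nsq_L2_def using elim by (intro nn_integral_mono ennreal_leI) (auto simp: truncate_def)
    then show ?case using N by simp
  qed
qed

lemma is_fourier_L2_iff:
  "is_fourier_L2 f g \<longleftrightarrow> in_L2 lborel g \<and>
     ((\<lambda>R. nsq_L2 lborel (\<lambda>\<xi>. fourier_int (truncate R f) \<xi> - g \<xi>)) \<longlongrightarrow> 0) at_top"
  unfolding is_fourier_L2_def fourier_int_truncate ..

text \<open>By the isometry on truncations, the transforms of the truncations form a Cauchy net, so
  completeness of \<open>L\<^sup>2\<close> yields the transform, and the isometry survives the limit.\<close>

theorem Plancherel:
  assumes f: "continuous_on UNIV f" and fin: "nsq_L2 lborel f < \<infinity>"
  shows "\<exists>g. is_fourier_L2 f g \<and> nsq_L2 lborel g = ennreal (2 * pi) * nsq_L2 lborel f"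
proof -
  have [measurable]: "f \<in> borel_measurable borel" using f by (rule borel_measurable_continuous_onI)
  have isom: "nsq_L2 lborel (fourier_int (truncate R f)) = ennreal (2 * pi) * nsq_L2 lborel (truncate R f)" for R
  proof -
    have zero: "fourier_int (\<lambda>x. 0) \<xi> = 0" for \<xi> by (simp add: fourier_int_def)
    have "truncate (-1) f = (\<lambda>x. 0)" by (auto simp: truncate_def fun_eq_iff)
    then show ?thesis
      using Plancherel_truncate_diff[OF f, of R "-1"] zero by simp
  qed
  have le: "nsq_L2 lborel (truncate R f) \<le> nsq_L2 lborel f" for R
    unfolding nsq_L2_def by (intro nn_integral_mono ennreal_leI) (auto simp: truncate_def)
  obtain g where g: "in_L2 lborel g"
    "((\<lambda>R. nsq_L2 lborel (\<lambda>\<xi>. fourier_int (truncate R f) \<xi> - g \<xi>)) \<longlongrightarrow> 0) at_top"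
  proof (rule L2_complete[of at_top "\<lambda>R. fourier_int (truncate R f)" lborel])
    show "eventually (\<lambda>R. nsq_L2 lborel (fourier_int (truncate R f)) < \<infinity>) at_top"
      using le fin by (intro always_eventually allI)
        (auto simp: isom ennreal_mult_less_top intro: le_less_trans)
    fix e :: real assume "e > 0"
    define P where "P R \<longleftrightarrow> nsq_L2 lborel (\<lambda>x. truncate R f x - f x) \<le> ennreal (e / (8 * pi))" for R
    have "eventually P at_top"
      using nsq_L2_truncate_tail[OF f fin] \<open>e > 0\<close> unfolding tendsto_0_ennreal_iff P_def[abs_def] by auto
    moreover have "nsq_L2 lborel (\<lambda>\<xi>. fourier_int (truncate R f) \<xi> - fourier_int (truncate S f) \<xi>) \<le> ennreal e"
      if "P R" "P S" for R S
    proof -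
      have "nsq_L2 lborel (\<lambda>\<xi>. fourier_int (truncate R f) \<xi> - fourier_int (truncate S f) \<xi>)
          = ennreal (2 * pi) * nsq_L2 lborel (\<lambda>x. truncate R f x - truncate S f x)"
        by (rule Plancherel_truncate_diff[OF f])
      also have "\<dots> \<le> ennreal (2 * pi) * (2 * nsq_L2 lborel (\<lambda>x. truncate R f x - f x) + 2 * nsq_L2 lborel (\<lambda>x. f x - truncate S f x))"
        by (intro mult_left_mono nsq_L2_triangle) auto
      also have "\<dots> \<le> ennreal (2 * pi) * (ennreal 2 * ennreal (e / (8 * pi)) + ennreal 2 * ennreal (e / (8 * pi)))"
        using that unfolding P_def nsq_L2_minus[of lborel f]
        by (simp, intro mult_left_mono add_mono) auto
      also have "\<dots> = ennreal e"
        using \<open>e > 0\<close> by (simp add: ennreal_mult[symmetric] ennreal_plus[symmetric] field_simps del: ennreal_plus ennreal_numeral)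
      finally show ?thesis .
    qed
    ultimately show "\<exists>P. eventually P at_top \<and> (\<forall>R S. P R \<longrightarrow> P S \<longrightarrow>
        nsq_L2 lborel (\<lambda>\<xi>. fourier_int (truncate R f) \<xi> - fourier_int (truncate S f) \<xi>) \<le> ennreal e)"
      by blast
  qed auto
  define N where "N = enn2real (nsq_L2 lborel f)"
  have N: "nsq_L2 lborel f = ennreal N" "0 \<le> N" using fin by (auto simp: N_def)
  have "nsq_L2 lborel g = ennreal (2 * pi * N)"
  proof (rule nsq_L2_tendsto_norm[of sequentially "\<lambda>n. fourier_int (truncate (real n) f)"])
    show "(\<lambda>n. nsq_L2 lborel (\<lambda>\<xi>. fourier_int (truncate (real n) f) \<xi> - g \<xi>)) \<longlonglongrightarrow> 0"
      by (rule filterlim_compose[OF g(2) filterlim_real_sequentially])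
    have "(\<lambda>n. nsq_L2 lborel (truncate (real n) f)) \<longlonglongrightarrow> nsq_L2 lborel f"
      unfolding nsq_L2_def
    proof (rule nn_integral_LIMSEQ)
      show "incseq (\<lambda>n x. ennreal ((cmod (truncate (real n) f x))\<^sup>2))"
        by (intro incseq_SucI le_funI ennreal_leI) (auto simp: truncate_def)
      show "(\<lambda>n. ennreal ((cmod (truncate (real n) f x))\<^sup>2)) \<longlonglongrightarrow> ennreal ((cmod (f x))\<^sup>2)" for x
      proof (rule tendsto_eventually)
        have "eventually (\<lambda>n. \<bar>x\<bar> \<le> real n) sequentially"
          using eventually_ge_at_top[of "nat \<lceil>\<bar>x\<bar>\<rceil>"] by eventually_elim linarith
        then show "eventually (\<lambda>n. ennreal ((cmod (truncate (real n) f x))\<^sup>2) = ennreal ((cmod (f x))\<^sup>2)) sequentially"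
          by eventually_elim (simp add: truncate_def)
      qed
    qed auto
    then have "(\<lambda>n. ennreal (2 * pi) * nsq_L2 lborel (truncate (real n) f)) \<longlonglongrightarrow> ennreal (2 * pi) * ennreal N"
      unfolding N(1) by (intro ennreal_tendsto_cmult) auto
    then show "(\<lambda>n. nsq_L2 lborel (fourier_int (truncate (real n) f))) \<longlonglongrightarrow> ennreal (2 * pi * N)"
      using N(2) unfolding isom by (simp add: ennreal_mult)
  qed (use g N in \<open>auto simp: in_L2_def\<close>)
  with g N show ?thesis
    unfolding is_fourier_L2_iff by (intro exI[of _ g]) (simp add: ennreal_mult)
qed

lemma is_fourier_L2_unique:
  assumes [measurable]: "f \<in> borel_measurable borel"
    and "is_fourier_L2 f g" "is_fourier_L2 f h"
  shows "AE \<xi> in lborel. g \<xi> = h \<xi>"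
  using assms(2,3) unfolding is_fourier_L2_iff in_L2_def
  by (intro nsq_L2_limit_unique[of at_top "\<lambda>R. fourier_int (truncate R f)"]) auto

lemma is_fourier_L2_diff:
  assumes f: "continuous_on UNIV f" and f': "continuous_on UNIV f'"
    and "is_fourier_L2 f g" "is_fourier_L2 f' g'"
  shows "is_fourier_L2 (\<lambda>x. f x - f' x) (\<lambda>\<xi>. g \<xi> - g' \<xi>)"
  unfolding is_fourier_L2_iff
proof
  have [measurable]: "f \<in> borel_measurable borel" "f' \<in> borel_measurable borel"
    "g \<in> borel_measurable borel" "g' \<in> borel_measurable borel"
    using f f' assms(3,4) by (auto intro: borel_measurable_continuous_onI simp: is_fourier_L2_def in_L2_def)
  show "in_L2 lborel (\<lambda>\<xi>. g \<xi> - g' \<xi>)"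
    using assms(3,4) by (intro in_L2_diff) (auto simp: is_fourier_L2_def)
  let ?T = "\<lambda>f R. fourier_int (truncate R f)"
  have T: "?T (\<lambda>x. f x - f' x) R \<xi> = ?T f R \<xi> - ?T f' R \<xi>" for R \<xi>
  proof -
    have "truncate R (\<lambda>x. f x - f' x) = (\<lambda>x. truncate R f x - truncate R f' x)"
      by (auto simp: truncate_def fun_eq_iff)
    then show ?thesis
      by (simp add: fourier_int_diff integrable_truncate f f')
  qed
  show "((\<lambda>R. nsq_L2 lborel (\<lambda>\<xi>. ?T (\<lambda>x. f x - f' x) R \<xi> - (g \<xi> - g' \<xi>))) \<longlongrightarrow> 0) at_top"
  proof (rule tendsto_0_ennreal_le)
    show "((\<lambda>R. 2 * nsq_L2 lborel (\<lambda>\<xi>. ?T f R \<xi> - g \<xi>) + 2 * nsq_L2 lborel (\<lambda>\<xi>. ?T f' R \<xi> - g' \<xi>)) \<longlongrightarrow> 0) at_top"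
      using assms(3,4) unfolding is_fourier_L2_iff
      by (intro tendsto_0_ennreal_add tendsto_0_ennreal_cmult) auto
    have "nsq_L2 lborel (\<lambda>\<xi>. ?T (\<lambda>x. f x - f' x) R \<xi> - (g \<xi> - g' \<xi>))
        \<le> 2 * nsq_L2 lborel (\<lambda>\<xi>. ?T f R \<xi> - g \<xi>) + 2 * nsq_L2 lborel (\<lambda>\<xi>. ?T f' R \<xi> - g' \<xi>)" for R
      using nsq_L2_diff_le[of "\<lambda>\<xi>. ?T f R \<xi> - g \<xi>" lborel "\<lambda>\<xi>. ?T f' R \<xi> - g' \<xi>"]
      by (simp add: T algebra_simps)
    then show "eventually (\<lambda>R. nsq_L2 lborel (\<lambda>\<xi>. ?T (\<lambda>x. f x - f' x) R \<xi> - (g \<xi> - g' \<xi>))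
        \<le> 2 * nsq_L2 lborel (\<lambda>\<xi>. ?T f R \<xi> - g \<xi>) + 2 * nsq_L2 lborel (\<lambda>\<xi>. ?T f' R \<xi> - g' \<xi>)) at_top"
      by simp
  qed
qed

lemma Plancherel_is_fourier_L2:
  assumes f: "continuous_on UNIV f" and fin: "nsq_L2 lborel f < \<infinity>" and g: "is_fourier_L2 f g"
  shows "nsq_L2 lborel g = ennreal (2 * pi) * nsq_L2 lborel f"
proof -
  obtain h where h: "is_fourier_L2 f h" "nsq_L2 lborel h = ennreal (2 * pi) * nsq_L2 lborel f"
    using Plancherel[OF f fin] by blast
  have "AE \<xi> in lborel. g \<xi> = h \<xi>"
    using f by (intro is_fourier_L2_unique[OF _ g h(1)] borel_measurable_continuous_onI)
  with h(2) show ?thesis by (simp add: nsq_L2_cong_AE)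
qed

lemma is_fourier_L2_fourier_L2:
  assumes "continuous_on UNIV f" "nsq_L2 lborel f < \<infinity>"
  shows "is_fourier_L2 f (fourier_L2 f)"
  unfolding fourier_L2_def using Plancherel[OF assms] by (metis someI_ex)

section \<open>The Hardy space of the strip\<close>

lemma contour_integral_linepath_same_Im:
  assumes "Im z = c" "Im z' = c" "Re z = a" "Re z' = b" "a < b"
  shows "contour_integral (linepath z z') f = integral {a..b} (\<lambda>x. f (Complex x c))"
proof -
  have zz': "z = Complex a c" "z' = Complex b c"
    using assms by (auto simp: complex_eq_iff)
  have "contour_integral (linepath z z') f =
         (z' - z) * integral {0..1} (\<lambda>x. f (linepath z z' x))"
    by (simp add: contour_integral_integral)
  also have "z' - z = of_real (b - a)"
    by (simp add: zz' Complex_eq)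
  also have "integral {0..1} (\<lambda>x. f (linepath z z' x)) =
             integral {0..(b - a) / (b - a)} (\<lambda>x. f (Complex (a + (b - a) * x) c))"
    using \<open>a < b\<close> by (simp add: linepath_def Complex_eq scaleR_conv_of_real algebra_simps zz')
  also have "{0..(b - a) / (b - a)} = (\<lambda>x. x / (b - a)) ` {0..b - a}"
    using \<open>a < b\<close> by simp
  also have "integral \<dots> (\<lambda>x. f (Complex (a + (b - a) * x) c)) =
             integral {a - a..b - a} (\<lambda>x. f (Complex (x + a) c)) / of_real (b - a)"
    using \<open>a < b\<close> by (subst integral_stretch_real) (auto simp: scaleR_conv_of_real add_ac)
  also have "\<dots> = integral {a..b} (\<lambda>x. f (Complex x c)) / of_real (b - a)"
    by (subst integral_shift_real_ivl) (rule refl)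
  finally show ?thesis
    using \<open>a < b\<close> by simp
qed

lemma contour_integral_rectpath:
  assumes x: "x1 < x2" and y: "y1 < y2"
    and F: "continuous_on (path_image (rectpath (Complex x1 y1) (Complex x2 y2))) F"
  shows "contour_integral (rectpath (Complex x1 y1) (Complex x2 y2)) F =
      integral {x1..x2} (\<lambda>x. F (Complex x y1)) + \<i> * integral {y1..y2} (\<lambda>y. F (Complex x2 y))
      - integral {x1..x2} (\<lambda>x. F (Complex x y2)) - \<i> * integral {y1..y2} (\<lambda>y. F (Complex x1 y))"
proof -
  let ?a = "Complex x1 y1" and ?b = "Complex x2 y1" and ?c = "Complex x2 y2" and ?d = "Complex x1 y2"
  have "path_image (rectpath ?a ?c)
      = closed_segment ?a ?b \<union> (closed_segment ?b ?c \<union> (closed_segment ?c ?d \<union> closed_segment ?d ?a))"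
    by (simp add: rectpath_def Let_def path_image_join)
  with F have c: "continuous_on (closed_segment ?a ?b) F" "continuous_on (closed_segment ?b ?c) F"
    "continuous_on (closed_segment ?c ?d) F" "continuous_on (closed_segment ?d ?a) F"
    by (auto elim!: continuous_on_subset)
  note i = c[THEN contour_integrable_continuous_linepath]
  have "contour_integral (rectpath ?a ?c) F = contour_integral (linepath ?a ?b) F
      + (contour_integral (linepath ?b ?c) F + (contour_integral (linepath ?c ?d) F + contour_integral (linepath ?d ?a) F))"
    unfolding rectpath_def Let_def using i
    by (simp add: contour_integral_join contour_integrable_join)
  moreover have "contour_integral (linepath ?c ?d) F = - contour_integral (linepath ?d ?c) F"
    "contour_integral (linepath ?d ?a) F = - contour_integral (linepath ?a ?d) F"
    using c by (auto intro: contour_integral_reverse_linepath)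
  ultimately show ?thesis
    using x y
    by (simp add: contour_integral_linepath_same_Im[of _ y1 _ x1 x2] contour_integral_linepath_same_Im[of _ y2 _ x1 x2]
        contour_integral_linepath_same_Re[of _ x1 _ y1 y2] contour_integral_linepath_same_Re[of _ x2 _ y1 y2])
qed

lemma integral_le_of_nn_integral:
  fixes a b :: real
  assumes k: "continuous_on {a..b} k" "\<And>x. x \<in> {a..b} \<Longrightarrow> (0::real) \<le> k x"
    and le: "(\<integral>\<^sup>+x. ennreal (k x) * indicator {a..b} x \<partial>lborel) \<le> ennreal N" and "0 \<le> N"
  shows "integral {a..b} k \<le> N"
proof -
  have "(\<integral>\<^sup>+x. ennreal (k x) * indicator {a..b} x \<partial>lborel) = ennreal (integral {a..b} k)"
    using k by (intro nn_integral_has_integral_lebesgue' integrable_integral integrable_continuous_interval) auto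
  with le \<open>0 \<le> N\<close> show ?thesis by (simp add: ennreal_le_iff)
qed

text \<open>By Tonelli, the squared norm of \<open>f\<close> on the vertical segment with abscissa \<open>x\<close> is an integrable
  function of \<open>x\<close>, so it is small for arbitrarily large \<open>\<bar>x\<bar>\<close>, on both sides at once. This is what
  makes contour integrals over long rectangles lose their vertical sides.\<close>

lemma exists_good_radius:
  assumes f: "continuous_on {z. a \<le> Im z \<and> Im z \<le> b} f"
    and N: "\<And>\<eta>. \<eta> \<in> {a..b} \<Longrightarrow> nsq_L2 lborel (\<lambda>x. f (Complex x \<eta>)) \<le> ennreal N"
    and "a \<le> b" "e > 0"
  shows "\<exists>R\<ge>R0. integral {a..b} (\<lambda>\<eta>. (cmod (f (Complex (x0 + R) \<eta>)))\<^sup>2)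
               + integral {a..b} (\<lambda>\<eta>. (cmod (f (Complex (x0 - R) \<eta>)))\<^sup>2) \<le> e"
proof (rule ccontr)
  assume neg: "\<not> ?thesis"
  define S where "S = {z. a \<le> Im z \<and> Im z \<le> b}"
  define h where "h z = indicator S z *\<^sub>R f z" for z
  have "closed S" unfolding S_def
    by (intro closed_Collect_conj closed_Collect_le continuous_intros)
  then have "h \<in> borel_measurable borel"
    unfolding h_def[abs_def] using f by (intro borel_measurable_continuous_on_indicator) (auto simp: S_def borel_closed)
  then have meas_h: "(\<lambda>z. ennreal ((cmod (h z))\<^sup>2)) \<in> borel_measurable borel" by measurable
  have "(\<lambda>(x, y). Complex x y) \<in> borel_measurable borel"
    unfolding Complex_eq split_beta by (intro borel_measurable_continuous_onI continuous_intros)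
  then have C: "(\<lambda>(x, y). Complex x y) \<in> borel_measurable (borel \<Otimes>\<^sub>M borel)"
    by (simp add: borel_prod)
  have [measurable]: "(\<lambda>(x, \<eta>). ennreal ((cmod (h (Complex x \<eta>)))\<^sup>2)) \<in> borel_measurable (borel \<Otimes>\<^sub>M borel)"
    using measurable_compose[OF C meas_h] by (simp add: split_beta)
  define \<Phi> where "\<Phi> x = (\<integral>\<^sup>+\<eta>. ennreal ((cmod (h (Complex x \<eta>)))\<^sup>2) \<partial>lborel)" for x
  have [measurable]: "\<Phi> \<in> borel_measurable borel" unfolding \<Phi>_def by measurable
  have h_eq: "ennreal ((cmod (h (Complex x \<eta>)))\<^sup>2) = ennreal ((cmod (f (Complex x \<eta>)))\<^sup>2) * indicator {a..b} \<eta>" for x \<eta>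
    by (auto simp: h_def S_def indicator_def)
  have \<Phi>: "\<Phi> x = ennreal (integral {a..b} (\<lambda>\<eta>. (cmod (f (Complex x \<eta>)))\<^sup>2))" for x
  proof -
    have "continuous_on {a..b} (\<lambda>\<eta>. (cmod (f (Complex x \<eta>)))\<^sup>2)"
      by (intro continuous_intros continuous_on_compose2[OF f]) (auto simp: Complex_eq intro!: continuous_intros)
    then show ?thesis
      unfolding \<Phi>_def h_eq
      by (intro nn_integral_has_integral_lebesgue' integrable_integral integrable_continuous_interval) auto
  qed
  have "(\<integral>\<^sup>+x. \<Phi> x \<partial>lborel) = (\<integral>\<^sup>+\<eta>. \<integral>\<^sup>+x. ennreal ((cmod (h (Complex x \<eta>)))\<^sup>2) \<partial>lborel \<partial>lborel)"
    unfolding \<Phi>_def by (intro lborel_pair.Fubini') measurable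
  also have "\<dots> \<le> (\<integral>\<^sup>+\<eta>. ennreal N * indicator {a..b} \<eta> \<partial>lborel)"
    unfolding h_eq using N
    by (intro nn_integral_mono) (auto simp: indicator_def nsq_L2_def)
  also have "\<dots> < \<infinity>"
    using \<open>a \<le> b\<close> by (simp add: nn_integral_cmult ennreal_mult_less_top)
  finally have fin: "(\<integral>\<^sup>+x. \<Phi> x \<partial>lborel) < \<infinity>" .
  \<comment> \<open>Without good radii, the integral of \<open>\<Phi>\<close> over both half lines would be infinite.\<close>
  have "ennreal e * emeasure lborel {R0..} = (\<integral>\<^sup>+R. ennreal e * indicator {R0..} R \<partial>lborel)"
    by (simp add: nn_integral_cmult)
  also have "\<dots> \<le> (\<integral>\<^sup>+R. \<Phi> (x0 + 1 * R) + \<Phi> (x0 + (-1) * R) \<partial>lborel)"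
  proof (intro nn_integral_mono)
    fix R
    show "ennreal e * indicator {R0..} R \<le> \<Phi> (x0 + 1 * R) + \<Phi> (x0 + (-1) * R)"
    proof (cases "R \<ge> R0")
      case True
      with neg have "e \<le> integral {a..b} (\<lambda>\<eta>. (cmod (f (Complex (x0 + R) \<eta>)))\<^sup>2)
               + integral {a..b} (\<lambda>\<eta>. (cmod (f (Complex (x0 - R) \<eta>)))\<^sup>2)" by force
      then show ?thesis using True unfolding \<Phi>
        by (subst ennreal_plus[symmetric]) (auto intro!: integral_nonneg ennreal_leI Henstock_Kurzweil_Integration.integral_nonneg
              integrable_continuous_interval continuous_intros continuous_on_compose2[OF f] simp: Complex_eq)
    qed auto
  qed
  also have "\<dots> = (\<integral>\<^sup>+R. \<Phi> (x0 + 1 * R) \<partial>lborel) + (\<integral>\<^sup>+R. \<Phi> (x0 + (-1) * R) \<partial>lborel)"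
    by (intro nn_integral_add) auto
  also have "\<dots> = (\<integral>\<^sup>+x. \<Phi> x \<partial>lborel) + (\<integral>\<^sup>+x. \<Phi> x \<partial>lborel)"
    using nn_integral_real_affine[of \<Phi> 1 x0] nn_integral_real_affine[of \<Phi> "-1" x0] by simp
  also have "\<dots> < \<infinity>" using fin by simp
  finally have "ennreal e * emeasure lborel {R0..} < \<infinity>" .
  then have "emeasure lborel {R0..} < \<infinity>"
    using \<open>e > 0\<close> by (auto simp: ennreal_mult_less_top)
  then obtain K where K: "emeasure lborel {R0..} = ennreal K" "0 \<le> K"
    by (cases "emeasure lborel {R0..}") auto
  have "ennreal (K + 1) = emeasure lborel {R0..R0 + (K + 1)}" using K(2) by simp
  also have "\<dots> \<le> emeasure lborel {R0..}" by (intro emeasure_mono) auto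
  finally show False using K by simp
qed

lemma open_strip: "open (strip \<beta>)"
  unfolding strip_def by (intro open_Collect_less continuous_intros)

lemma convex_strip: "convex (strip \<beta>)"
proof -
  have "strip \<beta> = {w. Im w < \<beta>} \<inter> {w. Im w > - \<beta>}" by (auto simp: strip_def)
  then show ?thesis by (simp add: convex_Int convex_halfspace_Im_lt convex_halfspace_Im_gt)
qed

lemma strip_line_continuous:
  assumes "f holomorphic_on strip \<beta>" "\<bar>y\<bar> < \<beta>"
  shows "continuous_on A (\<lambda>x. f (Complex x y))"
  by (rule continuous_on_compose2[OF holomorphic_on_imp_continuous_on[OF assms(1)]])
     (use assms(2) in \<open>auto simp: strip_def Complex_eq intro!: continuous_intros\<close>)

lemma integral_le_nsq_L2:
  fixes f :: "real \<Rightarrow> complex"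
  assumes "continuous_on UNIV f" "nsq_L2 lborel f \<le> ennreal N" "0 \<le> N"
  shows "integral {a..b} (\<lambda>x. (cmod (f x))\<^sup>2) \<le> N"
proof (rule integral_le_of_nn_integral)
  show "(\<integral>\<^sup>+x. ennreal ((cmod (f x))\<^sup>2) * indicator {a..b} x \<partial>lborel) \<le> ennreal N"
    using assms(2) unfolding nsq_L2_def
    by (intro order_trans[OF _ assms(2)[unfolded nsq_L2_def]] nn_integral_mono) (auto simp: indicator_def)
qed (use assms in \<open>auto intro!: continuous_intros intro: continuous_on_subset\<close>)

text \<open>Cauchy's formula for \<open>f\<^sup>2\<close> on the rectangle of half height \<open>\<delta>\<close> around the point: the horizontal
  sides contribute at most \<open>N / \<delta>\<close> each, and the vertical sides vanish along good radii. Using the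
  square of \<open>f\<close> makes the contour integral directly comparable with the line norms.\<close>

lemma strip_point_bound:
  assumes f: "f holomorphic_on strip \<beta>" and \<delta>: "\<delta> > 0" "\<bar>y\<bar> + \<delta> < \<beta>" and "0 \<le> N"
    and N: "\<And>\<eta>. \<eta> \<in> {y - \<delta>..y + \<delta>} \<Longrightarrow> nsq_L2 lborel (\<lambda>x. f (Complex x \<eta>)) \<le> ennreal N"
  shows "(cmod (f (Complex x y)))\<^sup>2 \<le> N / (pi * \<delta>)"
proof -
  have "2 * pi * (cmod (f (Complex x y)))\<^sup>2 \<le> 2 * N / \<delta> + e" if "e > 0" for e
  proof -
    define z where "z = Complex x y"
    define S where "S = {z. y - \<delta> \<le> Im z \<and> Im z \<le> y + \<delta>}"
    have S: "S \<subseteq> strip \<beta>" using \<delta> by (auto simp: S_def strip_def)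
    have cS: "continuous_on S f"
      using f S by (intro holomorphic_on_imp_continuous_on) (rule holomorphic_on_subset)
    obtain R where R: "R \<ge> 1" "integral {y - \<delta>..y + \<delta>} (\<lambda>\<eta>. (cmod (f (Complex (x + R) \<eta>)))\<^sup>2)
               + integral {y - \<delta>..y + \<delta>} (\<lambda>\<eta>. (cmod (f (Complex (x - R) \<eta>)))\<^sup>2) \<le> e"
      using exists_good_radius[OF cS[unfolded S_def] N, of e 1 x] \<delta> \<open>e > 0\<close> by auto
    define p where "p = rectpath (Complex (x - R) (y - \<delta>)) (Complex (x + R) (y + \<delta>))"
    have z_box: "z \<in> box (Complex (x - R) (y - \<delta>)) (Complex (x + R) (y + \<delta>))"
      using R(1) \<delta> by (auto simp: z_def in_box_complex_iff)
    define k where "k w = (f w)\<^sup>2 / (w - z)" for w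
    have img: "path_image p \<subseteq> strip \<beta> - {z}"
    proof -
      have "path_image p \<subseteq> cbox (Complex (x - R) (y - \<delta>)) (Complex (x + R) (y + \<delta>))"
        unfolding p_def using R(1) \<delta> by (intro path_image_rectpath_subset_cbox) auto
      moreover have "path_image p \<inter> box (Complex (x - R) (y - \<delta>)) (Complex (x + R) (y + \<delta>)) = {}"
        unfolding p_def using R(1) \<delta> by (intro path_image_rectpath_inter_box) auto
      moreover have "cbox (Complex (x - R) (y - \<delta>)) (Complex (x + R) (y + \<delta>)) \<subseteq> strip \<beta>"
        using \<delta> by (auto simp: strip_def in_cbox_complex_iff)
      ultimately show ?thesis using z_box by blast
    qed
    have "(k has_contour_integral of_real (2 * pi) * \<i> * winding_number p z * (f z)\<^sup>2) p"
      unfolding k_def[abs_def]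
    proof (rule Cauchy_integral_formula_convex_simple[OF convex_strip])
      show "(\<lambda>w. (f w)\<^sup>2) holomorphic_on strip \<beta>" by (intro holomorphic_intros f)
      show "z \<in> interior (strip \<beta>)" using \<delta> by (simp add: interior_open open_strip) (auto simp: z_def strip_def)
    qed (use img in \<open>auto simp: p_def\<close>)
    moreover have "winding_number p z = 1"
      unfolding p_def using z_box by (rule winding_number_rectpath)
    ultimately have Cauchy: "contour_integral p k = 2 * of_real pi * \<i> * (f z)\<^sup>2"
      by (simp add: contour_integral_unique)
    have ck: "continuous_on (strip \<beta> - {z}) k"
      unfolding k_def by (intro continuous_intros holomorphic_on_imp_continuous_on holomorphic_on_subset[OF f]) auto
    have bound: "cmod (integral {a..b} (\<lambda>t. k (\<gamma> t))) \<le> integral {a..b} (\<lambda>t. (cmod (f (\<gamma> t)))\<^sup>2) / d"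
      if "d > 0" "continuous_on {a..b} \<gamma>" and far: "\<And>t. t \<in> {a..b} \<Longrightarrow> \<gamma> t \<in> strip \<beta> \<and> cmod (\<gamma> t - z) \<ge> d" for a b d and \<gamma> :: "real \<Rightarrow> complex"
    proof -
      have nz: "\<gamma> t \<noteq> z" if "t \<in> {a..b}" for t using that \<open>d > 0\<close> far[of t] by auto
      have "cmod (integral {a..b} (\<lambda>t. k (\<gamma> t))) \<le> integral {a..b} (\<lambda>t. (cmod (f (\<gamma> t)))\<^sup>2 / d)"
      proof (rule Henstock_Kurzweil_Integration.integral_norm_bound_integral)
        show "(\<lambda>t. k (\<gamma> t)) integrable_on {a..b}"
          using that nz by (intro integrable_continuous_interval continuous_on_compose2[OF ck]) blast+
        show "(\<lambda>t. (cmod (f (\<gamma> t)))\<^sup>2 / d) integrable_on {a..b}"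
          using that by (intro integrable_continuous_interval continuous_intros
              continuous_on_compose2[OF holomorphic_on_imp_continuous_on[OF f]]) auto
        show "cmod (k (\<gamma> t)) \<le> (cmod (f (\<gamma> t)))\<^sup>2 / d" if t: "t \<in> {a..b}" for t
          unfolding k_def norm_divide norm_power
          using \<open>d > 0\<close> far[OF t] by (intro divide_left_mono mult_pos_pos) auto
      qed
      then show ?thesis by simp
    qed
    have hor: "cmod (integral {x - R..x + R} (\<lambda>t. k (Complex t \<eta>))) \<le> N / \<delta>"
      if "\<eta> \<in> {y - \<delta>, y + \<delta>}" for \<eta>
    proof -
      have \<eta>: "\<bar>\<eta>\<bar> < \<beta>" "\<eta> \<in> {y - \<delta>..y + \<delta>}" using that \<delta> by auto
      have "cmod (integral {x - R..x + R} (\<lambda>t. k (Complex t \<eta>))) \<le> integral {x - R..x + R} (\<lambda>t. (cmod (f (Complex t \<eta>)))\<^sup>2) / \<delta>"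
      proof (rule bound[OF \<delta>(1)])
        show "Complex t \<eta> \<in> strip \<beta> \<and> \<delta> \<le> cmod (Complex t \<eta> - z)" for t
          using that \<delta> \<eta> abs_Im_le_cmod[of "Complex t \<eta> - z"] by (auto simp: strip_def z_def)
      qed (auto simp: Complex_eq intro!: continuous_intros)
      also have "\<dots> \<le> N / \<delta>"
        using \<delta> \<eta> \<open>0 \<le> N\<close> by (intro divide_right_mono integral_le_nsq_L2 strip_line_continuous[OF f] N) auto
      finally show ?thesis .
    qed
    have ver: "cmod (integral {y - \<delta>..y + \<delta>} (\<lambda>t. k (Complex \<xi> t))) \<le> integral {y - \<delta>..y + \<delta>} (\<lambda>t. (cmod (f (Complex \<xi> t)))\<^sup>2) / 1"
      if "\<xi> \<in> {x - R, x + R}" for \<xi>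
    proof (rule bound)
      show "Complex \<xi> t \<in> strip \<beta> \<and> 1 \<le> cmod (Complex \<xi> t - z)" if t: "t \<in> {y - \<delta>..y + \<delta>}" for t
        using \<open>\<xi> \<in> _\<close> R(1) t \<delta> abs_Re_le_cmod[of "Complex \<xi> t - z"] by (auto simp: strip_def z_def)
    qed (auto simp: Complex_eq intro!: continuous_intros)
    have four: "cmod (A + \<i> * B - C - \<i> * D) \<le> cmod A + cmod B + cmod C + cmod D" for A B C D :: complex
    proof -
      have "cmod (A + \<i> * B - C - \<i> * D) \<le> cmod (A + \<i> * B - C) + cmod (\<i> * D)" by (rule norm_triangle_ineq4)
      also have "cmod (A + \<i> * B - C) \<le> cmod (A + \<i> * B) + cmod C" by (rule norm_triangle_ineq4)
      also have "cmod (A + \<i> * B) \<le> cmod A + cmod (\<i> * B)" by (rule norm_triangle_ineq)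
      finally show ?thesis by (simp add: norm_mult)
    qed
    have "2 * pi * (cmod (f z))\<^sup>2 = cmod (contour_integral p k)"
      unfolding Cauchy by (simp add: norm_mult norm_power)
    also have "\<dots> \<le> N / \<delta> + integral {y - \<delta>..y + \<delta>} (\<lambda>t. (cmod (f (Complex (x + R) t)))\<^sup>2)
        + N / \<delta> + integral {y - \<delta>..y + \<delta>} (\<lambda>t. (cmod (f (Complex (x - R) t)))\<^sup>2)"
    proof -
      have "contour_integral p k = integral {x - R..x + R} (\<lambda>t. k (Complex t (y - \<delta>)))
          + \<i> * integral {y - \<delta>..y + \<delta>} (\<lambda>t. k (Complex (x + R) t))
          - integral {x - R..x + R} (\<lambda>t. k (Complex t (y + \<delta>)))
          - \<i> * integral {y - \<delta>..y + \<delta>} (\<lambda>t. k (Complex (x - R) t))"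
        unfolding p_def using R(1) \<delta> img
        by (intro contour_integral_rectpath continuous_on_subset[OF ck]) (auto simp: p_def)
      then show ?thesis
        using four[of "integral {x - R..x + R} (\<lambda>t. k (Complex t (y - \<delta>)))"
            "integral {y - \<delta>..y + \<delta>} (\<lambda>t. k (Complex (x + R) t))"
            "integral {x - R..x + R} (\<lambda>t. k (Complex t (y + \<delta>)))"
            "integral {y - \<delta>..y + \<delta>} (\<lambda>t. k (Complex (x - R) t))"]
          hor[of "y - \<delta>"] hor[of "y + \<delta>"] ver[of "x - R"] ver[of "x + R"] by simp
    qed
    also have "\<dots> \<le> 2 * N / \<delta> + e" using R(2) by simp
    finally show ?thesis by (simp add: z_def)
  qed
  then have "2 * pi * (cmod (f (Complex x y)))\<^sup>2 \<le> 2 * N / \<delta>" by (rule field_le_epsilon)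
  then show ?thesis using \<delta>(1) by (simp add: field_simps)
qed

lemma H2_strip_bound:
  assumes "f \<in> H2_strip \<beta>"
  obtains N where "0 \<le> N" "\<And>y. nsq_L2 lborel (\<lambda>x. f (Complex x y)) \<le> ennreal N"
proof -
  let ?q = "\<lambda>y. nsq_L2 lborel (\<lambda>x. f (Complex x y))"
  define S where "S = (SUP y\<in>{0..<\<beta>}. ?q y + ?q (- y))"
  have S: "S < \<infinity>" using assms by (simp add: H2_strip_def S_def)
  have up: "?q y + ?q (- y) \<le> S" if "0 \<le> y" "y < \<beta>" for y
    unfolding S_def using that by (intro SUP_upper) auto
  have "?q y \<le> S" for y
  proof (cases "\<bar>y\<bar> < \<beta>")
    case True
    then have "?q \<bar>y\<bar> + ?q (- \<bar>y\<bar>) \<le> S" by (intro up) auto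
    moreover have "?q y \<le> ?q \<bar>y\<bar> + ?q (- \<bar>y\<bar>)" by (cases "y \<ge> 0") auto
    ultimately show ?thesis by (rule order_trans[rotated])
  next
    case False
    then have "f (Complex x y) = 0" for x using assms by (auto simp: H2_strip_def strip_def)
    then show ?thesis by (simp add: nsq_L2_def)
  qed
  moreover have "S = ennreal (enn2real S)" using S by simp
  ultimately show ?thesis by (intro that[of "enn2real S"]) auto
qed

lemma H2_strip_holomorphic: "f \<in> H2_strip \<beta> \<Longrightarrow> f holomorphic_on strip \<beta>"
  by (simp add: H2_strip_def)

lemma H2_strip_line_measurable:
  assumes "f \<in> H2_strip \<beta>"
  shows "(\<lambda>x. f (Complex x y)) \<in> borel_measurable borel"
proof (cases "\<bar>y\<bar> < \<beta>")
  case True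
  then show ?thesis
    by (intro borel_measurable_continuous_onI strip_line_continuous[OF H2_strip_holomorphic[OF assms]])
next
  case False
  then have "f (Complex x y) = 0" for x using assms by (auto simp: H2_strip_def strip_def)
  then show ?thesis by simp
qed

lemma H2_strip_fourier:
  assumes "f \<in> H2_strip \<beta>" "\<bar>y\<bar> < \<beta>"
  shows "is_fourier_L2 (\<lambda>x. f (Complex x y)) (fourier_L2 (\<lambda>x. f (Complex x y)))"
proof -
  obtain N where N: "\<And>y. nsq_L2 lborel (\<lambda>x. f (Complex x y)) \<le> ennreal N"
    using H2_strip_bound[OF assms(1)] by metis
  show ?thesis
    using assms N[of y]
    by (intro is_fourier_L2_fourier_L2 strip_line_continuous H2_strip_holomorphic)
       (auto intro: le_less_trans)
qed

lemma truncated_line_shift: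
  assumes f: "f holomorphic_on strip \<beta>" and y: "\<bar>y1\<bar> < \<beta>" "\<bar>y2\<bar> < \<beta>" "y1 < y2" and "R > 0"
  defines "k \<equiv> \<lambda>\<xi> z. f z * exp (- \<i> * z * of_real \<xi>)"
  shows "of_real (exp (y1 * \<xi>)) * fourier_int (truncate R (\<lambda>x. f (Complex x y1))) \<xi>
       - of_real (exp (y2 * \<xi>)) * fourier_int (truncate R (\<lambda>x. f (Complex x y2))) \<xi>
       = \<i> * integral {y1..y2} (\<lambda>y. k \<xi> (Complex (- R) y)) - \<i> * integral {y1..y2} (\<lambda>y. k \<xi> (Complex R y))"
proof -
  have hol: "k \<xi> holomorphic_on strip \<beta>"
    unfolding k_def by (intro holomorphic_intros f)
  define p where "p = rectpath (Complex (- R) y1) (Complex R y2)"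
  have img: "path_image p \<subseteq> strip \<beta>"
  proof -
    have "path_image p \<subseteq> cbox (Complex (- R) y1) (Complex R y2)"
      unfolding p_def using \<open>R > 0\<close> y by (intro path_image_rectpath_subset_cbox) auto
    also have "\<dots> \<subseteq> strip \<beta>" using y by (auto simp: strip_def in_cbox_complex_iff)
    finally show ?thesis .
  qed
  have "(k \<xi> has_contour_integral 0) p"
    by (rule Cauchy_theorem_convex_simple[OF hol convex_strip _ img]) (auto simp: p_def)
  then have "contour_integral p (k \<xi>) = 0" by (rule contour_integral_unique)
  moreover have "contour_integral p (k \<xi>) =
      integral {-R..R} (\<lambda>x. k \<xi> (Complex x y1)) + \<i> * integral {y1..y2} (\<lambda>y. k \<xi> (Complex R y))
      - integral {-R..R} (\<lambda>x. k \<xi> (Complex x y2)) - \<i> * integral {y1..y2} (\<lambda>y. k \<xi> (Complex (- R) y))"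
    unfolding p_def using \<open>R > 0\<close> y img
    by (intro contour_integral_rectpath continuous_on_subset[OF holomorphic_on_imp_continuous_on[OF hol]])
       (auto simp: p_def)
  moreover have "integral {-R..R} (\<lambda>x. k \<xi> (Complex x y)) = of_real (exp (y * \<xi>)) * fourier_int (truncate R (\<lambda>x. f (Complex x y))) \<xi>"
    if "\<bar>y\<bar> < \<beta>" for y
  proof -
    have "continuous_on UNIV (\<lambda>x. f (Complex x y) * cis (- (x * \<xi>)))"
      unfolding cis_conv_exp by (intro continuous_intros strip_line_continuous[OF f that])
    then have "set_integrable lborel {-R..R} (\<lambda>x. f (Complex x y) * cis (- (x * \<xi>)))"
      unfolding set_integrable_def by (intro borel_integrable_compact) (auto intro: continuous_on_subset)
    then have "fourier_int (truncate R (\<lambda>x. f (Complex x y))) \<xi> = integral {-R..R} (\<lambda>x. f (Complex x y) * cis (- (x * \<xi>)))"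
      unfolding fourier_int_truncate by (rule set_borel_integral_eq_integral(2))
    moreover have "k \<xi> (Complex x y) = of_real (exp (y * \<xi>)) * (f (Complex x y) * cis (- (x * \<xi>)))" for x
    proof -
      have "- \<i> * Complex x y * of_real \<xi> = of_real (y * \<xi>) + \<i> * of_real (- (x * \<xi>))"
        by (simp add: Complex_eq algebra_simps)
      then have "exp (- \<i> * Complex x y * of_real \<xi>) = of_real (exp (y * \<xi>)) * cis (- (x * \<xi>))"
        by (simp only: exp_add exp_of_real cis_conv_exp)
      then show ?thesis by (simp add: k_def)
    qed
    ultimately show ?thesis by simp
  qed
  ultimately show ?thesis using y by (simp add: algebra_simps)
qed

text \<open>Moving the line of integration from height \<open>y1\<close> to height \<open>y2\<close> changes the truncated integrals
  of \<open>f z * exp (- \<i> z \<xi>)\<close> by the vertical sides only, and these tend to zero along good radii, locally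
  uniformly in \<open>\<xi>\<close>. So in the limit the weighted transforms agree on every bounded interval.\<close>

lemma fourier_line_shift:
  assumes f: "f \<in> H2_strip \<beta>" and y: "\<bar>y1\<bar> < \<beta>" "\<bar>y2\<bar> < \<beta>" "y1 < y2"
    and g1: "is_fourier_L2 (\<lambda>x. f (Complex x y1)) g1" and g2: "is_fourier_L2 (\<lambda>x. f (Complex x y2)) g2"
  shows "AE \<xi> in lborel. of_real (exp (y1 * \<xi>)) * g1 \<xi> = of_real (exp (y2 * \<xi>)) * g2 \<xi>"
proof -
  have hol: "f holomorphic_on strip \<beta>" using f by (rule H2_strip_holomorphic)
  obtain N where N: "0 \<le> N" "\<And>y. nsq_L2 lborel (\<lambda>x. f (Complex x y)) \<le> ennreal N"
    using H2_strip_bound[OF f] by metis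
  have [measurable]: "g1 \<in> borel_measurable borel" "g2 \<in> borel_measurable borel"
    using g1 g2 by (auto simp: is_fourier_L2_def in_L2_def)
  define T where "T y R = fourier_int (truncate R (\<lambda>x. f (Complex x y)))" for y R
  have [measurable]: "T y R \<in> borel_measurable borel" for y R
    using H2_strip_line_measurable[OF f, of y] unfolding T_def by measurable
  have main: "AE \<xi> in lborel. \<bar>\<xi>\<bar> \<le> M \<longrightarrow> of_real (exp (y1 * \<xi>)) * g1 \<xi> - of_real (exp (y2 * \<xi>)) * g2 \<xi> = 0" if "M > 0" for M
  proof -
    define C where "C = exp (\<beta> * M)"
    have C: "C > 0" by (simp add: C_def)
    have exp_C: "exp (y * \<xi>) \<le> C" if "\<bar>y\<bar> < \<beta>" "\<bar>\<xi>\<bar> \<le> M" for y \<xi>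
    proof -
      have "y * \<xi> \<le> \<bar>y\<bar> * \<bar>\<xi>\<bar>" by (metis abs_ge_self abs_mult)
      also have "\<dots> \<le> \<beta> * M" using that by (intro mult_mono) auto
      finally show ?thesis by (simp add: C_def)
    qed
    define chi where "chi \<xi> = (if \<bar>\<xi>\<bar> \<le> M then 1 else 0 :: complex)" for \<xi>
    have [measurable]: "chi \<in> borel_measurable borel" unfolding chi_def by measurable
    define D where "D \<xi> = chi \<xi> * (of_real (exp (y1 * \<xi>)) * g1 \<xi> - of_real (exp (y2 * \<xi>)) * g2 \<xi>)" for \<xi>
    have [measurable]: "D \<in> borel_measurable borel" unfolding D_def by measurable
    have small: "nsq_L2 lborel D \<le> ennreal (8 * C\<^sup>2 * e + 2 * (2 * M * (C * (2 * (y2 - y1) + 1) * e)\<^sup>2))"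
      if "e > 0" for e
    proof -
      have lim: "eventually (\<lambda>R. nsq_L2 lborel (\<lambda>\<xi>. T y1 R \<xi> - g1 \<xi>) \<le> ennreal e
          \<and> nsq_L2 lborel (\<lambda>\<xi>. T y2 R \<xi> - g2 \<xi>) \<le> ennreal e) at_top"
        using g1 g2 \<open>e > 0\<close> unfolding is_fourier_L2_iff tendsto_0_ennreal_iff T_def
        by (intro eventually_conj) auto
      then obtain R0 where R0: "\<And>R. R \<ge> R0 \<Longrightarrow> nsq_L2 lborel (\<lambda>\<xi>. T y1 R \<xi> - g1 \<xi>) \<le> ennreal e"
          "\<And>R. R \<ge> R0 \<Longrightarrow> nsq_L2 lborel (\<lambda>\<xi>. T y2 R \<xi> - g2 \<xi>) \<le> ennreal e"
        unfolding eventually_at_top_linorder by blast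
      have "continuous_on {z. y1 \<le> Im z \<and> Im z \<le> y2} f"
        using y by (intro continuous_on_subset[OF holomorphic_on_imp_continuous_on[OF hol]]) (auto simp: strip_def)
      from exists_good_radius[OF this N(2), of "e\<^sup>2" "max R0 1" 0]
      obtain R where "R \<ge> max R0 1" and R: "integral {y1..y2} (\<lambda>\<eta>. (cmod (f (Complex R \<eta>)))\<^sup>2)
               + integral {y1..y2} (\<lambda>\<eta>. (cmod (f (Complex (- R) \<eta>)))\<^sup>2) \<le> e\<^sup>2"
        using y \<open>e > 0\<close> by auto
      then have R': "R \<ge> R0" "R > 0" by auto
      define k where "k \<xi> z = f z * exp (- \<i> * z * of_real \<xi>)" for \<xi> z
      define side where "side \<xi> = of_real (exp (y1 * \<xi>)) * T y1 R \<xi> - of_real (exp (y2 * \<xi>)) * T y2 R \<xi>" for \<xi>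
      have [measurable]: "side \<in> borel_measurable borel" unfolding side_def by measurable
      have vert: "cmod (integral {y1..y2} (\<lambda>y. k \<xi> (Complex x y)))
          \<le> C * (e * (y2 - y1) + integral {y1..y2} (\<lambda>\<eta>. (cmod (f (Complex x \<eta>)))\<^sup>2) / e)"
        if "\<bar>\<xi>\<bar> \<le> M" for x \<xi>
      proof -
        have cont: "continuous_on {y1..y2} (\<lambda>y. f (Complex x y))"
          using y by (intro continuous_on_compose2[OF holomorphic_on_imp_continuous_on[OF hol]])
            (auto simp: strip_def Complex_eq intro!: continuous_intros)
        have i: "(\<lambda>\<eta>. (cmod (f (Complex x \<eta>)))\<^sup>2) integrable_on {y1..y2}"
          by (intro integrable_continuous_interval continuous_intros cont)
        have "cmod (integral {y1..y2} (\<lambda>y. k \<xi> (Complex x y)))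
            \<le> integral {y1..y2} (\<lambda>y. C * (e + (cmod (f (Complex x y)))\<^sup>2 / e))"
        proof (rule Henstock_Kurzweil_Integration.integral_norm_bound_integral)
          show "(\<lambda>y. k \<xi> (Complex x y)) integrable_on {y1..y2}"
            unfolding k_def Complex_eq
            by (intro integrable_continuous_interval continuous_intros cont[unfolded Complex_eq])
          show "(\<lambda>y. C * (e + (cmod (f (Complex x y)))\<^sup>2 / e)) integrable_on {y1..y2}"
            using \<open>e > 0\<close> by (intro integrable_continuous_interval continuous_intros cont) auto
          fix y assume yy: "y \<in> {y1..y2}"
          define a where "a = cmod (f (Complex x y))"
          \<comment> \<open>This elementary bound takes the place of the Cauchy--Schwarz inequality on the side.\<close>
          have "a \<le> e + a\<^sup>2 / e"
          proof (cases "a \<le> e")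
            case False
            then have "a * e \<le> a * a" using \<open>e > 0\<close> by (intro mult_left_mono) auto
            then have "a \<le> a\<^sup>2 / e" using \<open>e > 0\<close> by (simp add: field_simps power2_eq_square)
            then show ?thesis using \<open>e > 0\<close> by simp
          qed (use \<open>e > 0\<close> in \<open>auto intro!: add_increasing2\<close>)
          moreover have "cmod (k \<xi> (Complex x y)) = a * exp (y * \<xi>)"
            by (simp add: k_def norm_mult a_def)
          moreover have "a * exp (y * \<xi>) \<le> a * C"
            using yy y \<open>\<bar>\<xi>\<bar> \<le> M\<close> by (intro mult_left_mono exp_C) (auto simp: a_def)
          moreover have "a * C \<le> (e + a\<^sup>2 / e) * C" using C calculation(1) by (intro mult_right_mono) auto
          ultimately show "cmod (k \<xi> (Complex x y)) \<le> C * (e + (cmod (f (Complex x y)))\<^sup>2 / e)"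
            by (simp add: a_def mult.commute)
        qed
        also have "\<dots> = C * (e * (y2 - y1) + integral {y1..y2} (\<lambda>\<eta>. (cmod (f (Complex x \<eta>)))\<^sup>2) / e)"
        proof -
          have "integral {y1..y2} (\<lambda>y. e + (cmod (f (Complex x y)))\<^sup>2 / e)
              = integral {y1..y2} (\<lambda>y. e) + integral {y1..y2} (\<lambda>y. (cmod (f (Complex x y)))\<^sup>2 / e)"
            using \<open>e > 0\<close> by (intro Henstock_Kurzweil_Integration.integral_add integrable_continuous_interval continuous_intros cont) auto
          then show ?thesis using y by simp
        qed
        finally show ?thesis .
      qed
      have side: "cmod (side \<xi>) \<le> C * (2 * (y2 - y1) + 1) * e" if "\<bar>\<xi>\<bar> \<le> M" for \<xi>
      proof -
        have "side \<xi> = \<i> * integral {y1..y2} (\<lambda>y. k \<xi> (Complex (- R) y)) - \<i> * integral {y1..y2} (\<lambda>y. k \<xi> (Complex R y))"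
          unfolding side_def T_def k_def by (rule truncated_line_shift[OF hol y R'(2)])
        then have "cmod (side \<xi>) \<le> cmod (integral {y1..y2} (\<lambda>y. k \<xi> (Complex (- R) y))) + cmod (integral {y1..y2} (\<lambda>y. k \<xi> (Complex R y)))"
          using norm_triangle_ineq4[of "\<i> * integral {y1..y2} (\<lambda>y. k \<xi> (Complex (- R) y))"
              "\<i> * integral {y1..y2} (\<lambda>y. k \<xi> (Complex R y))"] by (simp add: norm_mult)
        also have "\<dots> \<le> C * (e * (y2 - y1) + integral {y1..y2} (\<lambda>\<eta>. (cmod (f (Complex (- R) \<eta>)))\<^sup>2) / e)
            + C * (e * (y2 - y1) + integral {y1..y2} (\<lambda>\<eta>. (cmod (f (Complex R \<eta>)))\<^sup>2) / e)"
          by (intro add_mono vert that)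
        also have "\<dots> = C * (2 * (y2 - y1) * e + (integral {y1..y2} (\<lambda>\<eta>. (cmod (f (Complex R \<eta>)))\<^sup>2)
               + integral {y1..y2} (\<lambda>\<eta>. (cmod (f (Complex (- R) \<eta>)))\<^sup>2)) / e)"
          by (simp add: algebra_simps add_divide_distrib)
        also have "\<dots> \<le> C * (2 * (y2 - y1) * e + e\<^sup>2 / e)"
          using R C \<open>e > 0\<close> by (intro mult_left_mono add_left_mono divide_right_mono) auto
        also have "\<dots> = C * (2 * (y2 - y1) + 1) * e"
          using \<open>e > 0\<close> by (simp add: power2_eq_square algebra_simps)
        finally show ?thesis .
      qed
      have damp: "nsq_L2 lborel (\<lambda>\<xi>. chi \<xi> * (of_real (exp (y * \<xi>)) * (g \<xi> - T y R \<xi>))) \<le> ennreal (C\<^sup>2 * e)"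
        if "\<bar>y\<bar> < \<beta>" "nsq_L2 lborel (\<lambda>\<xi>. T y R \<xi> - g \<xi>) \<le> ennreal e" and [measurable]: "g \<in> borel_measurable borel" for y g
      proof -
        have "nsq_L2 lborel (\<lambda>\<xi>. chi \<xi> * (of_real (exp (y * \<xi>)) * (g \<xi> - T y R \<xi>))) \<le> nsq_L2 lborel (\<lambda>\<xi>. of_real C * (g \<xi> - T y R \<xi>))"
          unfolding nsq_L2_def using exp_C[OF that(1)] C
          by (intro nn_integral_mono ennreal_leI power_mono) (auto simp: chi_def norm_mult intro!: mult_right_mono)
        also have "\<dots> = ennreal (C\<^sup>2) * nsq_L2 lborel (\<lambda>\<xi>. T y R \<xi> - g \<xi>)"
          by (subst nsq_L2_cmult) (auto simp: nsq_L2_minus[of lborel g])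
        also have "\<dots> \<le> ennreal (C\<^sup>2) * ennreal e" by (intro mult_left_mono that) auto
        finally show ?thesis using \<open>e > 0\<close> by (simp add: ennreal_mult)
      qed
      have "nsq_L2 lborel (\<lambda>\<xi>. chi \<xi> * side \<xi>)
          \<le> (\<integral>\<^sup>+\<xi>. ennreal ((C * (2 * (y2 - y1) + 1) * e)\<^sup>2) * indicator {-M..M} \<xi> \<partial>lborel)"
        unfolding nsq_L2_def using side
        by (intro nn_integral_mono) (auto simp: chi_def indicator_def abs_le_iff intro!: ennreal_leI power_mono)
      also have "\<dots> = ennreal (2 * M * (C * (2 * (y2 - y1) + 1) * e)\<^sup>2)"
        using \<open>M > 0\<close> by (subst nn_integral_cmult_indicator) (auto simp: ennreal_mult[symmetric] mult.commute)
      finally have side_nsq: "nsq_L2 lborel (\<lambda>\<xi>. chi \<xi> * side \<xi>) \<le> ennreal (2 * M * (C * (2 * (y2 - y1) + 1) * e)\<^sup>2)" .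
      have "D \<xi> = (chi \<xi> * (of_real (exp (y1 * \<xi>)) * (g1 \<xi> - T y1 R \<xi>)) - chi \<xi> * (of_real (exp (y2 * \<xi>)) * (g2 \<xi> - T y2 R \<xi>))) + chi \<xi> * side \<xi>" for \<xi>
        by (simp add: D_def side_def algebra_simps)
      then have "nsq_L2 lborel D \<le> 2 * nsq_L2 lborel (\<lambda>\<xi>. chi \<xi> * (of_real (exp (y1 * \<xi>)) * (g1 \<xi> - T y1 R \<xi>)) - chi \<xi> * (of_real (exp (y2 * \<xi>)) * (g2 \<xi> - T y2 R \<xi>)))
          + 2 * nsq_L2 lborel (\<lambda>\<xi>. chi \<xi> * side \<xi>)"
        by (intro ord_eq_le_trans[OF arg_cong[of _ _ "nsq_L2 lborel"] nsq_L2_add_le] ext) auto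
      also have "\<dots> \<le> 2 * (2 * nsq_L2 lborel (\<lambda>\<xi>. chi \<xi> * (of_real (exp (y1 * \<xi>)) * (g1 \<xi> - T y1 R \<xi>)))
            + 2 * nsq_L2 lborel (\<lambda>\<xi>. chi \<xi> * (of_real (exp (y2 * \<xi>)) * (g2 \<xi> - T y2 R \<xi>))))
          + 2 * nsq_L2 lborel (\<lambda>\<xi>. chi \<xi> * side \<xi>)"
        by (intro add_right_mono mult_left_mono nsq_L2_diff_le) auto
      also have "\<dots> \<le> ennreal 2 * (ennreal 2 * ennreal (C\<^sup>2 * e) + ennreal 2 * ennreal (C\<^sup>2 * e))
          + ennreal 2 * ennreal (2 * M * (C * (2 * (y2 - y1) + 1) * e)\<^sup>2)"
        using side_nsq damp[OF y(1) R0(1)[OF R'(1)]] damp[OF y(2) R0(2)[OF R'(1)]]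
        by (simp only: ennreal_numeral, intro add_mono mult_left_mono) auto
      also have "\<dots> = ennreal (8 * C\<^sup>2 * e + 2 * (2 * M * (C * (2 * (y2 - y1) + 1) * e)\<^sup>2))"
        using \<open>e > 0\<close> \<open>M > 0\<close>
        by (simp add: ennreal_mult[symmetric] ennreal_plus[symmetric] del: ennreal_plus ennreal_numeral)
      finally show ?thesis .
    qed
    have "((\<lambda>e. ennreal (8 * C\<^sup>2 * e + 2 * (2 * M * (C * (2 * (y2 - y1) + 1) * e)\<^sup>2))) \<longlongrightarrow>
        ennreal (8 * C\<^sup>2 * 0 + 2 * (2 * M * (C * (2 * (y2 - y1) + 1) * 0)\<^sup>2))) (at_right 0)"
      by (intro tendsto_ennrealI tendsto_intros)
    moreover have "eventually (\<lambda>e. nsq_L2 lborel D \<le> ennreal (8 * C\<^sup>2 * e + 2 * (2 * M * (C * (2 * (y2 - y1) + 1) * e)\<^sup>2))) (at_right 0)"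
      using small by (intro eventually_at_rightI[of 0 1]) auto
    ultimately have "nsq_L2 lborel D \<le> ennreal (8 * C\<^sup>2 * 0 + 2 * (2 * M * (C * (2 * (y2 - y1) + 1) * 0)\<^sup>2))"
      by (rule tendsto_lowerbound) simp
    then have "AE \<xi> in lborel. D \<xi> = 0"
      by (subst nsq_L2_eq_0_iff[symmetric]) auto
    then show ?thesis by eventually_elim (auto simp: D_def chi_def)
  qed
  have "AE \<xi> in lborel. \<forall>n::nat. \<bar>\<xi>\<bar> \<le> real (Suc n) \<longrightarrow> of_real (exp (y1 * \<xi>)) * g1 \<xi> - of_real (exp (y2 * \<xi>)) * g2 \<xi> = 0"
    using main by (subst AE_all_countable) auto
  then show ?thesis
  proof eventually_elim
    case (elim \<xi>)
    have "\<bar>\<xi>\<bar> \<le> real (Suc (nat \<lceil>\<bar>\<xi>\<bar>\<rceil>))" by linarith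
    with elim have "of_real (exp (y1 * \<xi>)) * g1 \<xi> - of_real (exp (y2 * \<xi>)) * g2 \<xi> = 0" by blast
    then show ?case by simp
  qed
qed

lemma H2_strip_fourier_line:
  assumes f: "f \<in> H2_strip \<beta>" and y: "\<bar>y\<bar> < \<beta>"
  shows "AE \<xi> in lborel. fourier_L2 (\<lambda>x. f (Complex x y)) \<xi> = of_real (exp (- (y * \<xi>))) * fourier_L2 (\<lambda>x. f (Complex x 0)) \<xi>"
proof -
  have 0: "\<bar>0\<bar> < \<beta>" using y by auto
  consider "y = 0" | "0 < y" | "y < 0" by linarith
  then have "AE \<xi> in lborel. of_real (exp (y * \<xi>)) * fourier_L2 (\<lambda>x. f (Complex x y)) \<xi> = fourier_L2 (\<lambda>x. f (Complex x 0)) \<xi>"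
  proof cases
    case 2
    from fourier_line_shift[OF f 0 y this H2_strip_fourier[OF f 0] H2_strip_fourier[OF f y]]
    show ?thesis by eventually_elim simp
  next
    case 3
    from fourier_line_shift[OF f y 0 this H2_strip_fourier[OF f y] H2_strip_fourier[OF f 0]]
    show ?thesis by eventually_elim simp
  qed simp
  then show ?thesis
  proof eventually_elim
    case (elim \<xi>)
    have "of_real (exp (- (y * \<xi>))) * (of_real (exp (y * \<xi>)) * fourier_L2 (\<lambda>x. f (Complex x y)) \<xi>) = fourier_L2 (\<lambda>x. f (Complex x y)) \<xi>"
      by (simp add: mult.assoc[symmetric] of_real_mult[symmetric] exp_add[symmetric] del: of_real_mult)
    with elim show ?case by simp
  qed
qed

lemma H2_strip_Plancherel:
  assumes f: "f \<in> H2_strip \<beta>" and y: "\<bar>y\<bar> < \<beta>"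
  defines "g \<equiv> fourier_L2 (\<lambda>x. f (Complex x 0))"
  shows "ennreal (2 * pi) * nsq_L2 lborel (\<lambda>x. f (Complex x y)) = nsq_L2 lborel (\<lambda>\<xi>. of_real (exp (- (y * \<xi>))) * g \<xi>)"
proof -
  obtain N where N: "\<And>y. nsq_L2 lborel (\<lambda>x. f (Complex x y)) \<le> ennreal N"
    using H2_strip_bound[OF f] by metis
  have "ennreal (2 * pi) * nsq_L2 lborel (\<lambda>x. f (Complex x y)) = nsq_L2 lborel (fourier_L2 (\<lambda>x. f (Complex x y)))"
    using N[of y]
    by (intro Plancherel_is_fourier_L2[symmetric] strip_line_continuous[OF H2_strip_holomorphic[OF f] y] H2_strip_fourier[OF f y])
       (auto intro: le_less_trans)
  also have "\<dots> = nsq_L2 lborel (\<lambda>\<xi>. of_real (exp (- (y * \<xi>))) * g \<xi>)"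
    unfolding g_def by (intro nsq_L2_cong_AE H2_strip_fourier_line[OF f y])
  finally show ?thesis .
qed

lemma H2_strip_Plancherel_diff:
  assumes f: "f \<in> H2_strip \<beta>" and y: "\<bar>y\<bar> < \<beta>" "\<bar>y'\<bar> < \<beta>"
  defines "g \<equiv> fourier_L2 (\<lambda>x. f (Complex x 0))"
  shows "ennreal (2 * pi) * nsq_L2 lborel (\<lambda>x. f (Complex x y) - f (Complex x y'))
       = nsq_L2 lborel (\<lambda>\<xi>. of_real (exp (- (y * \<xi>)) - exp (- (y' * \<xi>))) * g \<xi>)"
proof -
  obtain N where N: "\<And>y. nsq_L2 lborel (\<lambda>x. f (Complex x y)) \<le> ennreal N"
    using H2_strip_bound[OF f] by metis
  note cont = strip_line_continuous[OF H2_strip_holomorphic[OF f]]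
  have "in_L2 lborel (\<lambda>x. f (Complex x y) - f (Complex x y'))"
    using N H2_strip_line_measurable[OF f]
    by (intro in_L2_diff) (auto simp: in_L2_def intro: le_less_trans[OF N])
  then have "ennreal (2 * pi) * nsq_L2 lborel (\<lambda>x. f (Complex x y) - f (Complex x y'))
    = nsq_L2 lborel (\<lambda>\<xi>. fourier_L2 (\<lambda>x. f (Complex x y)) \<xi> - fourier_L2 (\<lambda>x. f (Complex x y')) \<xi>)"
    by (intro Plancherel_is_fourier_L2[symmetric] is_fourier_L2_diff continuous_intros cont y H2_strip_fourier[OF f])
       (auto simp: in_L2_def)
  also have "\<dots> = nsq_L2 lborel (\<lambda>\<xi>. of_real (exp (- (y * \<xi>)) - exp (- (y' * \<xi>))) * g \<xi>)"
  proof (rule nsq_L2_cong_AE)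
    show "AE \<xi> in lborel. fourier_L2 (\<lambda>x. f (Complex x y)) \<xi> - fourier_L2 (\<lambda>x. f (Complex x y')) \<xi>
        = of_real (exp (- (y * \<xi>)) - exp (- (y' * \<xi>))) * g \<xi>"
      using H2_strip_fourier_line[OF f y(1)] H2_strip_fourier_line[OF f y(2)]
      unfolding g_def by eventually_elim (simp add: left_diff_distrib)
  qed
  finally show ?thesis .
qed

lemma nhds_within_symmetric_interval_neq_bot:
  assumes "0 < \<beta>" "\<bar>y0\<bar> \<le> (\<beta>::real)"
  shows "inf (nhds y0) (principal {-\<beta><..<\<beta>}) \<noteq> bot"
proof -
  have "y0 islimpt {-\<beta><..<\<beta>}"
  proof (cases "\<bar>y0\<bar> < \<beta>")
    case True
    then show ?thesis by (intro open_imp_islimpt) auto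
  next
    case False
    then have "y0 = \<beta> \<or> y0 = - \<beta>" using assms by auto
    then show ?thesis
      using islimpt_greaterThanLessThan1[of "-\<beta>" \<beta>] islimpt_greaterThanLessThan2[of "-\<beta>" \<beta>] assms by auto
  qed
  then have "at y0 within {-\<beta><..<\<beta>} \<noteq> bot" by (simp add: trivial_limit_within)
  moreover have "at y0 within {-\<beta><..<\<beta>} \<le> inf (nhds y0) (principal {-\<beta><..<\<beta>})"
    unfolding at_within_def by (intro inf_mono) auto
  ultimately show ?thesis by (metis bot.extremum_unique)
qed

text \<open>The transforms \<open>exp (- y \<xi>) * g \<xi>\<close> are dominated by \<open>(exp (\<beta> \<xi>) + exp (- \<beta> \<xi>)) * g \<xi>\<close>, which is square
  integrable by Fatou's lemma. Dominated convergence makes the lines of \<open>f\<close> a Cauchy net up to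
  and including the boundary of the strip. The filter does not remove \<open>y0\<close>, because slices of the
  worm domain can attain their limiting height before they reach the corner.\<close>

lemma H2_strip_L2_limit:
  assumes f: "f \<in> H2_strip \<beta>" and "0 < \<beta>" and y0: "\<bar>y0\<bar> \<le> \<beta>"
  obtains g where "in_L2 lborel g"
    "((\<lambda>y. nsq_L2 lborel (\<lambda>x. f (Complex x y) - g x)) \<longlongrightarrow> 0) (inf (nhds y0) (principal {-\<beta><..<\<beta>}))"
proof -
  obtain N where N: "0 \<le> N" "\<And>y. nsq_L2 lborel (\<lambda>x. f (Complex x y)) \<le> ennreal N"
    using H2_strip_bound[OF f] by metis
  define g where "g = fourier_L2 (\<lambda>x. f (Complex x 0))"
  have [measurable]: "g \<in> borel_measurable borel"
    using H2_strip_fourier[OF f, of 0] \<open>0 < \<beta>\<close> by (simp add: g_def is_fourier_L2_def in_L2_def)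
  have edge: "nsq_L2 lborel (\<lambda>\<xi>. of_real (exp (- (b * \<xi>))) * g \<xi>) \<le> ennreal (2 * pi * N)" if "\<bar>b\<bar> = \<beta>" for b
  proof (rule nsq_L2_Fatou[of "\<lambda>n \<xi>. of_real (exp (- (b * (1 - 1 / real (Suc n)) * \<xi>))) * g \<xi>" _ _ 0])
    have "(\<lambda>n. of_real (exp (- (b * (1 - 1 / real (Suc n)) * \<xi>))) * g \<xi>) \<longlonglongrightarrow> of_real (exp (- (b * (1 - 0) * \<xi>))) * g \<xi>" for \<xi>
      by (intro tendsto_intros LIMSEQ_Suc[OF lim_1_over_n])
    then show "AE \<xi> in lborel. (\<lambda>n. of_real (exp (- (b * (1 - 1 / real (Suc n)) * \<xi>))) * g \<xi>) \<longlonglongrightarrow> of_real (exp (- (b * \<xi>))) * g \<xi>"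
      by simp
    fix n
    have "\<bar>b * (1 - 1 / real (Suc n))\<bar> < \<beta>"
      using that \<open>0 < \<beta>\<close> by (simp add: abs_mult field_simps)
    from H2_strip_Plancherel[OF f this]
    have "nsq_L2 lborel (\<lambda>\<xi>. of_real (exp (- (b * (1 - 1 / real (Suc n)) * \<xi>))) * g \<xi>)
        = ennreal (2 * pi) * nsq_L2 lborel (\<lambda>x. f (Complex x (b * (1 - 1 / real (Suc n)))))"
      by (simp add: g_def)
    also have "\<dots> \<le> ennreal (2 * pi) * ennreal N" by (intro mult_left_mono N) auto
    finally show "nsq_L2 lborel (\<lambda>\<xi>. of_real (exp (- (b * (1 - 1 / real (Suc n)) * \<xi>))) * g \<xi>) \<le> ennreal (2 * pi * N)"
      using N by (simp add: ennreal_mult)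
  qed measurable
  define w where "w \<xi> = of_real (exp (- (\<beta> * \<xi>))) * g \<xi>" for \<xi>
  define w' where "w' \<xi> = of_real (exp (- (- \<beta> * \<xi>))) * g \<xi>" for \<xi>
  have [measurable]: "w \<in> borel_measurable borel" "w' \<in> borel_measurable borel"
    unfolding w_def w'_def by measurable
  have exp_le: "exp (- (y * \<xi>)) \<le> exp (- (\<beta> * \<xi>)) + exp (- (- \<beta> * \<xi>))" if "\<bar>y\<bar> \<le> \<beta>" for y \<xi>
  proof (cases "\<xi> \<ge> 0")
    case True
    moreover have "- \<beta> \<le> y" using that by linarith
    ultimately have "- \<beta> * \<xi> \<le> y * \<xi>" by (intro mult_right_mono)
    then have "- (y * \<xi>) \<le> - (- \<beta> * \<xi>)" by linarith
    then have "exp (- (y * \<xi>)) \<le> exp (- (- \<beta> * \<xi>))" by simp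
    then show ?thesis by (simp add: add_increasing)
  next
    case False
    then have "\<beta> * \<xi> \<le> y * \<xi>" using that by (intro mult_right_mono_neg) auto
    then have "- (y * \<xi>) \<le> - (\<beta> * \<xi>)" by linarith
    then have "exp (- (y * \<xi>)) \<le> exp (- (\<beta> * \<xi>))" by simp
    then show ?thesis by (simp add: add_increasing2)
  qed
  define h where "h y \<xi> = of_real (exp (- (y * \<xi>)) - exp (- (y0 * \<xi>))) * g \<xi>" for y \<xi>
  have [measurable]: "h y \<in> borel_measurable borel" for y unfolding h_def by measurable
  have h_lim: "((\<lambda>y. nsq_L2 lborel (h y)) \<longlongrightarrow> 0) (at y0 within {-\<beta><..<\<beta>})"
    unfolding tendsto_at_iff_sequentially
  proof (intro allI impI)
    fix X assume X: "\<forall>i. X i \<in> {-\<beta><..<\<beta>} - {y0}" "X \<longlonglongrightarrow> y0"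
    have "(\<lambda>i. nsq_L2 lborel (h (X i))) \<longlonglongrightarrow> (\<integral>\<^sup>+\<xi>. 0 \<partial>(lborel :: real measure))"
      unfolding nsq_L2_def
    proof (rule nn_integral_dominated_convergence[where w = "\<lambda>\<xi>. 2 * ennreal ((cmod (w \<xi>))\<^sup>2) + 2 * ennreal ((cmod (w' \<xi>))\<^sup>2)"])
      show "AE \<xi> in lborel. ennreal ((cmod (h (X j) \<xi>))\<^sup>2) \<le> 2 * ennreal ((cmod (w \<xi>))\<^sup>2) + 2 * ennreal ((cmod (w' \<xi>))\<^sup>2)" for j
      proof (intro AE_I2)
        fix \<xi> :: real
        have *: "0 \<le> exp (- (y * \<xi>))" for y :: real by simp
        have "\<bar>X j\<bar> \<le> \<beta>" using X(1) by (auto simp: abs_le_iff less_imp_le) (smt (verit))+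
        then have "\<bar>exp (- (X j * \<xi>)) - exp (- (y0 * \<xi>))\<bar> \<le> exp (- (\<beta> * \<xi>)) + exp (- (- \<beta> * \<xi>))"
          using exp_le[of "X j" \<xi>] exp_le[OF y0, of \<xi>] *[of "X j"] *[of y0] by linarith
        then have "cmod (h (X j) \<xi>) \<le> (exp (- (\<beta> * \<xi>)) + exp (- (- \<beta> * \<xi>))) * cmod (g \<xi>)"
          unfolding h_def norm_mult norm_of_real by (rule mult_right_mono) simp
        also have "\<dots> = cmod (w \<xi>) + cmod (w' \<xi>)"
          by (simp add: w_def w'_def norm_mult distrib_right)
        finally have "(cmod (h (X j) \<xi>))\<^sup>2 \<le> (cmod (w \<xi>) + cmod (w' \<xi>))\<^sup>2"
          by (intro power_mono) auto
        also have "\<dots> \<le> 2 * (cmod (w \<xi>))\<^sup>2 + 2 * (cmod (w' \<xi>))\<^sup>2"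
          using sum_squares_bound[of "cmod (w \<xi>)" "cmod (w' \<xi>)"] by (simp add: power2_sum)
        finally have "ennreal ((cmod (h (X j) \<xi>))\<^sup>2) \<le> ennreal (2 * (cmod (w \<xi>))\<^sup>2 + 2 * (cmod (w' \<xi>))\<^sup>2)"
          by (rule ennreal_leI)
        then show "ennreal ((cmod (h (X j) \<xi>))\<^sup>2) \<le> 2 * ennreal ((cmod (w \<xi>))\<^sup>2) + 2 * ennreal ((cmod (w' \<xi>))\<^sup>2)"
          by (simp add: ennreal_mult)
      qed
      have "(\<integral>\<^sup>+\<xi>. 2 * ennreal ((cmod (w \<xi>))\<^sup>2) + 2 * ennreal ((cmod (w' \<xi>))\<^sup>2) \<partial>lborel)
          = 2 * nsq_L2 lborel w + 2 * nsq_L2 lborel w'"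
        unfolding nsq_L2_def by (subst nn_integral_add) (auto simp: nn_integral_cmult)
      also have "\<dots> < \<infinity>"
        using edge[of \<beta>] edge[of "- \<beta>"] \<open>0 < \<beta>\<close> unfolding w_def w'_def
        by (auto simp: ennreal_mult_less_top intro: le_less_trans)
      finally show "(\<integral>\<^sup>+\<xi>. 2 * ennreal ((cmod (w \<xi>))\<^sup>2) + 2 * ennreal ((cmod (w' \<xi>))\<^sup>2) \<partial>lborel) < \<infinity>" .
      have "(\<lambda>i. ennreal ((cmod (h (X i) \<xi>))\<^sup>2)) \<longlonglongrightarrow> ennreal ((cmod (of_real (exp (- (y0 * \<xi>)) - exp (- (y0 * \<xi>))) * g \<xi>))\<^sup>2)" for \<xi>
        unfolding h_def by (intro tendsto_intros tendsto_ennrealI X(2))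
      then show "AE \<xi> in lborel. (\<lambda>i. ennreal ((cmod (h (X i) \<xi>))\<^sup>2)) \<longlonglongrightarrow> 0" by simp
    qed auto
    then show "((\<lambda>y. nsq_L2 lborel (h y)) \<circ> X) \<longlonglongrightarrow> 0" by (simp add: o_def)
  qed
  have h_lim': "((\<lambda>y. nsq_L2 lborel (h y)) \<longlongrightarrow> 0) (inf (nhds y0) (principal {-\<beta><..<\<beta>}))"
    unfolding tendsto_0_ennreal_iff eventually_inf_principal
  proof (intro allI impI)
    fix e :: real assume "e > 0"
    have "eventually (\<lambda>y. y \<noteq> y0 \<longrightarrow> y \<in> {-\<beta><..<\<beta>} \<longrightarrow> nsq_L2 lborel (h y) \<le> ennreal e) (nhds y0)"
      using h_lim \<open>e > 0\<close> unfolding tendsto_0_ennreal_iff eventually_at_filter by blast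
    moreover have "nsq_L2 lborel (h y0) = 0" by (simp add: h_def[abs_def] nsq_L2_def)
    ultimately show "eventually (\<lambda>y. y \<in> {-\<beta><..<\<beta>} \<longrightarrow> nsq_L2 lborel (h y) \<le> ennreal e) (nhds y0)"
      by (auto elim!: eventually_mono)
  qed
  show ?thesis
  proof (rule L2_complete[of "inf (nhds y0) (principal {-\<beta><..<\<beta>})" "\<lambda>y x. f (Complex x y)" lborel])
    show "inf (nhds y0) (principal {-\<beta><..<\<beta>}) \<noteq> bot"
      using \<open>0 < \<beta>\<close> y0 by (rule nhds_within_symmetric_interval_neq_bot)
    show "(\<lambda>x. f (Complex x y)) \<in> borel_measurable lborel" for y
      using H2_strip_line_measurable[OF f] by simp
    show "eventually (\<lambda>y. nsq_L2 lborel (\<lambda>x. f (Complex x y)) < \<infinity>) (inf (nhds y0) (principal {-\<beta><..<\<beta>}))"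
      by (intro always_eventually allI le_less_trans[OF N(2)]) auto
    fix e :: real assume "e > 0"
    define P where "P y \<longleftrightarrow> y \<in> {-\<beta><..<\<beta>} \<and> nsq_L2 lborel (h y) \<le> ennreal (e * pi / 2)" for y
    have "eventually P (inf (nhds y0) (principal {-\<beta><..<\<beta>}))"
      using h_lim' \<open>e > 0\<close> unfolding P_def[abs_def] tendsto_0_ennreal_iff
      by (intro eventually_conj) (auto simp: eventually_inf_principal)
    moreover have "nsq_L2 lborel (\<lambda>x. f (Complex x y) - f (Complex x y')) \<le> ennreal e" if "P y" "P y'" for y y'
    proof -
      have y: "\<bar>y\<bar> < \<beta>" "\<bar>y'\<bar> < \<beta>" using that by (auto simp: P_def)
      have "ennreal (2 * pi) * nsq_L2 lborel (\<lambda>x. f (Complex x y) - f (Complex x y'))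
          = nsq_L2 lborel (\<lambda>\<xi>. h y \<xi> - h y' \<xi>)"
        using H2_strip_Plancherel_diff[OF f y] by (simp add: g_def h_def algebra_simps)
      also have "\<dots> \<le> 2 * nsq_L2 lborel (h y) + 2 * nsq_L2 lborel (h y')"
        by (intro nsq_L2_diff_le) auto
      also have "\<dots> \<le> ennreal 2 * ennreal (e * pi / 2) + ennreal 2 * ennreal (e * pi / 2)"
        using that by (simp only: ennreal_numeral, intro add_mono mult_left_mono) (auto simp: P_def)
      also have "\<dots> = ennreal (2 * pi) * ennreal e"
        using \<open>e > 0\<close> by (simp add: ennreal_mult[symmetric] ennreal_plus[symmetric] del: ennreal_plus ennreal_numeral)
      finally show ?thesis by (subst (asm) ennreal_mult_le_mult_iff) auto
    qed
    ultimately show "\<exists>P. eventually P (inf (nhds y0) (principal {-\<beta><..<\<beta>})) \<and> (\<forall>y y'. P y \<longrightarrow> P y' \<longrightarrow>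
        nsq_L2 lborel (\<lambda>x. f (Complex x y) - f (Complex x y')) \<le> ennreal e)"
      by blast
  qed (rule that)
qed

section \<open>Holomorphic functions of two variables\<close>

text \<open>On a compact disc \<open>f t\<close> is uniformly close to \<open>f t0\<close> for \<open>t\<close> near \<open>t0\<close>, and Cauchy's inequality transfers
  this to the derivatives. The parameter is a second complex variable in Osgood's lemma and a
  variable of integration in the lemma after this one.\<close>

lemma continuous_on_deriv_param:
  fixes f :: "'b::metric_space \<Rightarrow> complex \<Rightarrow> complex"
  assumes "open U" and cont: "continuous_on (T \<times> U) (\<lambda>(t, z). f t z)"
    and hol: "\<And>t. t \<in> T \<Longrightarrow> f t holomorphic_on U"
  shows "continuous_on (T \<times> U) (\<lambda>(t, z). deriv (f t) z)"
  unfolding continuous_on_iff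
proof (intro ballI allI impI, clarify)
  fix t0 z0 and e :: real assume t0: "t0 \<in> T" and z0: "z0 \<in> U" and "0 < e"
  obtain r where r: "r > 0" "cball z0 (2 * r) \<subseteq> U"
  proof -
    obtain s where "s > 0" "cball z0 s \<subseteq> U" using \<open>open U\<close> z0 open_contains_cball by blast
    then show ?thesis by (intro that[of "s / 2"]) auto
  qed
  have "continuous_on (T \<times> cball z0 (2 * r)) (\<lambda>(t, z). f t z)"
    using r(2) by (intro continuous_on_subset[OF cont]) auto
  then obtain X where X: "t0 \<in> X" "open X"
    "\<forall>t\<in>X \<inter> T. \<forall>w\<in>cball z0 (2 * r). dist (f t w) (f t0 w) \<le> e * r / 4"
    using continuous_on_prod_compactE[of T "cball z0 (2 * r)" "\<lambda>(t, z). f t z" t0 "e * r / 4"] t0 \<open>0 < e\<close> r(1)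
    by (auto simp del: mem_cball)
  obtain d1 where d1: "d1 > 0" "\<And>t. dist t t0 < d1 \<Longrightarrow> t \<in> X"
    using X(1,2) unfolding open_dist by blast
  have "continuous_on U (deriv (f t0))"
    by (intro holomorphic_on_imp_continuous_on holomorphic_deriv hol t0 \<open>open U\<close>)
  then obtain d2 where d2: "d2 > 0" "\<And>z. z \<in> U \<Longrightarrow> dist z z0 < d2 \<Longrightarrow> dist (deriv (f t0) z) (deriv (f t0) z0) < e / 2"
    using z0 \<open>0 < e\<close> unfolding continuous_on_iff by (metis half_gt_zero)
  show "\<exists>d>0. \<forall>x'\<in>T \<times> U. dist x' (t0, z0) < d \<longrightarrow>
      dist (case x' of (t, z) \<Rightarrow> deriv (f t) z) (deriv (f t0) z0) < e"
  proof (intro exI[of _ "min (min d1 d2) r"] conjI ballI impI)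
    fix x' assume x': "x' \<in> T \<times> U" "dist x' (t0, z0) < min (min d1 d2) r"
    obtain t z where tz: "x' = (t, z)" "t \<in> T" "z \<in> U" using x'(1) by auto
    have dt: "dist t t0 < min (min d1 d2) r" and dz: "dist z z0 < min (min d1 d2) r"
      using x'(2) dist_fst_le[of x' "(t0, z0)"] dist_snd_le[of x' "(t0, z0)"] by (auto simp: tz(1))
    have sub: "cball z r \<subseteq> cball z0 (2 * r)"
    proof
      fix w assume "w \<in> cball z r"
      then have "dist z0 w \<le> dist z0 z + dist z w" "dist z w \<le> r" by (auto intro: dist_triangle)
      then show "w \<in> cball z0 (2 * r)" using dz by (auto simp: dist_commute)
    qed
    have fd: "f s field_differentiable at z" if "s \<in> T" for s
      using hol[OF that] \<open>open U\<close> tz(3) by (simp add: holomorphic_on_imp_differentiable_at)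
    have "cmod ((deriv ^^ 1) (\<lambda>w. f t w - f t0 w) z) \<le> fact 1 * (e * r / 4) / r ^ 1"
    proof (rule Cauchy_inequality)
      show "(\<lambda>w. f t w - f t0 w) holomorphic_on ball z r"
        using sub r(2) by (intro holomorphic_intros holomorphic_on_subset[OF hol] tz(2) t0) (auto simp: subset_eq)
      show "continuous_on (cball z r) (\<lambda>w. f t w - f t0 w)"
        using sub r(2) by (intro continuous_intros holomorphic_on_imp_continuous_on
            holomorphic_on_subset[OF hol] tz(2) t0) (auto simp: subset_eq)
      fix w assume "cmod (z - w) = r"
      then have "w \<in> cball z0 (2 * r)" using sub by (auto simp: dist_norm)
      with X(3) d1(2)[of t] dt tz(2) show "cmod (f t w - f t0 w) \<le> e * r / 4"
        by (auto simp: dist_norm)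
    qed (use r in auto)
    then have "cmod (deriv (f t) z - deriv (f t0) z) \<le> e / 4"
      using r(1) fd[OF tz(2)] fd[OF t0] by simp
    moreover have "dist (deriv (f t0) z) (deriv (f t0) z0) < e / 2"
      using d2(2)[OF tz(3)] dz by auto
    moreover have "dist (deriv (f t) z) (deriv (f t0) z0) \<le> dist (deriv (f t) z) (deriv (f t0) z) + dist (deriv (f t0) z) (deriv (f t0) z0)"
      by (rule dist_triangle)
    ultimately show "dist (case x' of (t, z) \<Rightarrow> deriv (f t) z) (deriv (f t0) z0) < e"
      using \<open>0 < e\<close> by (simp add: tz(1) dist_norm)
  qed (use d1 d2 r in auto)
qed

lemma holomorphic_on_integral_param:
  fixes f :: "complex \<Rightarrow> real \<Rightarrow> complex"
  assumes "open U" and cont: "continuous_on (U \<times> {a..b}) (\<lambda>(z, t). f z t)"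
    and hol: "\<And>t. t \<in> {a..b} \<Longrightarrow> (\<lambda>z. f z t) holomorphic_on U"
  shows "(\<lambda>z. integral {a..b} (f z)) holomorphic_on U"
proof -
  have swap: "continuous_on ({a..b} \<times> U) (\<lambda>(t, z). f z t)"
  proof -
    have "continuous_on ({a..b} \<times> U) ((\<lambda>(z, t). f z t) \<circ> (\<lambda>(t, z). (z, t)))"
      by (intro continuous_on_compose continuous_on_subset[OF cont])
         (auto simp: split_beta intro!: continuous_intros)
    then show ?thesis by (simp add: o_def split_beta)
  qed
  have d0: "continuous_on ({a..b} \<times> U) (\<lambda>(t, z). deriv (\<lambda>z. f z t) z)"
    using \<open>open U\<close> swap hol by (rule continuous_on_deriv_param)
  have "continuous_on (U \<times> {a..b}) ((\<lambda>(t, z). deriv (\<lambda>z. f z t) z) \<circ> (\<lambda>(z, t). (t, z)))"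
    by (intro continuous_on_compose continuous_on_subset[OF d0])
       (auto simp: split_beta intro!: continuous_on_Pair continuous_on_fst continuous_on_snd continuous_on_id)
  then have deriv: "continuous_on (U \<times> {a..b}) (\<lambda>(z, t). deriv (\<lambda>z. f z t) z)"
    by (simp add: o_def split_beta)
  have "(\<lambda>z. integral {a..b} (f z)) field_differentiable at z" if zU: "z \<in> U" for z
  proof -
    obtain r where r: "r > 0" "ball z r \<subseteq> U" using openE[OF \<open>open U\<close> zU] by blast
    have "(\<lambda>z. integral (cbox a b) (f z)) holomorphic_on ball z r"
    proof (rule leibniz_rule_holomorphic)
      fix w t assume "w \<in> ball z r" "t \<in> cbox a b"
      then show "((\<lambda>z. f z t) has_field_derivative deriv (\<lambda>z. f z t) w) (at w within ball z r)"
        using hol[of t] \<open>open U\<close> r(2)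
        by (intro has_field_derivative_at_within[OF holomorphic_derivI[of _ U]]) auto
    next
      fix w assume "w \<in> ball z r"
      then have "continuous_on {a..b} ((\<lambda>(z, t). f z t) \<circ> (\<lambda>t. (w, t)))"
        using r(2) by (intro continuous_on_compose continuous_on_subset[OF cont]) (auto intro!: continuous_intros)
      then show "f w integrable_on cbox a b"
        by (simp add: o_def integrable_continuous_interval)
    qed (use r(2) in \<open>auto intro: continuous_on_subset[OF deriv]\<close>)
    from holomorphic_on_imp_differentiable_at[OF this[unfolded cbox_interval] open_ball]
    show ?thesis using r(1) by simp
  qed
  then show ?thesis
    unfolding holomorphic_on_def using field_differentiable_at_within by blast
qed

text \<open>Osgood's lemma: by \<open>continuous_on_deriv_param\<close> one of the two partial derivatives is jointly continuous,
  which is enough for total differentiability. It reduces holomorphy of integrals and of limits in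
  two variables to the one variable theorems.\<close>

lemma holomorphic2_onI:
  assumes "open D" and cont: "continuous_on D F"
    and hol1: "\<And>z2. (\<lambda>z1. F (z1, z2)) holomorphic_on {z1. (z1, z2) \<in> D}"
    and hol2: "\<And>z1. (\<lambda>z2. F (z1, z2)) holomorphic_on {z2. (z1, z2) \<in> D}"
  shows "holomorphic2_on F D"
  unfolding holomorphic2_on_def
proof
  fix p assume "p \<in> D"
  obtain x y where p: "p = (x, y)" by (cases p)
  obtain A B where AB: "open A" "open B" "x \<in> A" "y \<in> B" "A \<times> B \<subseteq> D"
    using \<open>open D\<close> \<open>p \<in> D\<close> p by (elim open_prod_elim) (auto simp: mem_Times_iff)
  obtain r where r: "r > 0" "ball y r \<subseteq> B" using AB open_contains_ball by blast
  define Y where "Y = ball y r"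
  have Y: "open Y" "convex Y" "y \<in> Y" "A \<times> Y \<subseteq> D" using r AB by (auto simp: Y_def)
  define d2 where "d2 u v = deriv (\<lambda>w. F (u, w)) v" for u v
  have h1: "(\<lambda>u. F (u, v)) holomorphic_on A" if "v \<in> Y" for v
    using Y that by (intro holomorphic_on_subset[OF hol1[of v]]) auto
  have h2: "(\<lambda>w. F (u, w)) holomorphic_on Y" if "u \<in> A" for u
    using Y that by (intro holomorphic_on_subset[OF hol2[of u]]) auto
  have "continuous_on (A \<times> Y) (\<lambda>(u, v). F (u, v))"
    using Y by (simp add: split_beta continuous_on_subset[OF cont])
  then have "continuous_on (A \<times> Y) (\<lambda>(u, v). d2 u v)"
    unfolding d2_def using Y(1) h2 by (intro continuous_on_deriv_param[of Y A "\<lambda>u w. F (u, w)"]) auto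
  then have c: "continuous_on (A \<times> Y) (\<lambda>p. blinfun_mult_right (d2 (fst p) (snd p)))"
    by (intro bounded_linear.continuous_on[OF bounded_linear_blinfun_mult_right]) (simp add: split_beta)
  have "((\<lambda>(u, v). F (u, v)) has_derivative (\<lambda>(tx, ty). deriv (\<lambda>u. F (u, y)) x * tx + blinfun_mult_right (d2 x y) ty))
      (at (x, y) within A \<times> Y)"
  proof (rule has_derivative_partialsI)
    show "((\<lambda>u. F (u, y)) has_derivative (*) (deriv (\<lambda>u. F (u, y)) x)) (at x within A)"
      using holomorphic_derivI[OF h1[OF Y(3)] AB(1,3)]
      by (simp add: has_field_derivative_def[symmetric] has_field_derivative_at_within)
    show "((\<lambda>v. F (u, v)) has_derivative blinfun_apply (blinfun_mult_right (d2 u v))) (at v within Y)"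
      if "u \<in> A" "v \<in> Y" for u v
      using holomorphic_derivI[OF h2[OF that(1)] Y(1) that(2)]
      by (simp add: has_field_derivative_def[symmetric] has_field_derivative_at_within d2_def blinfun_mult_right.rep_eq)
    show "continuous (at (x, y) within A \<times> Y) (\<lambda>(u, v). blinfun_mult_right (d2 u v))"
      using c AB(3) Y(3) unfolding continuous_on_eq_continuous_within split_beta by blast
  qed (use Y in auto)
  moreover have "at (x, y) within A \<times> Y = at (x, y)"
    using AB Y by (intro at_within_open open_Times) auto
  moreover have "at p within D = at (x, y)"
    using \<open>open D\<close> \<open>p \<in> D\<close> unfolding p by (intro at_within_open) auto
  ultimately have "(F has_derivative (\<lambda>h. deriv (\<lambda>u. F (u, y)) x * fst h + d2 x y * snd h)) (at p within D)"
    by (simp add: case_prod_unfold blinfun_mult_right.rep_eq)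
  then show "\<exists>a b. (F has_derivative (\<lambda>h. a * fst h + b * snd h)) (at p within D)"
    by blast
qed

lemma holomorphic2_on_imp_continuous_on: "holomorphic2_on F D \<Longrightarrow> continuous_on D F"
  unfolding holomorphic2_on_def continuous_on_eq_continuous_within
  by (blast intro: has_derivative_continuous)

lemma holomorphic2_on_fst:
  assumes "open D" "holomorphic2_on F D"
  shows "(\<lambda>z1. F (z1, z2)) holomorphic_on {z1. (z1, z2) \<in> D}"
  unfolding holomorphic_on_def
proof
  fix z1 assume "z1 \<in> {z1. (z1, z2) \<in> D}"
  then have D: "(z1, z2) \<in> D" by simp
  obtain a b where "(F has_derivative (\<lambda>h. a * fst h + b * snd h)) (at (z1, z2) within D)"
    using assms(2) D unfolding holomorphic2_on_def by blast
  then have F: "(F has_derivative (\<lambda>h. a * fst h + b * snd h)) (at (z1, z2))"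
    using at_within_open[OF D assms(1)] by simp
  have "((\<lambda>z1. F (z1, z2)) has_derivative (\<lambda>h. a * fst (h, 0::complex) + b * snd (h, 0::complex))) (at z1)"
    by (rule has_derivative_compose[of "\<lambda>z1. (z1, z2)" "\<lambda>h. (h, 0)" _ _ F, OF _ F]) (auto intro!: derivative_eq_intros)
  then have "((\<lambda>z1. F (z1, z2)) has_field_derivative a) (at z1)"
    by (simp add: has_field_derivative_def)
  then show "(\<lambda>z1. F (z1, z2)) field_differentiable at z1 within {z1. (z1, z2) \<in> D}"
    using field_differentiable_at_within field_differentiable_def by blast
qed

lemma holomorphic2_on_snd:
  assumes "open D" "holomorphic2_on F D"
  shows "(\<lambda>z2. F (z1, z2)) holomorphic_on {z2. (z1, z2) \<in> D}"
  unfolding holomorphic_on_def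
proof
  fix z2 assume "z2 \<in> {z2. (z1, z2) \<in> D}"
  then have D: "(z1, z2) \<in> D" by simp
  obtain a b where "(F has_derivative (\<lambda>h. a * fst h + b * snd h)) (at (z1, z2) within D)"
    using assms(2) D unfolding holomorphic2_on_def by blast
  then have F: "(F has_derivative (\<lambda>h. a * fst h + b * snd h)) (at (z1, z2))"
    using at_within_open[OF D assms(1)] by simp
  have "((\<lambda>z2. F (z1, z2)) has_derivative (\<lambda>h. a * fst (0::complex, h) + b * snd (0::complex, h))) (at z2)"
    by (rule has_derivative_compose[of "\<lambda>z2. (z1, z2)" "\<lambda>h. (0, h)" _ _ F, OF _ F]) (auto intro!: derivative_eq_intros)
  then have "((\<lambda>z2. F (z1, z2)) has_field_derivative b) (at z2)"
    by (simp add: has_field_derivative_def)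
  then show "(\<lambda>z2. F (z1, z2)) field_differentiable at z2 within {z2. (z1, z2) \<in> D}"
    using field_differentiable_at_within field_differentiable_def by blast
qed

lemma holomorphic_on_locally_uniform_limit:
  assumes "open U" "\<F> \<noteq> bot" and hol: "\<And>n. f n holomorphic_on U"
    and lim: "\<And>z. z \<in> U \<Longrightarrow> \<exists>V. open V \<and> z \<in> V \<and> uniform_limit V f g \<F>"
  shows "g holomorphic_on U"
proof -
  have "g field_differentiable at z" if zU: "z \<in> U" for z
  proof -
    obtain V where V: "open V" "z \<in> V" "uniform_limit V f g \<F>" using lim[OF zU] by blast
    then obtain r where r: "r > 0" "cball z r \<subseteq> V \<inter> U"
      using \<open>open U\<close> zU by (metis IntI open_Int open_contains_cball)
    obtain "g holomorphic_on ball z r"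
    proof (rule holomorphic_uniform_limit[of z r f \<F> g])
      show "eventually (\<lambda>n. continuous_on (cball z r) (f n) \<and> f n holomorphic_on ball z r) \<F>"
      proof (intro always_eventually allI conjI)
        fix n
        have "f n holomorphic_on cball z r" using r(2) by (intro holomorphic_on_subset[OF hol]) auto
        then show "continuous_on (cball z r) (f n)" "f n holomorphic_on ball z r"
          by (auto intro: holomorphic_on_imp_continuous_on elim: holomorphic_on_subset)
      qed
      show "uniform_limit (cball z r) f g \<F>"
        using r(2) by (intro uniform_limit_on_subset[OF V(3)]) auto
    qed (use \<open>\<F> \<noteq> bot\<close> in auto)
    then show ?thesis
      by (rule holomorphic_on_imp_differentiable_at[OF _ open_ball]) (use r(1) in simp)
  qed
  then show ?thesis
    unfolding holomorphic_on_def using field_differentiable_at_within by blast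
qed

lemma holomorphic2_on_locally_uniform_limit:
  assumes "open D" "\<F> \<noteq> bot" and hol: "\<And>n. holomorphic2_on (f n) D"
    and lim: "\<And>p. p \<in> D \<Longrightarrow> \<exists>V. open V \<and> p \<in> V \<and> uniform_limit V f g \<F>"
  shows "holomorphic2_on g D"
proof (rule holomorphic2_onI[OF \<open>open D\<close>])
  have "isCont g p" if pD: "p \<in> D" for p
  proof -
    obtain V where V: "open V" "p \<in> V" "uniform_limit V f g \<F>" using lim[OF pD] by blast
    have "continuous_on (V \<inter> D) g"
    proof (rule uniform_limit_theorem)
      show "eventually (\<lambda>n. continuous_on (V \<inter> D) (f n)) \<F>"
        by (intro always_eventually allI continuous_on_subset[OF holomorphic2_on_imp_continuous_on[OF hol]]) auto
      show "uniform_limit (V \<inter> D) f g \<F>" by (rule uniform_limit_on_subset[OF V(3)]) auto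
    qed (use \<open>\<F> \<noteq> bot\<close> in auto)
    then show ?thesis
      using continuous_on_eq_continuous_at[OF open_Int[OF V(1) \<open>open D\<close>]] V(2) pD by blast
  qed
  then show "continuous_on D g" by (simp add: continuous_at_imp_continuous_on)
  have op1: "open {z1. (z1, z2) \<in> V}" if "open V" for z2 :: complex and V :: "(complex \<times> complex) set"
    using open_vimage[OF that, of "\<lambda>z1. (z1, z2)"] by (simp add: vimage_def continuous_intros)
  have op2: "open {z2. (z1, z2) \<in> V}" if "open V" for z1 :: complex and V :: "(complex \<times> complex) set"
    using open_vimage[OF that, of "\<lambda>z2. (z1, z2)"] by (simp add: vimage_def continuous_intros)
  show "(\<lambda>z1. g (z1, z2)) holomorphic_on {z1. (z1, z2) \<in> D}" for z2
  proof (rule holomorphic_on_locally_uniform_limit[OF op1[OF \<open>open D\<close>] \<open>\<F> \<noteq> bot\<close> holomorphic2_on_fst[OF \<open>open D\<close> hol]])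
    fix z1 assume "z1 \<in> {z1. (z1, z2) \<in> D}"
    then obtain V where V: "open V" "(z1, z2) \<in> V" "uniform_limit V f g \<F>" using lim by blast
    then have "uniform_limit {z1. (z1, z2) \<in> V} (\<lambda>n z1. f n (z1, z2)) (\<lambda>z1. g (z1, z2)) \<F>"
      unfolding uniform_limit_iff by (fastforce elim: eventually_mono)
    then show "\<exists>V. open V \<and> z1 \<in> V \<and> uniform_limit V (\<lambda>n z1. f n (z1, z2)) (\<lambda>z1. g (z1, z2)) \<F>"
      using V op1 by blast
  qed
  show "(\<lambda>z2. g (z1, z2)) holomorphic_on {z2. (z1, z2) \<in> D}" for z1
  proof (rule holomorphic_on_locally_uniform_limit[OF op2[OF \<open>open D\<close>] \<open>\<F> \<noteq> bot\<close> holomorphic2_on_snd[OF \<open>open D\<close> hol]])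
    fix z2 assume "z2 \<in> {z2. (z1, z2) \<in> D}"
    then obtain V where V: "open V" "(z1, z2) \<in> V" "uniform_limit V f g \<F>" using lim by blast
    then have "uniform_limit {z2. (z1, z2) \<in> V} (\<lambda>n z2. f n (z1, z2)) (\<lambda>z2. g (z1, z2)) \<F>"
      unfolding uniform_limit_iff by (fastforce elim: eventually_mono)
    then show "\<exists>V. open V \<and> z2 \<in> V \<and> uniform_limit V (\<lambda>n z2. f n (z1, z2)) (\<lambda>z2. g (z1, z2)) \<F>"
      using V op2 by blast
  qed
qed

lemma holomorphic2_on_add:
  "holomorphic2_on F D \<Longrightarrow> holomorphic2_on G D \<Longrightarrow> holomorphic2_on (\<lambda>z. F z + G z) D"
  unfolding holomorphic2_on_def
proof (intro ballI, goal_cases)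
  case (1 z)
  then obtain a b c d where "(F has_derivative (\<lambda>h. a * fst h + b * snd h)) (at z within D)"
    "(G has_derivative (\<lambda>h. c * fst h + d * snd h)) (at z within D)" by blast
  from has_derivative_add[OF this]
  have "((\<lambda>z. F z + G z) has_derivative (\<lambda>h. (a + c) * fst h + (b + d) * snd h)) (at z within D)"
    by (simp add: algebra_simps)
  then show ?case by blast
qed

lemma holomorphic2_on_cmult:
  "holomorphic2_on F D \<Longrightarrow> holomorphic2_on (\<lambda>z. c * F z) D"
  unfolding holomorphic2_on_def
proof (intro ballI, goal_cases)
  case (1 z)
  then obtain a b where "(F has_derivative (\<lambda>h. a * fst h + b * snd h)) (at z within D)" by blast
  from has_derivative_mult_right[OF this, of c]
  have "((\<lambda>z. c * F z) has_derivative (\<lambda>h. (c * a) * fst h + (c * b) * snd h)) (at z within D)"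
    by (simp add: algebra_simps)
  then show ?case by blast
qed

section \<open>Fourier coefficients on the circle\<close>

lemma integral_cis_period:
  "integral {0..1} (\<lambda>\<theta>. cis (2 * pi * of_int n * \<theta>)) = (if n = 0 then 1 else 0)"
proof (cases "n = 0")
  case False
  define c where "c = 2 * pi * real_of_int n"
  have c: "c \<noteq> 0" using False by (simp add: c_def)
  have "((\<lambda>\<theta>. cis (c * \<theta>)) has_integral (cis (c * 1) / (\<i> * c) - cis (c * 0) / (\<i> * c))) {0..1}"
  proof (rule fundamental_theorem_of_calculus)
    fix x :: real
    have "((\<lambda>\<theta>. exp (\<i> * (of_real c * \<theta>)) / (\<i> * c)) has_field_derivative exp (\<i> * (of_real c * of_real x))) (at (of_real x))"
      using c by (auto intro!: derivative_eq_intros simp: mult_ac)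
    from has_vector_derivative_real_field[OF this]
    show "((\<lambda>\<theta>. cis (c * \<theta>) / (\<i> * c)) has_vector_derivative cis (c * x)) (at x within {0..1})"
      by (simp add: cis_conv_exp o_def has_vector_derivative_at_within)
  qed simp
  moreover have "cis (c * 1) = 1"
    unfolding c_def using cis_multiple_2pi[of "real_of_int n"] by simp
  ultimately show ?thesis using False by (simp add: integral_unique c_def)
qed simp

definition fourier_coeff :: "(real \<Rightarrow> complex) \<Rightarrow> int \<Rightarrow> complex" where
  "fourier_coeff h n = integral {0..1} (\<lambda>\<theta>. h \<theta> * cis (- (2 * pi * of_int n * \<theta>)))"

lemma Parseval_trigonometric_polynomial:
  assumes "finite A"
  shows "integral {0..1} (\<lambda>\<theta>. (cmod (\<Sum>n\<in>A. c n * cis (2 * pi * of_int n * \<theta>)))\<^sup>2) = (\<Sum>n\<in>A. (cmod (c n))\<^sup>2)"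
proof -
  let ?S = "\<lambda>\<theta>. \<Sum>n\<in>A. c n * cis (2 * pi * of_int n * \<theta>)"
  have "complex_of_real (integral {0..1} (\<lambda>\<theta>. (cmod (?S \<theta>))\<^sup>2)) = integral {0..1} (\<lambda>\<theta>. of_real ((cmod (?S \<theta>))\<^sup>2))"
    by (intro integral_linear[OF _ bounded_linear_of_real, unfolded o_def, symmetric]
        integrable_continuous_interval continuous_intros)
  also have "\<dots> = integral {0..1} (\<lambda>\<theta>. \<Sum>n\<in>A. \<Sum>m\<in>A. (c n * cnj (c m)) * cis (2 * pi * of_int (n - m) * \<theta>))"
  proof (intro Henstock_Kurzweil_Integration.integral_cong)
    fix \<theta> :: real
    have "cis (2 * pi * of_int n * \<theta>) * cis (- (2 * pi * of_int m * \<theta>)) = cis (2 * pi * of_int (n - m) * \<theta>)" for n m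
      by (simp add: cis_mult algebra_simps)
    then show "of_real ((cmod (?S \<theta>))\<^sup>2) = (\<Sum>n\<in>A. \<Sum>m\<in>A. (c n * cnj (c m)) * cis (2 * pi * of_int (n - m) * \<theta>))"
      by (simp only: complex_norm_square cnj_sum sum_product complex_cnj_mult cis_cnj)
         (simp add: mult_ac)
  qed
  also have "\<dots> = (\<Sum>n\<in>A. \<Sum>m\<in>A. (c n * cnj (c m)) * integral {0..1} (\<lambda>\<theta>. cis (2 * pi * of_int (n - m) * \<theta>)))"
    using assms
    by (simp add: Henstock_Kurzweil_Integration.integral_sum integrable_continuous_interval continuous_intros del: of_int_diff)
  also have "\<dots> = (\<Sum>n\<in>A. of_real ((cmod (c n))\<^sup>2))"
    unfolding integral_cis_period complex_norm_square using assms
    by (intro sum.cong) (auto simp: if_distrib sum.delta' cong: if_cong)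
  finally show ?thesis by (simp only: of_real_sum[symmetric] of_real_eq_iff)
qed

lemma Bessel_inequality:
  assumes h: "continuous_on {0..1} h" and "finite A"
  shows "(\<Sum>n\<in>A. (cmod (fourier_coeff h n))\<^sup>2) \<le> integral {0..1} (\<lambda>\<theta>. (cmod (h \<theta>))\<^sup>2)"
proof -
  define c where "c = fourier_coeff h"
  let ?S = "\<lambda>\<theta>. \<Sum>n\<in>A. c n * cis (2 * pi * of_int n * \<theta>)"
  have "integral {0..1} (\<lambda>\<theta>. h \<theta> * cnj (?S \<theta>)) = integral {0..1} (\<lambda>\<theta>. \<Sum>n\<in>A. cnj (c n) * (h \<theta> * cis (- (2 * pi * of_int n * \<theta>))))"
    by (intro Henstock_Kurzweil_Integration.integral_cong) (simp add: sum_distrib_left cis_cnj mult_ac)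
  also have "\<dots> = (\<Sum>n\<in>A. cnj (c n) * fourier_coeff h n)"
    unfolding fourier_coeff_def using assms
    by (simp add: Henstock_Kurzweil_Integration.integral_sum integrable_continuous_interval continuous_intros)
  also have "\<dots> = of_real (\<Sum>n\<in>A. (cmod (c n))\<^sup>2)"
    unfolding of_real_sum complex_norm_square by (simp add: c_def mult.commute)
  finally have cross: "integral {0..1} (\<lambda>\<theta>. h \<theta> * cnj (?S \<theta>)) = of_real (\<Sum>n\<in>A. (cmod (c n))\<^sup>2)" .
  have Re: "integral {0..1} (\<lambda>\<theta>. Re (h \<theta> * cnj (?S \<theta>))) = (\<Sum>n\<in>A. (cmod (c n))\<^sup>2)"
    using arg_cong[OF cross, of Re] integral_linear[OF _ bounded_linear_Re, of "\<lambda>\<theta>. h \<theta> * cnj (?S \<theta>)" "{0..1}"] h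
    by (simp add: o_def integrable_continuous_interval continuous_intros)
  have cmod_diff: "(cmod (a - b))\<^sup>2 = (cmod a)\<^sup>2 + (cmod b)\<^sup>2 - 2 * Re (a * cnj b)" for a b
    unfolding cmod_power2 by (simp add: power2_eq_square algebra_simps)
  have "0 \<le> integral {0..1} (\<lambda>\<theta>. (cmod (h \<theta> - ?S \<theta>))\<^sup>2)"
    using h by (intro Henstock_Kurzweil_Integration.integral_nonneg integrable_continuous_interval continuous_intros) auto
  also have "\<dots> = integral {0..1} (\<lambda>\<theta>. (cmod (h \<theta>))\<^sup>2 + (cmod (?S \<theta>))\<^sup>2 - 2 * Re (h \<theta> * cnj (?S \<theta>)))"
    by (simp only: cmod_diff)
  also have "\<dots> = integral {0..1} (\<lambda>\<theta>. (cmod (h \<theta>))\<^sup>2) + integral {0..1} (\<lambda>\<theta>. (cmod (?S \<theta>))\<^sup>2) - 2 * integral {0..1} (\<lambda>\<theta>. Re (h \<theta> * cnj (?S \<theta>)))"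
    using h by (simp only: Henstock_Kurzweil_Integration.integral_diff Henstock_Kurzweil_Integration.integral_add
        Henstock_Kurzweil_Integration.integral_mult_right integrable_continuous_interval continuous_intros)
  finally show ?thesis
    by (simp only: Re Parseval_trigonometric_polynomial[OF \<open>finite A\<close>]) (simp add: c_def)
qed

lemma continuous_on_real_polynomial_cis:
  assumes "real_polynomial_function p"
  shows "continuous_on A (\<lambda>\<theta>. p (cis (2 * pi * \<theta>)))"
proof -
  have "continuous_on UNIV p"
    using assms by (intro continuous_at_imp_continuous_on ballI continuous_real_polymonial_function)
  moreover have "continuous_on A (\<lambda>\<theta>. cis (2 * pi * \<theta>))" by (intro continuous_intros)
  ultimately show ?thesis by (rule continuous_on_compose2) simp
qed

text \<open>Multiplying a function whose Fourier coefficients all vanish by \<open>w\<close> or \<open>cnj w\<close> shifts the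
  coefficients, so multiplication by any real polynomial in the coordinates keeps them zero.\<close>

lemma fourier_coeff_mult_polynomial_eq_0:
  assumes "real_polynomial_function p" and h: "continuous_on {0..1} h" "\<And>n. fourier_coeff h n = 0"
  shows "fourier_coeff (\<lambda>\<theta>. h \<theta> * of_real (p (cis (2 * pi * \<theta>)))) n = 0"
  using assms
proof (induction p arbitrary: h n rule: real_polynomial_function.induct)
  case (linear f)
  define a where "a = (of_real (f 1) - \<i> * of_real (f \<i>)) / 2"
  have f: "of_real (f w) = a * w + cnj a * cnj w" for w
  proof -
    have "f w = f (Re w *\<^sub>R 1 + Im w *\<^sub>R \<i>)"
      by (rule arg_cong[of _ _ f]) (simp add: complex_eq_iff)
    also have "\<dots> = Re w * f 1 + Im w * f \<i>"
      using linear(1) by (simp add: linear_simps)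
    finally show ?thesis by (simp add: a_def complex_eq_iff field_simps)
  qed
  have "fourier_coeff (\<lambda>\<theta>. h \<theta> * of_real (f (cis (2 * pi * \<theta>)))) n
      = integral {0..1} (\<lambda>\<theta>. a * (h \<theta> * cis (- (2 * pi * of_int (n - 1) * \<theta>))) + cnj a * (h \<theta> * cis (- (2 * pi * of_int (n + 1) * \<theta>))))"
    unfolding fourier_coeff_def
  proof (intro Henstock_Kurzweil_Integration.integral_cong)
    fix \<theta> :: real
    have alg: "h0 * (a * u + b * v) * e = a * (h0 * (u * e)) + b * (h0 * (v * e))" for h0 a b u v e :: complex
      by (simp add: algebra_simps)
    have "cis (2 * pi * \<theta>) * cis (- (2 * pi * of_int n * \<theta>)) = cis (- (2 * pi * of_int (n - 1) * \<theta>))"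
      "cis (- (2 * pi * \<theta>)) * cis (- (2 * pi * of_int n * \<theta>)) = cis (- (2 * pi * of_int (n + 1) * \<theta>))"
      by (simp_all add: cis_mult algebra_simps)
    then show "h \<theta> * of_real (f (cis (2 * pi * \<theta>))) * cis (- (2 * pi * of_int n * \<theta>))
      = a * (h \<theta> * cis (- (2 * pi * of_int (n - 1) * \<theta>))) + cnj a * (h \<theta> * cis (- (2 * pi * of_int (n + 1) * \<theta>)))"
      unfolding f cis_cnj alg by (simp only:)
  qed
  also have "\<dots> = a * fourier_coeff h (n - 1) + cnj a * fourier_coeff h (n + 1)"
    unfolding fourier_coeff_def using linear(2)
    by (simp only: Henstock_Kurzweil_Integration.integral_add Henstock_Kurzweil_Integration.integral_mult_right
        integrable_continuous_interval continuous_intros)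
  finally show ?case using linear(3) by simp
next
  case (const c)
  have "fourier_coeff (\<lambda>\<theta>. h \<theta> * of_real c) n = of_real c * fourier_coeff h n"
    unfolding fourier_coeff_def Henstock_Kurzweil_Integration.integral_mult_right[symmetric] by (simp add: mult_ac)
  with const show ?case by simp
next
  case (add f g)
  have c: "continuous_on {0..1} (\<lambda>\<theta>. p (cis (2 * pi * \<theta>)))" if "real_polynomial_function p" for p :: "complex \<Rightarrow> real"
    by (rule continuous_on_real_polynomial_cis[OF that])
  have "fourier_coeff (\<lambda>\<theta>. h \<theta> * of_real (f (cis (2 * pi * \<theta>)) + g (cis (2 * pi * \<theta>)))) n
      = fourier_coeff (\<lambda>\<theta>. h \<theta> * of_real (f (cis (2 * pi * \<theta>)))) n + fourier_coeff (\<lambda>\<theta>. h \<theta> * of_real (g (cis (2 * pi * \<theta>)))) n"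
    unfolding fourier_coeff_def of_real_add distrib_left distrib_right
    by (intro Henstock_Kurzweil_Integration.integral_add integrable_continuous_interval continuous_intros add.prems c add.hyps)
  with add show ?case by simp
next
  case (mult f g)
  have c: "continuous_on {0..1} (\<lambda>\<theta>. f (cis (2 * pi * \<theta>)))"
    by (rule continuous_on_real_polynomial_cis[OF mult(1)])
  have "fourier_coeff (\<lambda>\<theta>. (h \<theta> * of_real (f (cis (2 * pi * \<theta>)))) * of_real (g (cis (2 * pi * \<theta>)))) n = 0"
    by (intro mult.IH(2) continuous_intros mult.prems c mult.IH(1))
  then show ?case by (simp add: mult_ac)
qed

text \<open>By Stone--Weierstrass the conjugate of \<open>\<phi>\<close> is on the circle a uniform limit of polynomials \<open>p - \<i> q\<close>,
  and the integral of \<open>\<phi>\<close> times such a polynomial is zero; so the integral of \<open>\<bar>\<phi>\<bar>\<^sup>2\<close> is zero.\<close>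

lemma fourier_coeff_eq_0_imp_eq_0:
  assumes \<phi>: "continuous_on (sphere 0 1) \<phi>"
    and zero: "\<And>n. fourier_coeff (\<lambda>\<theta>. \<phi> (cis (2 * pi * \<theta>))) n = 0"
  shows "\<phi> (cis (2 * pi * \<theta>0)) = 0"
proof -
  define h where "h \<theta> = \<phi> (cis (2 * pi * \<theta>))" for \<theta>
  have h: "continuous_on A h" for A
    unfolding h_def by (intro continuous_on_compose2[OF \<phi>] continuous_intros) auto
  have zero': "fourier_coeff h n = 0" for n using zero[of n] unfolding h_def .
  have orth: "integral {0..1} (\<lambda>\<theta>. h \<theta> * of_real (p (cis (2 * pi * \<theta>)))) = 0"
    if "real_polynomial_function p" for p
    using fourier_coeff_mult_polynomial_eq_0[OF that h zero', of 0] by (simp add: fourier_coeff_def)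
  have "compact (h ` {0..1})" by (intro compact_continuous_image h) auto
  then obtain B where B: "\<And>\<theta>. \<theta> \<in> {0..1} \<Longrightarrow> cmod (h \<theta>) \<le> B"
    using compact_imp_bounded bounded_iff by (metis imageI)
  have "0 \<le> B" using B[of 0] norm_ge_zero[of "h 0"] by (metis atLeastAtMost_iff order_refl order_trans zero_le_one)
  have pc: "continuous_on A (\<lambda>\<theta>. p (cis (2 * pi * \<theta>)))" if "real_polynomial_function p" for A and p :: "complex \<Rightarrow> real"
    by (rule continuous_on_real_polynomial_cis[OF that])
  have le: "integral {0..1} (\<lambda>\<theta>. (cmod (h \<theta>))\<^sup>2) \<le> 0 + e" if "e > 0" for e
  proof -
    define d where "d = e / (2 * B + 1)"
    have d: "d > 0" using \<open>e > 0\<close> \<open>0 \<le> B\<close> by (simp add: d_def)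
    obtain p where p: "real_polynomial_function p" "\<And>w. w \<in> sphere 0 1 \<Longrightarrow> \<bar>Re (\<phi> w) - p w\<bar> < d"
      using Stone_Weierstrass_real_polynomial_function[of "sphere 0 1" "\<lambda>w. Re (\<phi> w)" d] \<phi> d
      by (auto intro!: continuous_intros)
    obtain q where q: "real_polynomial_function q" "\<And>w. w \<in> sphere 0 1 \<Longrightarrow> \<bar>Im (\<phi> w) - q w\<bar> < d"
      using Stone_Weierstrass_real_polynomial_function[of "sphere 0 1" "\<lambda>w. Im (\<phi> w)" d] \<phi> d
      by (auto intro!: continuous_intros)
    define r where "r \<theta> = of_real (p (cis (2 * pi * \<theta>))) - \<i> * of_real (q (cis (2 * pi * \<theta>)))" for \<theta>
    have rc: "continuous_on {0..1} r" unfolding r_def by (intro continuous_intros pc p q)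
    have "integral {0..1} (\<lambda>\<theta>. h \<theta> * r \<theta>) = integral {0..1} (\<lambda>\<theta>. h \<theta> * of_real (p (cis (2 * pi * \<theta>))) - \<i> * (h \<theta> * of_real (q (cis (2 * pi * \<theta>)))))"
      by (simp add: r_def algebra_simps)
    also have "\<dots> = 0"
      using p(1) q(1)
      by (simp add: Henstock_Kurzweil_Integration.integral_diff integrable_continuous_interval continuous_intros h pc orth)
    finally have r0: "integral {0..1} (\<lambda>\<theta>. h \<theta> * r \<theta>) = 0" .
    have "complex_of_real (integral {0..1} (\<lambda>\<theta>. (cmod (h \<theta>))\<^sup>2)) = integral {0..1} (\<lambda>\<theta>. of_real ((cmod (h \<theta>))\<^sup>2))"
      by (intro integral_linear[OF _ bounded_linear_of_real, unfolded o_def, symmetric]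
          integrable_continuous_interval continuous_intros h)
    also have "\<dots> = integral {0..1} (\<lambda>\<theta>. h \<theta> * (cnj (h \<theta>) - r \<theta>) + h \<theta> * r \<theta>)"
      unfolding complex_norm_square by (simp add: algebra_simps)
    also have "\<dots> = integral {0..1} (\<lambda>\<theta>. h \<theta> * (cnj (h \<theta>) - r \<theta>))"
      using r0 by (simp add: Henstock_Kurzweil_Integration.integral_add integrable_continuous_interval continuous_intros h rc)
    finally have "\<bar>integral {0..1} (\<lambda>\<theta>. (cmod (h \<theta>))\<^sup>2)\<bar> = cmod (integral {0..1} (\<lambda>\<theta>. h \<theta> * (cnj (h \<theta>) - r \<theta>)))"
      by (metis norm_of_real)
    also have "\<dots> \<le> integral {0..1} (\<lambda>\<theta>::real. B * (2 * d))"
    proof (rule Henstock_Kurzweil_Integration.integral_norm_bound_integral)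
      fix \<theta> :: real assume \<theta>: "\<theta> \<in> {0..1}"
      have "cis (2 * pi * \<theta>) \<in> sphere 0 1" by simp
      from p(2)[OF this] q(2)[OF this]
      have "\<bar>Re (cnj (h \<theta>) - r \<theta>)\<bar> < d" "\<bar>Im (cnj (h \<theta>) - r \<theta>)\<bar> < d"
        by (auto simp: h_def r_def)
      then have "cmod (cnj (h \<theta>) - r \<theta>) \<le> 2 * d"
        using cmod_le[of "cnj (h \<theta>) - r \<theta>"] by linarith
      then show "cmod (h \<theta> * (cnj (h \<theta>) - r \<theta>)) \<le> B * (2 * d)"
        unfolding norm_mult using B[OF \<theta>] \<open>0 \<le> B\<close> by (intro mult_mono) auto
    qed (intro integrable_continuous_interval continuous_intros h rc)+
    also have "\<dots> \<le> e"
      using \<open>e > 0\<close> \<open>0 \<le> B\<close> by (simp add: d_def field_simps)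
    finally show ?thesis by simp
  qed
  have "integral {0..1} (\<lambda>\<theta>. (cmod (h \<theta>))\<^sup>2) \<le> 0" by (rule field_le_epsilon[OF le])
  moreover have "0 \<le> integral {0..1} (\<lambda>\<theta>. (cmod (h \<theta>))\<^sup>2)"
    by (intro Henstock_Kurzweil_Integration.integral_nonneg integrable_continuous_interval continuous_intros h) auto
  ultimately have "((\<lambda>\<theta>. (cmod (h \<theta>))\<^sup>2) has_integral 0) (cbox 0 1)"
    using integrable_integral[OF integrable_continuous_interval[of 0 1 "\<lambda>\<theta>. (cmod (h \<theta>))\<^sup>2"]]
    by (simp add: h continuous_intros)
  then have h0: "h \<theta> = 0" if "\<theta> \<in> {0..1}" for \<theta>
    using has_integral_0_cbox_imp_0[of 0 1 "\<lambda>\<theta>. (cmod (h \<theta>))\<^sup>2" \<theta>] that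
    by (simp add: h continuous_intros)
  have "cis (2 * pi * \<theta>0) = cis (2 * pi * frac \<theta>0)"
  proof -
    have "2 * pi * \<theta>0 = 2 * pi * frac \<theta>0 + 2 * pi * of_int \<lfloor>\<theta>0\<rfloor>"
      by (simp add: frac_def algebra_simps)
    then show ?thesis by (simp add: cis_mult[symmetric] cis_multiple_2pi)
  qed
  then show ?thesis using h0[of "frac \<theta>0"] frac_lt_1[of \<theta>0] by (simp add: h_def)
qed

section \<open>Slices of the worm domain\<close>

text \<open>The slice number \<open>l\<close> with parameters \<open>(t, s)\<close> lies over the line \<open>Im z1 = slice_height l t s\<close> and the circle
  \<open>ln ((cmod z2)\<^sup>2) = slice_level l s\<close>. All further reasoning treats the four slices alike in terms of
  these two numbers.\<close>

definition slice_height :: "nat \<Rightarrow> real \<Rightarrow> real \<Rightarrow> real" where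
  "slice_height l t s = (if l = 1 then s + t else if l = 2 then s - t else if l = 3 then - (s + t) else - (s - t))"

definition slice_level :: "nat \<Rightarrow> real \<Rightarrow> real" where
  "slice_level l s = (if l = 1 \<or> l = 2 then s else - s)"

lemma slice_eq:
  "slice F l t s (x, \<theta>) = F (Complex x (slice_height l t s), of_real (exp (slice_level l s / 2)) * cis (2 * pi * \<theta>))"
  by (simp add: slice_def slice_height_def slice_level_def)

lemma mem_worm_circle:
  "(z1, of_real (exp (\<sigma> / 2)) * cis \<phi>) \<in> worm \<beta> \<longleftrightarrow> \<bar>Im z1 - \<sigma>\<bar> < pi / 2 \<and> \<bar>\<sigma>\<bar> < \<beta> - pi / 2"
proof -
  have "ln ((cmod (of_real (exp (\<sigma> / 2)) * cis \<phi>))\<^sup>2) = \<sigma>"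
    by (simp add: norm_mult ln_realpow)
  then show ?thesis by (simp add: worm_def)
qed

lemma slice_in_worm:
  assumes "(t, s) \<in> worm_params \<beta>"
  shows "(Complex x (slice_height l t s), of_real (exp (slice_level l s / 2)) * cis \<phi>) \<in> worm \<beta>"
  using assms by (auto simp: mem_worm_circle worm_params_def slice_height_def slice_level_def)

text \<open>The slices fill the domain: the signs of the level and of height minus level select \<open>l\<close>.\<close>

lemma level_height_on_slice:
  assumes "\<bar>y - \<sigma>\<bar> < pi / 2" "\<bar>\<sigma>\<bar> < \<beta> - pi / 2"
  obtains l t s where "l \<in> {1..4}" "(t, s) \<in> worm_params \<beta>" "slice_height l t s = y" "slice_level l s = \<sigma>"
proof (cases "\<sigma> \<ge> 0")
  case True
  show ?thesis
  proof (cases "y \<ge> \<sigma>")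
    case True
    with \<open>\<sigma> \<ge> 0\<close> assms show ?thesis
      by (intro that[of 1 "y - \<sigma>" \<sigma>]) (auto simp: worm_params_def slice_height_def slice_level_def)
  next
    case False
    with \<open>\<sigma> \<ge> 0\<close> assms show ?thesis
      by (intro that[of 2 "\<sigma> - y" \<sigma>]) (auto simp: worm_params_def slice_height_def slice_level_def)
  qed
next
  case False
  show ?thesis
  proof (cases "y \<ge> \<sigma>")
    case True
    with \<open>\<not> \<sigma> \<ge> 0\<close> assms show ?thesis
      by (intro that[of 4 "y - \<sigma>" "- \<sigma>"]) (auto simp: worm_params_def slice_height_def slice_level_def)
  next
    case False
    with \<open>\<not> \<sigma> \<ge> 0\<close> assms show ?thesis
      by (intro that[of 3 "\<sigma> - y" "- \<sigma>"]) (auto simp: worm_params_def slice_height_def slice_level_def)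
  qed
qed

lemma worm_rotate: "(z1, cis \<theta> * z2) \<in> worm \<beta> \<longleftrightarrow> (z1, z2) \<in> worm \<beta>"
  by (simp add: worm_def norm_mult)

lemma open_annular_domain:
  "open {z. snd z \<noteq> 0 \<and> \<bar>Im (fst z) - ln ((cmod (snd z))\<^sup>2)\<bar> < a \<and> \<bar>ln ((cmod (snd z))\<^sup>2)\<bar> < b}"
proof -
  have 0: "open {z :: complex \<times> complex. snd z \<noteq> 0}"
    by (intro open_Collect_neq continuous_intros)
  define S where "S = {z :: complex \<times> complex. snd z \<noteq> 0}"
  have c: "continuous_on S (\<lambda>z. ln ((cmod (snd z))\<^sup>2))"
    unfolding S_def by (intro continuous_intros) auto
  have "open (S \<inter> (\<lambda>z. \<bar>Im (fst z) - ln ((cmod (snd z))\<^sup>2)\<bar>) -` {..<a})"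
    using 0 by (intro continuous_open_preimage continuous_intros c) (auto simp: S_def)
  moreover have "open (S \<inter> (\<lambda>z. \<bar>ln ((cmod (snd z))\<^sup>2)\<bar>) -` {..<b})"
    using 0 by (intro continuous_open_preimage continuous_intros c) (auto simp: S_def)
  moreover have "{z. snd z \<noteq> 0 \<and> \<bar>Im (fst z) - ln ((cmod (snd z))\<^sup>2)\<bar> < a \<and> \<bar>ln ((cmod (snd z))\<^sup>2)\<bar> < b}
      = (S \<inter> (\<lambda>z. \<bar>Im (fst z) - ln ((cmod (snd z))\<^sup>2)\<bar>) -` {..<a}) \<inter> (S \<inter> (\<lambda>z. \<bar>ln ((cmod (snd z))\<^sup>2)\<bar>) -` {..<b})"
    by (auto simp: S_def)
  ultimately show ?thesis by (simp add: open_Int)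
qed

lemma open_worm: "open (worm \<beta>)"
proof -
  have "worm \<beta> = {z. snd z \<noteq> 0 \<and> \<bar>Im (fst z) - ln ((cmod (snd z))\<^sup>2)\<bar> < pi / 2 \<and> \<bar>ln ((cmod (snd z))\<^sup>2)\<bar> < \<beta> - pi / 2}"
    by (auto simp: worm_def)
  then show ?thesis by (simp only: open_annular_domain)
qed

lemma continuous_on_slice:
  assumes "holomorphic2_on F (worm \<beta>)" "(t, s) \<in> worm_params \<beta>"
  shows "continuous_on UNIV (slice F l t s)"
proof -
  have "slice F l t s = (\<lambda>p. F (Complex (fst p) (slice_height l t s), of_real (exp (slice_level l s / 2)) * cis (2 * pi * snd p)))"
    by (auto simp: fun_eq_iff slice_eq)
  moreover have "continuous_on UNIV (\<lambda>p. F (Complex (fst p) (slice_height l t s), of_real (exp (slice_level l s / 2)) * cis (2 * pi * snd p)))"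
    using slice_in_worm[OF assms(2)]
    by (intro continuous_on_compose2[OF holomorphic2_on_imp_continuous_on[OF assms(1)]])
       (auto simp: Complex_eq intro!: continuous_intros)
  ultimately show ?thesis by simp
qed

interpretation circle: sigma_finite_measure "restrict_space lborel {0..<1::real}"
  by (intro sigma_finite_measure_restrict_space) (auto simp: lborel.sigma_finite_measure_axioms)

interpretation line_circle: pair_sigma_finite lborel "restrict_space lborel {0..<1::real}" ..

lemma borel_measurable_line_circle:
  assumes "g \<in> borel_measurable borel"
  shows "g \<in> borel_measurable line_circle"
proof -
  have "(\<lambda>x. x) \<in> measurable (restrict_space lborel {0..<1::real}) borel"
    by (intro measurable_restrict_space1) simp
  from measurable_compose[OF measurable_snd this, of lborel]
  have "snd \<in> measurable line_circle borel" by (simp add: line_circle_def)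
  moreover have "fst \<in> measurable line_circle lborel"
    unfolding line_circle_def by (rule measurable_fst)
  then have "fst \<in> measurable line_circle borel" by simp
  ultimately have "(\<lambda>p. (fst p, snd p)) \<in> measurable line_circle (borel \<Otimes>\<^sub>M borel)"
    by (intro measurable_Pair)
  then have "(\<lambda>p. p) \<in> measurable line_circle borel" by (simp add: borel_prod)
  from measurable_compose[OF this assms] show ?thesis .
qed

lemma measurable_slice:
  assumes "holomorphic2_on F (worm \<beta>)" "(t, s) \<in> worm_params \<beta>"
  shows "slice F l t s \<in> borel_measurable line_circle"
  by (intro borel_measurable_line_circle borel_measurable_continuous_onI continuous_on_slice[OF assms])

lemma nn_integral_circle:
  fixes k :: "real \<Rightarrow> real"
  assumes "continuous_on {0..1} k" "\<And>\<theta>. 0 \<le> k \<theta>"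
  shows "(\<integral>\<^sup>+\<theta>. ennreal (k \<theta>) \<partial>restrict_space lborel {0..<1}) = ennreal (integral {0..1} k)"
proof -
  have "(\<integral>\<^sup>+\<theta>. ennreal (k \<theta>) \<partial>restrict_space lborel {0..<1}) = (\<integral>\<^sup>+\<theta>. ennreal (k \<theta>) * indicator {0..<1} \<theta> \<partial>lborel)"
    by (rule nn_integral_restrict_space) simp
  also have "\<dots> = (\<integral>\<^sup>+\<theta>. ennreal (k \<theta>) * indicator {0..1} \<theta> \<partial>lborel)"
  proof (rule nn_integral_cong_AE)
    have "AE \<theta> in lborel. \<theta> \<noteq> (1::real)" by (rule AE_lborel_singleton)
    then show "AE \<theta> in lborel. ennreal (k \<theta>) * indicator {0..<1} \<theta> = ennreal (k \<theta>) * indicator {0..1} \<theta>"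
      by eventually_elim (auto simp: indicator_def)
  qed
  also have "\<dots> = ennreal (integral {0..1} k)"
    using assms by (intro nn_integral_has_integral_lebesgue' integrable_integral integrable_continuous_interval) auto
  finally show ?thesis .
qed

lemma nsq_line_circle_continuous:
  assumes g: "continuous_on UNIV g"
  shows "nsq_L2 line_circle g = (\<integral>\<^sup>+x. ennreal (integral {0..1} (\<lambda>\<theta>. (cmod (g (x, \<theta>)))\<^sup>2)) \<partial>lborel)"
proof -
  have "(\<lambda>p. ennreal ((cmod (g p))\<^sup>2)) \<in> borel_measurable line_circle"
    using borel_measurable_continuous_onI[OF g] by (intro borel_measurable_line_circle) measurable
  then have "nsq_L2 line_circle g = (\<integral>\<^sup>+x. \<integral>\<^sup>+\<theta>. ennreal ((cmod (g (x, \<theta>)))\<^sup>2) \<partial>restrict_space lborel {0..<1} \<partial>lborel)"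
    unfolding nsq_L2_def line_circle_def by (subst circle.nn_integral_fst) auto
  also have "\<dots> = (\<integral>\<^sup>+x. ennreal (integral {0..1} (\<lambda>\<theta>. (cmod (g (x, \<theta>)))\<^sup>2)) \<partial>lborel)"
    by (intro nn_integral_cong nn_integral_circle)
       (auto intro!: continuous_intros continuous_on_compose2[OF g])
  finally show ?thesis .
qed

lemma nsq_line_circle_character:
  assumes [measurable]: "a \<in> borel_measurable borel"
  shows "nsq_L2 line_circle (\<lambda>(x, \<theta>). a x * cis (k * \<theta>)) = nsq_L2 lborel a"
proof -
  have "(\<lambda>p. a (fst p)) \<in> borel_measurable (borel \<Otimes>\<^sub>M (borel :: real measure))" by measurable
  then have [measurable]: "(\<lambda>p :: real \<times> real. a (fst p)) \<in> borel_measurable borel" by (simp add: borel_prod)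
  have "(\<lambda>p. ennreal ((cmod (a (fst p)))\<^sup>2)) \<in> borel_measurable line_circle"
    by (intro borel_measurable_line_circle) measurable
  then have "(\<integral>\<^sup>+p. ennreal ((cmod (a (fst p)))\<^sup>2) \<partial>line_circle)
      = (\<integral>\<^sup>+x. \<integral>\<^sup>+\<theta>. ennreal ((cmod (a x))\<^sup>2) \<partial>restrict_space lborel {0..<1::real} \<partial>lborel)"
    unfolding line_circle_def by (subst circle.nn_integral_fst[symmetric]) auto
  also have "\<dots> = nsq_L2 lborel a"
    unfolding nsq_L2_def by (simp add: emeasure_restrict_space)
  finally show ?thesis
    unfolding nsq_L2_def by (simp add: case_prod_unfold norm_mult)
qed

section \<open>The components of fixed degree\<close>

definition lift :: "real \<Rightarrow> int \<Rightarrow> (complex \<Rightarrow> complex) \<Rightarrow> complex \<times> complex \<Rightarrow> complex" where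
  "lift \<beta> j f z = (if z \<in> worm \<beta> then f (fst z) * snd z powi j else 0)"

lemma circle_point_powi:
  "(of_real (exp (\<sigma> / 2)) * cis \<phi>) powi j = of_real (exp (of_int j * \<sigma> / 2)) * cis (of_int j * \<phi>)"
proof -
  have "of_real (exp (\<sigma> / 2)) * cis \<phi> = exp (of_real (\<sigma> / 2) + \<i> * of_real \<phi>)"
    by (simp only: exp_add exp_of_real cis_conv_exp)
  then have "(of_real (exp (\<sigma> / 2)) * cis \<phi>) powi j = exp (of_int j * (of_real (\<sigma> / 2) + \<i> * of_real \<phi>))"
    by (simp only: exp_power_int)
  also have "of_int j * (of_real (\<sigma> / 2) + \<i> * of_real \<phi>) = complex_of_real (of_int j * \<sigma> / 2) + \<i> * of_real (of_int j * \<phi>)"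
    by (simp add: algebra_simps)
  also have "exp \<dots> = of_real (exp (of_int j * \<sigma> / 2)) * cis (of_int j * \<phi>)"
    by (simp only: exp_add exp_of_real cis_conv_exp)
  finally show ?thesis .
qed

lemma slice_lift:
  assumes "(t, s) \<in> worm_params \<beta>"
  shows "slice (lift \<beta> j f) l t s = (\<lambda>(x, \<theta>). (of_real (exp (of_int j * slice_level l s / 2)) * f (Complex x (slice_height l t s)))
            * cis (of_int j * 2 * pi * \<theta>))"
proof (rule ext, clarify)
  fix x \<theta>
  show "slice (lift \<beta> j f) l t s (x, \<theta>) = (of_real (exp (of_int j * slice_level l s / 2)) * f (Complex x (slice_height l t s)))
            * cis (of_int j * 2 * pi * \<theta>)"
    using slice_in_worm[OF assms, of x l "2 * pi * \<theta>"]
    by (simp only: slice_eq lift_def if_True fst_conv snd_conv circle_point_powi) (simp add: mult_ac)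
qed

lemma slice_height_bound:
  assumes "(t, s) \<in> worm_params \<beta>"
  shows "\<bar>slice_height l t s\<bar> < \<beta>"
  using assms by (auto simp: worm_params_def slice_height_def abs_less_iff)

lemma nsq_slice_lift:
  assumes "(t, s) \<in> worm_params \<beta>" "f holomorphic_on strip \<beta>"
  shows "nsq_L2 line_circle (slice (lift \<beta> j f) l t s)
       = ennreal (exp (of_int j * slice_level l s)) * nsq_L2 lborel (\<lambda>x. f (Complex x (slice_height l t s)))"
proof -
  have [measurable]: "(\<lambda>x. f (Complex x (slice_height l t s))) \<in> borel_measurable borel"
    by (intro borel_measurable_continuous_onI strip_line_continuous[OF assms(2)] slice_height_bound[OF assms(1)])
  have "nsq_L2 line_circle (slice (lift \<beta> j f) l t s)
      = nsq_L2 lborel (\<lambda>x. of_real (exp (of_int j * slice_level l s / 2)) * f (Complex x (slice_height l t s)))"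
    unfolding slice_lift[OF assms(1)] by (rule nsq_line_circle_character) measurable
  also have "\<dots> = ennreal ((exp (of_int j * slice_level l s / 2))\<^sup>2) * nsq_L2 lborel (\<lambda>x. f (Complex x (slice_height l t s)))"
    by (subst nsq_L2_cmult) auto
  also have "(exp (of_int j * slice_level l s / 2))\<^sup>2 = exp (of_int j * slice_level l s)"
    by (simp add: exp_double[symmetric])
  finally show ?thesis .
qed

lemma worm_imp_strip:
  assumes "(z1, z2) \<in> worm \<beta>"
  shows "z1 \<in> strip \<beta>"
proof -
  have "\<bar>Im z1 - ln ((cmod z2)\<^sup>2)\<bar> < pi / 2" "\<bar>ln ((cmod z2)\<^sup>2)\<bar> < \<beta> - pi / 2"
    using assms by (auto simp: worm_def)
  then have "\<bar>Im z1\<bar> < \<beta>" by linarith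
  then show ?thesis by (simp add: strip_def)
qed

lemma holomorphic2_on_lift:
  assumes "f holomorphic_on strip \<beta>"
  shows "holomorphic2_on (lift \<beta> j f) (worm \<beta>)"
proof (rule holomorphic2_onI[OF open_worm])
  have strip: "fst z \<in> strip \<beta>" "snd z \<noteq> 0" if "z \<in> worm \<beta>" for z
    using that worm_imp_strip[of "fst z" "snd z"] by (auto simp: worm_def)
  have "continuous_on (worm \<beta>) (\<lambda>z. f (fst z) * snd z powi j)"
    using strip by (intro continuous_intros continuous_on_compose2[OF holomorphic_on_imp_continuous_on[OF assms]]) auto
  then show "continuous_on (worm \<beta>) (lift \<beta> j f)"
    by (simp add: lift_def cong: continuous_on_cong)
  show "(\<lambda>z1. lift \<beta> j f (z1, z2)) holomorphic_on {z1. (z1, z2) \<in> worm \<beta>}" for z2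
  proof (rule holomorphic_transform)
    show "(\<lambda>z1. f z1 * z2 powi j) holomorphic_on {z1. (z1, z2) \<in> worm \<beta>}"
      using strip by (intro holomorphic_intros holomorphic_on_subset[OF assms]) force
  qed (simp add: lift_def)
  show "(\<lambda>z2. lift \<beta> j f (z1, z2)) holomorphic_on {z2. (z1, z2) \<in> worm \<beta>}" for z1
  proof (rule holomorphic_transform)
    show "(\<lambda>z2. f z1 * z2 powi j) holomorphic_on {z2. (z1, z2) \<in> worm \<beta>}"
      using strip by (intro holomorphic_intros) force
  qed (simp add: lift_def)
qed

text \<open>In the coordinate \<open>\<zeta>\<close> with \<open>z2 = exp \<zeta>\<close>, an equivariant function divided by \<open>z2 powi j\<close> is
  holomorphic and does not change in the imaginary direction, so its derivative vanishes; the
  domain of \<open>\<zeta>\<close> is convex.\<close>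

lemma equivariant_quotient_const:
  assumes F: "holomorphic2_on F (worm \<beta>)"
    and eq: "\<And>z1 z2 \<theta>. (z1, z2) \<in> worm \<beta> \<Longrightarrow> F (z1, cis \<theta> * z2) = cis (of_int j * \<theta>) * F (z1, z2)"
    and z: "(z1, z2) \<in> worm \<beta>" "(z1, z2') \<in> worm \<beta>"
  shows "F (z1, z2) * z2 powi (- j) = F (z1, z2') * z2' powi (- j)"
proof -
  define E where "E = {\<zeta>. (z1, exp \<zeta>) \<in> worm \<beta>}"
  define H where "H \<zeta> = F (z1, exp \<zeta>) * exp (of_int (- j) * \<zeta>)" for \<zeta>
  have E_iff: "\<zeta> \<in> E \<longleftrightarrow> \<bar>Im z1 - 2 * Re \<zeta>\<bar> < pi / 2 \<and> \<bar>2 * Re \<zeta>\<bar> < \<beta> - pi / 2" for \<zeta>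
    by (simp add: E_def worm_def ln_realpow)
  have "E = {\<zeta>. Re \<zeta> < (Im z1 + pi / 2) / 2} \<inter> {\<zeta>. Re \<zeta> > (Im z1 - pi / 2) / 2}
      \<inter> ({\<zeta>. Re \<zeta> < (\<beta> - pi / 2) / 2} \<inter> {\<zeta>. Re \<zeta> > - (\<beta> - pi / 2) / 2})"
  proof (rule set_eqI)
    fix \<zeta>
    show "\<zeta> \<in> E \<longleftrightarrow> \<zeta> \<in> {\<zeta>. Re \<zeta> < (Im z1 + pi / 2) / 2} \<inter> {\<zeta>. Re \<zeta> > (Im z1 - pi / 2) / 2}
      \<inter> ({\<zeta>. Re \<zeta> < (\<beta> - pi / 2) / 2} \<inter> {\<zeta>. Re \<zeta> > - (\<beta> - pi / 2) / 2})"
      unfolding E_iff abs_less_iff Int_iff mem_Collect_eq by (auto simp: field_simps)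
  qed
  then have E: "convex E" "open E"
    by (simp_all only:) (intro convex_Int convex_halfspace_Re_lt convex_halfspace_Re_gt
        open_Int open_halfspace_Re_lt open_halfspace_Re_gt)+
  have hol: "H holomorphic_on E"
    unfolding H_def
    by (intro holomorphic_intros holomorphic_on_compose_gen[OF _ holomorphic2_on_snd[OF open_worm F], unfolded o_def])
       (auto simp: E_def)
  have shift: "H (\<zeta> + \<i> * of_real \<theta>) = H \<zeta>" if "\<zeta> \<in> E" for \<zeta> \<theta>
  proof -
    have e: "exp (\<zeta> + \<i> * of_real \<theta>) = cis \<theta> * exp \<zeta>" by (simp add: exp_add cis_conv_exp)
    have "exp (of_int (- j) * (\<zeta> + \<i> * of_real \<theta>)) = cis (- (of_int j * \<theta>)) * exp (of_int (- j) * \<zeta>)"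
      by (simp add: cis_conv_exp exp_add[symmetric] algebra_simps)
    then show ?thesis
      using that unfolding H_def e
      by (simp add: eq E_def cis_mult)
  qed
  have "(H has_field_derivative 0) (at \<zeta> within E)" if "\<zeta> \<in> E" for \<zeta>
  proof -
    have D: "(H has_field_derivative deriv H \<zeta>) (at \<zeta>)" by (rule holomorphic_derivI[OF hol E(2) that])
    have "((\<lambda>\<theta>. H (\<zeta> + \<i> * of_real \<theta>)) has_vector_derivative \<i> * deriv H \<zeta>) (at 0)"
    proof -
      have "((\<lambda>\<theta>. \<zeta> + \<i> * of_real \<theta>) has_vector_derivative \<i>) (at 0)"
        by (auto intro!: derivative_eq_intros)
      moreover have "(H has_field_derivative deriv H \<zeta>) (at (\<zeta> + \<i> * of_real 0))" using D by simp
      ultimately show ?thesis using field_vector_diff_chain_at by (fastforce simp: o_def)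
    qed
    moreover have "((\<lambda>\<theta>. H (\<zeta> + \<i> * of_real \<theta>)) has_vector_derivative 0) (at 0)"
      by (simp add: shift[OF that])
    ultimately have "\<i> * deriv H \<zeta> = 0" by (rule vector_derivative_unique_at)
    then show ?thesis using has_field_derivative_at_within[OF D] by simp
  qed
  from has_field_derivative_zero_constant[OF E(1) this]
  obtain c where c: "\<And>\<zeta>. \<zeta> \<in> E \<Longrightarrow> H \<zeta> = c" by blast
  have "F (z1, w) * w powi (- j) = c" if w: "(z1, w) \<in> worm \<beta>" for w
  proof -
    have "w \<noteq> 0" using w by (simp add: worm_def)
    then have "exp (Ln w) = w" by simp
    moreover from this have "w powi (- j) = exp (of_int (- j) * Ln w)"
      by (metis exp_power_int)
    moreover have "Ln w \<in> E" using w calculation(1) by (simp add: E_def)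
    ultimately show ?thesis using c[of "Ln w"] by (simp add: H_def)
  qed
  then show ?thesis using z by simp
qed

text \<open>The level \<open>\<sigma> = Im w * (\<beta> - pi / 2) / \<beta>\<close> makes \<open>(w, exp (\<sigma> / 2))\<close> a point of the worm domain for every
  \<open>w\<close> in the strip.\<close>

definition strip_section :: "real \<Rightarrow> complex \<Rightarrow> complex" where
  "strip_section \<beta> w = of_real (exp (Im w * (\<beta> - pi / 2) / \<beta> / 2))"

definition trace :: "real \<Rightarrow> int \<Rightarrow> (complex \<times> complex \<Rightarrow> complex) \<Rightarrow> complex \<Rightarrow> complex" where
  "trace \<beta> j F w = (if w \<in> strip \<beta> then F (w, strip_section \<beta> w) * strip_section \<beta> w powi (- j) else 0)"

lemma strip_section_in_worm:
  assumes "\<beta> > pi / 2" "w \<in> strip \<beta>"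
  shows "(w, strip_section \<beta> w) \<in> worm \<beta>"
proof -
  have \<beta>: "\<beta> > 0" using assms(1) pi_gt_zero by linarith
  have w: "\<bar>Im w\<bar> < \<beta>" using assms(2) by (simp add: strip_def)
  have "Im w - Im w * (\<beta> - pi / 2) / \<beta> = Im w * (pi / 2) / \<beta>"
    using \<beta> by (simp add: field_simps)
  moreover have "\<bar>Im w * (pi / 2) / \<beta>\<bar> < pi / 2"
    using w \<beta> by (simp add: abs_mult divide_simps)
  moreover have "\<bar>Im w * (\<beta> - pi / 2) / \<beta>\<bar> < \<beta> - pi / 2"
    using w \<beta> assms(1) by (simp add: abs_mult pos_divide_less_eq mult.commute)
  ultimately have "(w, of_real (exp (Im w * (\<beta> - pi / 2) / \<beta> / 2)) * cis 0) \<in> worm \<beta>"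
    by (simp only: mem_worm_circle)
  then show ?thesis by (simp add: strip_section_def)
qed

lemma lift_trace:
  assumes \<beta>: "\<beta> > pi / 2" and F: "holomorphic2_on F (worm \<beta>)" "\<And>z. z \<notin> worm \<beta> \<Longrightarrow> F z = 0"
    and eq: "\<And>z1 z2 \<theta>. (z1, z2) \<in> worm \<beta> \<Longrightarrow> F (z1, cis \<theta> * z2) = cis (of_int j * \<theta>) * F (z1, z2)"
  shows "lift \<beta> j (trace \<beta> j F) = F"
proof (rule ext, clarify)
  fix z1 z2
  show "lift \<beta> j (trace \<beta> j F) (z1, z2) = F (z1, z2)"
  proof (cases "(z1, z2) \<in> worm \<beta>")
    case True
    have z1: "z1 \<in> strip \<beta>" using True by (rule worm_imp_strip)
    have "z2 \<noteq> 0" using True by (simp add: worm_def)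
    have "trace \<beta> j F z1 = F (z1, z2) * z2 powi (- j)"
      using equivariant_quotient_const[OF F(1) eq strip_section_in_worm[OF \<beta> z1] True] z1
      by (simp add: trace_def)
    then show ?thesis
      using True \<open>z2 \<noteq> 0\<close> by (simp add: lift_def power_int_minus)
  qed (simp add: lift_def F(2))
qed

lemma trace_lift:
  assumes "\<beta> > pi / 2" "\<And>z. z \<notin> strip \<beta> \<Longrightarrow> f z = 0"
  shows "trace \<beta> j (lift \<beta> j f) = f"
proof
  fix w
  have "strip_section \<beta> w \<noteq> 0" by (simp add: strip_section_def)
  then show "trace \<beta> j (lift \<beta> j f) w = f w"
    using strip_section_in_worm[OF assms(1), of w] assms(2)[of w]
    by (auto simp: trace_def lift_def power_int_minus)
qed

lemma trace_holomorphic: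
  assumes \<beta>: "\<beta> > pi / 2" and F: "holomorphic2_on F (worm \<beta>)" "\<And>z. z \<notin> worm \<beta> \<Longrightarrow> F z = 0"
    and eq: "\<And>z1 z2 \<theta>. (z1, z2) \<in> worm \<beta> \<Longrightarrow> F (z1, cis \<theta> * z2) = cis (of_int j * \<theta>) * F (z1, z2)"
  shows "trace \<beta> j F holomorphic_on strip \<beta>"
proof -
  have "trace \<beta> j F field_differentiable at w0" if w0: "w0 \<in> strip \<beta>" for w0
  proof -
    define z2 where "z2 = strip_section \<beta> w0"
    define U where "U = {w. (w, z2) \<in> worm \<beta>}"
    have "open U"
      using open_vimage[OF open_worm, of "\<lambda>w. (w, z2)"] by (simp add: U_def vimage_def continuous_intros)
    have "w0 \<in> U" using strip_section_in_worm[OF \<beta> w0] by (simp add: U_def z2_def)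
    have "(\<lambda>w. F (w, z2) * z2 powi (- j)) holomorphic_on U"
      unfolding U_def by (intro holomorphic_intros holomorphic2_on_fst[OF open_worm F(1)])
    moreover have "F (w, z2) * z2 powi (- j) = trace \<beta> j F w" if "w \<in> U" for w
    proof -
      have w: "(w, z2) \<in> worm \<beta>" using that by (simp add: U_def)
      then have "w \<in> strip \<beta>" by (rule worm_imp_strip)
      then show ?thesis
        using equivariant_quotient_const[OF F(1) eq w strip_section_in_worm[OF \<beta>]] by (simp add: trace_def)
    qed
    ultimately have "trace \<beta> j F holomorphic_on U" by (rule holomorphic_transform)
    then show ?thesis using \<open>open U\<close> \<open>w0 \<in> U\<close> by (rule holomorphic_on_imp_differentiable_at)
  qed
  then show ?thesis
    unfolding holomorphic_on_def using field_differentiable_at_within by blast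
qed

lemma slice_le_nsq_worm:
  assumes "l \<in> {1..4}" "(t, s) \<in> worm_params \<beta>"
  shows "nsq_L2 line_circle (slice F l t s) \<le> nsq_worm \<beta> F"
proof -
  have "nsq_L2 line_circle (slice F l t s) \<le> (\<Sum>l=1..4. nsq_L2 line_circle (slice F l t s))"
    using assms(1) by (intro member_le_sum) auto
  also have "\<dots> \<le> nsq_worm \<beta> F"
    unfolding nsq_worm_def using assms(2) by (intro SUP_upper2[of "(t, s)"]) auto
  finally show ?thesis .
qed

lemma nsq_worm_le:
  assumes "\<And>t s. (t, s) \<in> worm_params \<beta> \<Longrightarrow> (\<Sum>l=1..4. nsq_L2 line_circle (slice F l t s)) \<le> B"
  shows "nsq_worm \<beta> F \<le> B"
  unfolding nsq_worm_def using assms by (intro SUP_least) auto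

lemma nsq_line_le_nsq_worm_lift:
  assumes f: "f holomorphic_on strip \<beta>" and y: "\<bar>y - \<sigma>\<bar> < pi / 2" "\<bar>\<sigma>\<bar> < \<beta> - pi / 2"
  shows "nsq_L2 lborel (\<lambda>x. f (Complex x y)) \<le> ennreal (exp (- (of_int j * \<sigma>))) * nsq_worm \<beta> (lift \<beta> j f)"
proof -
  obtain l t s where l: "l \<in> {1..4}" "(t, s) \<in> worm_params \<beta>" "slice_height l t s = y" "slice_level l s = \<sigma>"
    using level_height_on_slice[OF y] by metis
  have "ennreal (exp (- (of_int j * \<sigma>))) * (ennreal (exp (of_int j * \<sigma>)) * nsq_L2 lborel (\<lambda>x. f (Complex x y)))
      \<le> ennreal (exp (- (of_int j * \<sigma>))) * nsq_worm \<beta> (lift \<beta> j f)"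
    using slice_le_nsq_worm[OF l(1,2), of "lift \<beta> j f"] nsq_slice_lift[OF l(2) f, of j l] l(3,4)
    by (intro mult_left_mono) auto
  also have "ennreal (exp (- (of_int j * \<sigma>))) * (ennreal (exp (of_int j * \<sigma>)) * nsq_L2 lborel (\<lambda>x. f (Complex x y)))
      = nsq_L2 lborel (\<lambda>x. f (Complex x y))"
    by (simp add: mult.assoc[symmetric] ennreal_mult[symmetric] exp_add[symmetric])
  finally show ?thesis .
qed

lemma lift_equivariant:
  "(z1, z2) \<in> worm \<beta> \<Longrightarrow> lift \<beta> j f (z1, cis \<theta> * z2) = cis (of_int j * \<theta>) * lift \<beta> j f (z1, z2)"
proof -
  assume "(z1, z2) \<in> worm \<beta>"
  moreover have "cis \<theta> powi j = cis (of_int j * \<theta>)"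
    using circle_point_powi[of 0 \<theta> j] by simp
  ultimately show ?thesis by (simp add: lift_def worm_rotate power_int_mult_distrib)
qed

lemma lift_in_H2_worm_comp:
  assumes f: "f \<in> H2_strip \<beta>"
  shows "lift \<beta> j f \<in> H2_worm_comp \<beta> j"
proof -
  have hol: "f holomorphic_on strip \<beta>" using f by (rule H2_strip_holomorphic)
  obtain N where N: "0 \<le> N" "\<And>y. nsq_L2 lborel (\<lambda>x. f (Complex x y)) \<le> ennreal N"
    using H2_strip_bound[OF f] by metis
  define C where "C = exp (\<bar>of_int j\<bar> * (\<beta> - pi / 2)) * N"
  have "nsq_worm \<beta> (lift \<beta> j f) \<le> (\<Sum>l=1..(4::nat). ennreal C)"
  proof (intro nsq_worm_le sum_mono)
    fix t s and l :: nat assume ts: "(t, s) \<in> worm_params \<beta>"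
    have "of_int j * slice_level l s \<le> \<bar>of_int j * slice_level l s\<bar>" by simp
    also have "\<dots> \<le> \<bar>of_int j\<bar> * (\<beta> - pi / 2)"
      unfolding abs_mult using ts
      by (intro mult_left_mono) (auto simp: worm_params_def slice_level_def)
    finally have "ennreal (exp (of_int j * slice_level l s)) * nsq_L2 lborel (\<lambda>x. f (Complex x (slice_height l t s)))
       \<le> ennreal (exp (\<bar>of_int j\<bar> * (\<beta> - pi / 2))) * ennreal N"
      by (intro mult_mono N ennreal_leI) auto
    then show "nsq_L2 line_circle (slice (lift \<beta> j f) l t s) \<le> ennreal C"
      using N(1) by (simp add: nsq_slice_lift[OF ts hol] C_def ennreal_mult)
  qed
  also have "\<dots> < \<infinity>" by (simp add: ennreal_mult_less_top)
  finally have "nsq_worm \<beta> (lift \<beta> j f) < \<infinity>" .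
  then show ?thesis
    unfolding H2_worm_comp_def H2_worm_def
    using holomorphic2_on_lift[OF hol] lift_equivariant[of _ _ \<beta> j f] by (auto simp: lift_def[of \<beta> j f])
qed

lemma H2_worm_compD:
  assumes "F \<in> H2_worm_comp \<beta> j"
  shows "holomorphic2_on F (worm \<beta>)" "\<And>z. z \<notin> worm \<beta> \<Longrightarrow> F z = 0" "nsq_worm \<beta> F < \<infinity>"
    "\<And>z1 z2 \<theta>. (z1, z2) \<in> worm \<beta> \<Longrightarrow> F (z1, cis \<theta> * z2) = cis (of_int j * \<theta>) * F (z1, z2)"
  using assms by (auto simp: H2_worm_comp_def H2_worm_def)

lemma lift_trace_comp:
  assumes "\<beta> > pi / 2" "F \<in> H2_worm_comp \<beta> j"
  shows "lift \<beta> j (trace \<beta> j F) = F"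
  using lift_trace[OF assms(1) H2_worm_compD(1,2,4)[OF assms(2)]] .

text \<open>Each line of the strip is a line of some slice, so the line norms are bounded by the worm norm up
  to the factor \<open>\<bar>z2\<bar> ^ (- 2 j)\<close>, which is bounded on the domain.\<close>

lemma trace_in_H2_strip:
  assumes \<beta>: "\<beta> > pi / 2" and F: "F \<in> H2_worm_comp \<beta> j"
  shows "trace \<beta> j F \<in> H2_strip \<beta>"
proof -
  define f where "f = trace \<beta> j F"
  have hol: "f holomorphic_on strip \<beta>"
    unfolding f_def using trace_holomorphic[OF \<beta> H2_worm_compD(1,2,4)[OF F]] .
  have lift: "lift \<beta> j f = F" unfolding f_def by (rule lift_trace_comp[OF \<beta> F])
  have \<beta>0: "\<beta> > 0" using \<beta> pi_gt_zero by linarith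
  define B where "B = ennreal (exp (\<bar>of_int j\<bar> * (\<beta> - pi / 2))) * nsq_worm \<beta> F"
  have le: "nsq_L2 lborel (\<lambda>x. f (Complex x y)) \<le> B" if "\<bar>y\<bar> < \<beta>" for y
  proof -
    define \<sigma> where "\<sigma> = y * (\<beta> - pi / 2) / \<beta>"
    have "(Complex 0 y, of_real (exp (\<sigma> / 2)) * cis 0) \<in> worm \<beta>"
      using strip_section_in_worm[OF \<beta>, of "Complex 0 y"] that
      by (simp add: strip_def strip_section_def \<sigma>_def)
    then have \<sigma>: "\<bar>y - \<sigma>\<bar> < pi / 2" "\<bar>\<sigma>\<bar> < \<beta> - pi / 2" by (simp_all only: mem_worm_circle complex.sel)
    have "- (of_int j * \<sigma>) \<le> \<bar>of_int j * \<sigma>\<bar>" by simp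
    also have "\<dots> \<le> \<bar>of_int j\<bar> * (\<beta> - pi / 2)"
      unfolding abs_mult using \<sigma> by (intro mult_left_mono) auto
    finally have "ennreal (exp (- (of_int j * \<sigma>))) * nsq_worm \<beta> F \<le> B"
      unfolding B_def by (intro mult_right_mono ennreal_leI) auto
    then show ?thesis
      using nsq_line_le_nsq_worm_lift[OF hol \<sigma>, of j] unfolding lift by (rule order_trans[rotated])
  qed
  have "(SUP y\<in>{0..<\<beta>}. nsq_L2 lborel (\<lambda>x. f (Complex x y)) + nsq_L2 lborel (\<lambda>x. f (Complex x (- y)))) \<le> B + B"
    by (intro SUP_least add_mono le) auto
  also have "\<dots> < \<infinity>"
    using H2_worm_compD(3)[OF F] by (simp add: B_def ennreal_mult_less_top)
  finally show ?thesis
    unfolding H2_strip_def f_def[symmetric] using hol by (auto simp: f_def trace_def)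
qed

text \<open>Up to the factor \<open>2 / pi\<close>, this is the density against which the squared transform is integrated
  in the slice norms; at \<open>t = pi / 2\<close> and \<open>s = \<beta> - pi / 2\<close> it is the weight of the norm on the strip.\<close>

definition worm_weight :: "int \<Rightarrow> real \<Rightarrow> real \<Rightarrow> real \<Rightarrow> real" where
  "worm_weight j t s \<xi> = cosh (2 * t * \<xi>) * cosh (2 * s * (\<xi> - of_int j / 2))"

lemma worm_weight_pos: "0 < worm_weight j t s \<xi>"
  unfolding worm_weight_def by (intro mult_pos_pos cosh_real_pos)

lemma worm_weight_mono:
  assumes "0 \<le> t" "t \<le> t'" "0 \<le> s" "s \<le> s'"
  shows "worm_weight j t s \<xi> \<le> worm_weight j t' s' \<xi>"
proof -
  have *: "cosh (a * b) \<le> cosh (a' * b)" if "0 \<le> a" "a \<le> a'" for a a' b :: real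
  proof -
    have "\<bar>a * b\<bar> \<le> \<bar>a' * b\<bar>" unfolding abs_mult using that by (intro mult_right_mono) auto
    then show ?thesis by (metis abs_ge_zero cosh_real_abs cosh_real_nonneg_le_iff)
  qed
  show ?thesis
    unfolding worm_weight_def using assms by (intro mult_mono * cosh_real_nonneg) auto
qed

lemma worm_weight_exp:
  "exp (of_int j * s - 2 * (s + t) * \<xi>) + exp (of_int j * s - 2 * (s - t) * \<xi>)
    + exp (- (of_int j * s) + 2 * (s + t) * \<xi>) + exp (- (of_int j * s) + 2 * (s - t) * \<xi>) = 4 * worm_weight j t s \<xi>"
proof -
  define A B where "A = 2 * t * \<xi>" and "B = 2 * s * (\<xi> - of_int j / 2)"
  have "4 * (cosh A * cosh B) = exp (- B - A) + exp (- B + A) + exp (B + A) + exp (B - A)"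
    by (simp add: cosh_field_def exp_add exp_diff exp_minus field_simps)
  moreover have "of_int j * s - 2 * (s + t) * \<xi> = - B - A" "of_int j * s - 2 * (s - t) * \<xi> = - B + A"
    "- (of_int j * s) + 2 * (s + t) * \<xi> = B + A" "- (of_int j * s) + 2 * (s - t) * \<xi> = B - A"
    by (simp_all add: A_def B_def algebra_simps)
  ultimately show ?thesis by (simp add: worm_weight_def A_def B_def)
qed

text \<open>Plancherel turns each slice into an exponential weight, and the four exponentials add up to a
  product of hyperbolic cosines.\<close>

lemma slice_sum_lift:
  assumes f: "f \<in> H2_strip \<beta>" and ts: "(t, s) \<in> worm_params \<beta>"
  shows "(\<Sum>l=1..4. nsq_L2 line_circle (slice (lift \<beta> j f) l t s))
    = ennreal (2 / pi) * (\<integral>\<^sup>+\<xi>. ennreal ((cmod (fourier_L2 (\<lambda>x. f (Complex x 0)) \<xi>))\<^sup>2 * worm_weight j t s \<xi>) \<partial>lborel)"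
proof -
  define g where "g = fourier_L2 (\<lambda>x. f (Complex x 0))"
  have "\<bar>0\<bar> < \<beta>" using slice_height_bound[OF ts, of 1] by auto
  then have [measurable]: "g \<in> borel_measurable borel"
    using H2_strip_fourier[OF f, of 0] by (simp add: g_def is_fourier_L2_def in_L2_def)
  have one: "ennreal (2 * pi) * nsq_L2 line_circle (slice (lift \<beta> j f) l t s)
      = (\<integral>\<^sup>+\<xi>. ennreal (exp (of_int j * slice_level l s - 2 * slice_height l t s * \<xi>) * (cmod (g \<xi>))\<^sup>2) \<partial>lborel)" for l
  proof -
    have "ennreal (2 * pi) * nsq_L2 line_circle (slice (lift \<beta> j f) l t s)
      = ennreal (exp (of_int j * slice_level l s)) * (ennreal (2 * pi) * nsq_L2 lborel (\<lambda>x. f (Complex x (slice_height l t s))))"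
      by (simp add: nsq_slice_lift[OF ts H2_strip_holomorphic[OF f]] mult_ac)
    also have "\<dots> = ennreal (exp (of_int j * slice_level l s)) * nsq_L2 lborel (\<lambda>\<xi>. of_real (exp (- (slice_height l t s * \<xi>))) * g \<xi>)"
      unfolding g_def by (simp only: H2_strip_Plancherel[OF f slice_height_bound[OF ts]])
    also have "\<dots> = (\<integral>\<^sup>+\<xi>. ennreal (exp (of_int j * slice_level l s)) * ennreal ((cmod (of_real (exp (- (slice_height l t s * \<xi>))) * g \<xi>))\<^sup>2) \<partial>lborel)"
      unfolding nsq_L2_def by (intro nn_integral_cmult[symmetric]) measurable
    also have "\<dots> = (\<integral>\<^sup>+\<xi>. ennreal (exp (of_int j * slice_level l s - 2 * slice_height l t s * \<xi>) * (cmod (g \<xi>))\<^sup>2) \<partial>lborel)"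
    proof (intro nn_integral_cong)
      fix \<xi>
      have "exp (of_int j * slice_level l s) * (exp (- (slice_height l t s * \<xi>)))\<^sup>2 = exp (of_int j * slice_level l s - 2 * slice_height l t s * \<xi>)"
        by (simp add: exp_double[symmetric] exp_add[symmetric])
      then show "ennreal (exp (of_int j * slice_level l s)) * ennreal ((cmod (of_real (exp (- (slice_height l t s * \<xi>))) * g \<xi>))\<^sup>2)
        = ennreal (exp (of_int j * slice_level l s - 2 * slice_height l t s * \<xi>) * (cmod (g \<xi>))\<^sup>2)"
        by (simp add: ennreal_mult[symmetric] norm_mult power_mult_distrib mult.assoc[symmetric])
    qed
    finally show ?thesis .
  qed
  have four: "(\<Sum>l=1..(4::nat). h l) = h 1 + h 2 + h 3 + h 4" for h :: "nat \<Rightarrow> 'z::comm_monoid_add"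
    by (simp add: numeral_eq_Suc add_ac)
  have "ennreal (2 * pi) * (\<Sum>l=1..4. nsq_L2 line_circle (slice (lift \<beta> j f) l t s))
      = (\<Sum>l=1..4. \<integral>\<^sup>+\<xi>. ennreal (exp (of_int j * slice_level l s - 2 * slice_height l t s * \<xi>) * (cmod (g \<xi>))\<^sup>2) \<partial>lborel)"
    by (simp only: sum_distrib_left one)
  also have "\<dots> = (\<integral>\<^sup>+\<xi>. (\<Sum>l=1..4. ennreal (exp (of_int j * slice_level l s - 2 * slice_height l t s * \<xi>) * (cmod (g \<xi>))\<^sup>2)) \<partial>lborel)"
    by (intro nn_integral_sum[symmetric]) measurable
  also have "\<dots> = (\<integral>\<^sup>+\<xi>. ennreal 4 * ennreal ((cmod (g \<xi>))\<^sup>2 * worm_weight j t s \<xi>) \<partial>lborel)"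
  proof (intro nn_integral_cong)
    fix \<xi>
    have "(\<Sum>l=1..4. ennreal (exp (of_int j * slice_level l s - 2 * slice_height l t s * \<xi>) * (cmod (g \<xi>))\<^sup>2))
        = ennreal (\<Sum>l=1..4. exp (of_int j * slice_level l s - 2 * slice_height l t s * \<xi>) * (cmod (g \<xi>))\<^sup>2)"
      by (intro sum_ennreal) auto
    also have "(\<Sum>l=1..4. exp (of_int j * slice_level l s - 2 * slice_height l t s * \<xi>) * (cmod (g \<xi>))\<^sup>2)
        = (4 * worm_weight j t s \<xi>) * (cmod (g \<xi>))\<^sup>2"
      unfolding four worm_weight_exp[symmetric] distrib_right
      by (simp add: slice_level_def slice_height_def algebra_simps)
    finally show "(\<Sum>l=1..4. ennreal (exp (of_int j * slice_level l s - 2 * slice_height l t s * \<xi>) * (cmod (g \<xi>))\<^sup>2))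
        = ennreal 4 * ennreal ((cmod (g \<xi>))\<^sup>2 * worm_weight j t s \<xi>)"
      using worm_weight_pos[of j t s \<xi>] by (subst ennreal_mult[symmetric]) (auto simp: mult_ac less_imp_le)
  qed
  also have "\<dots> = ennreal 4 * (\<integral>\<^sup>+\<xi>. ennreal ((cmod (g \<xi>))\<^sup>2 * worm_weight j t s \<xi>) \<partial>lborel)"
    unfolding worm_weight_def cosh_field_def by (intro nn_integral_cmult) measurable
  finally have *: "ennreal (2 * pi) * (\<Sum>l=1..4. nsq_L2 line_circle (slice (lift \<beta> j f) l t s))
      = ennreal 4 * (\<integral>\<^sup>+\<xi>. ennreal ((cmod (g \<xi>))\<^sup>2 * worm_weight j t s \<xi>) \<partial>lborel)" .
  have "(\<Sum>l=1..4. nsq_L2 line_circle (slice (lift \<beta> j f) l t s))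
      = ennreal (1 / (2 * pi)) * (ennreal (2 * pi) * (\<Sum>l=1..4. nsq_L2 line_circle (slice (lift \<beta> j f) l t s)))"
    by (subst mult.assoc[symmetric], subst ennreal_mult[symmetric]) auto
  also have "\<dots> = ennreal (2 / pi) * (\<integral>\<^sup>+\<xi>. ennreal ((cmod (g \<xi>))\<^sup>2 * worm_weight j t s \<xi>) \<partial>lborel)"
    unfolding * by (subst mult.assoc[symmetric], subst ennreal_mult[symmetric]) auto
  finally show ?thesis by (simp add: g_def)
qed

text \<open>A sequence of parameters that increases to the corner. It is independent of the degree, so that
  limits along it commute with finite sums over the degrees.\<close>

definition param_seq :: "real \<Rightarrow> nat \<Rightarrow> real \<times> real" where
  "param_seq \<beta> n = (pi / 2 * (1 - 1 / real (Suc n)), (\<beta> - pi / 2) * (1 - 1 / real (Suc n)))"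

lemma param_seq_in: "\<beta> > pi / 2 \<Longrightarrow> param_seq \<beta> n \<in> worm_params \<beta>"
  by (simp add: param_seq_def worm_params_def)

lemma nsq_strip_weighted_eq:
  "nsq_strip_weighted \<beta> j f = ennreal (2 / pi) *
     (\<integral>\<^sup>+\<xi>. ennreal ((cmod (fourier_L2 (\<lambda>x. f (Complex x 0)) \<xi>))\<^sup>2 * worm_weight j (pi / 2) (\<beta> - pi / 2) \<xi>) \<partial>lborel)"
proof -
  have "2 * (\<beta> - pi / 2) = 2 * \<beta> - pi" by simp
  then show ?thesis
    unfolding nsq_strip_weighted_def worm_weight_def complex_of_real_def by (simp only: mult.assoc) simp
qed

text \<open>The weight increases in both parameters, so the supremum over the slices is the limit at the
  corner, computed by monotone convergence.\<close>

lemma nsq_worm_lift: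
  assumes \<beta>: "\<beta> > pi / 2" and f: "f \<in> H2_strip \<beta>"
  shows "nsq_worm \<beta> (lift \<beta> j f) = nsq_strip_weighted \<beta> j f"
    and "(\<lambda>n. \<Sum>l=1..4. nsq_L2 line_circle (slice (lift \<beta> j f) l (fst (param_seq \<beta> n)) (snd (param_seq \<beta> n))))
      \<longlonglongrightarrow> nsq_worm \<beta> (lift \<beta> j f)" (is "?E \<longlonglongrightarrow> _")
proof -
  define g where "g = fourier_L2 (\<lambda>x. f (Complex x 0))"
  have "0 < \<beta>" using \<beta> pi_gt_zero by linarith
  then have [measurable]: "g \<in> borel_measurable borel"
    using H2_strip_fourier[OF f, of 0] by (simp add: g_def is_fourier_L2_def in_L2_def)
  define I where "I t s = ennreal (2 / pi) * (\<integral>\<^sup>+\<xi>. ennreal ((cmod (g \<xi>))\<^sup>2 * worm_weight j t s \<xi>) \<partial>lborel)" for t s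
  define w where "w n = worm_weight j (fst (param_seq \<beta> n)) (snd (param_seq \<beta> n))" for n
  have "(\<lambda>n. \<integral>\<^sup>+\<xi>. ennreal ((cmod (g \<xi>))\<^sup>2 * w n \<xi>) \<partial>lborel)
      \<longlonglongrightarrow> (\<integral>\<^sup>+\<xi>. ennreal ((cmod (g \<xi>))\<^sup>2 * worm_weight j (pi / 2) (\<beta> - pi / 2) \<xi>) \<partial>lborel)"
  proof (rule nn_integral_LIMSEQ)
    show "incseq (\<lambda>n \<xi>. ennreal ((cmod (g \<xi>))\<^sup>2 * w n \<xi>))"
      unfolding w_def using \<beta>
      by (intro incseq_SucI le_funI ennreal_leI mult_left_mono worm_weight_mono)
         (auto simp: param_seq_def intro!: mult_left_mono divide_left_mono)
    show "(\<lambda>\<xi>. ennreal ((cmod (g \<xi>))\<^sup>2 * w n \<xi>)) \<in> borel_measurable lborel" for n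
      unfolding w_def worm_weight_def cosh_field_def by measurable
    fix \<xi>
    have "(\<lambda>n. (cmod (g \<xi>))\<^sup>2 * (cosh (2 * (pi / 2 * (1 - 1 / real (Suc n))) * \<xi>) * cosh (2 * ((\<beta> - pi / 2) * (1 - 1 / real (Suc n))) * (\<xi> - of_int j / 2))))
        \<longlonglongrightarrow> (cmod (g \<xi>))\<^sup>2 * (cosh (2 * (pi / 2 * (1 - 0)) * \<xi>) * cosh (2 * ((\<beta> - pi / 2) * (1 - 0)) * (\<xi> - of_int j / 2)))"
      by (intro tendsto_intros LIMSEQ_Suc[OF lim_1_over_n])
    then show "(\<lambda>n. ennreal ((cmod (g \<xi>))\<^sup>2 * w n \<xi>)) \<longlonglongrightarrow> ennreal ((cmod (g \<xi>))\<^sup>2 * worm_weight j (pi / 2) (\<beta> - pi / 2) \<xi>)"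
      by (intro tendsto_ennrealI) (simp add: w_def worm_weight_def param_seq_def)
  qed
  then have "(\<lambda>n. I (fst (param_seq \<beta> n)) (snd (param_seq \<beta> n))) \<longlonglongrightarrow> I (pi / 2) (\<beta> - pi / 2)"
    unfolding I_def w_def by (intro ennreal_tendsto_cmult) auto
  moreover have E: "?E n = I (fst (param_seq \<beta> n)) (snd (param_seq \<beta> n))" for n
    using slice_sum_lift[OF f, of "fst (param_seq \<beta> n)" "snd (param_seq \<beta> n)" j] param_seq_in[OF \<beta>, of n]
    by (simp add: I_def g_def)
  ultimately have lim: "?E \<longlonglongrightarrow> I (pi / 2) (\<beta> - pi / 2)" by simp
  have "nsq_worm \<beta> (lift \<beta> j f) \<le> I (pi / 2) (\<beta> - pi / 2)"
  proof (rule nsq_worm_le)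
    fix t s assume ts: "(t, s) \<in> worm_params \<beta>"
    have "I t s \<le> I (pi / 2) (\<beta> - pi / 2)"
      unfolding I_def using ts
      by (intro mult_left_mono nn_integral_mono ennreal_leI worm_weight_mono) (auto simp: worm_params_def)
    then show "(\<Sum>l=1..4. nsq_L2 line_circle (slice (lift \<beta> j f) l t s)) \<le> I (pi / 2) (\<beta> - pi / 2)"
      unfolding slice_sum_lift[OF f ts] by (simp add: I_def g_def)
  qed
  moreover have "I (pi / 2) (\<beta> - pi / 2) \<le> nsq_worm \<beta> (lift \<beta> j f)"
  proof (rule tendsto_upperbound[OF lim])
    show "eventually (\<lambda>n. ?E n \<le> nsq_worm \<beta> (lift \<beta> j f)) sequentially"
      unfolding nsq_worm_def using param_seq_in[OF \<beta>]
      by (intro always_eventually allI SUP_upper2) (auto simp: case_prod_beta)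
  qed simp
  ultimately have eq: "nsq_worm \<beta> (lift \<beta> j f) = I (pi / 2) (\<beta> - pi / 2)" by simp
  then show "nsq_worm \<beta> (lift \<beta> j f) = nsq_strip_weighted \<beta> j f"
    by (simp add: nsq_strip_weighted_eq I_def g_def)
  show "?E \<longlonglongrightarrow> nsq_worm \<beta> (lift \<beta> j f)" unfolding eq by (rule lim)
qed

lemma isometric_iso_comp_strip:
  assumes \<beta>: "\<beta> > pi / 2"
  shows "isometric_iso (H2_worm_comp \<beta> j) (nsq_worm \<beta>) (H2_strip \<beta>) (nsq_strip_weighted \<beta> j)"
  unfolding isometric_iso_def
proof (intro exI[of _ "trace \<beta> j"] conjI ballI)
  show "lin_map_on (H2_worm_comp \<beta> j) (trace \<beta> j)"
    by (auto simp: lin_map_on_def trace_def fun_eq_iff algebra_simps)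
  show "bij_betw (trace \<beta> j) (H2_worm_comp \<beta> j) (H2_strip \<beta>)"
  proof (rule bij_betw_byWitness[of _ "lift \<beta> j"])
    show "\<forall>f\<in>H2_strip \<beta>. trace \<beta> j (lift \<beta> j f) = f"
      using trace_lift[OF \<beta>] by (auto simp: H2_strip_def)
  qed (use lift_trace_comp[OF \<beta>] trace_in_H2_strip[OF \<beta>] lift_in_H2_worm_comp in auto)
  show "nsq_strip_weighted \<beta> j (trace \<beta> j F) = nsq_worm \<beta> F" if "F \<in> H2_worm_comp \<beta> j" for F
    using nsq_worm_lift(1)[OF \<beta> trace_in_H2_strip[OF \<beta> that], of j] lift_trace_comp[OF \<beta> that] by simp
qed

section \<open>The projections onto the components\<close>

lemma comp_slice_limit:
  assumes "\<beta> > pi / 2" "F \<in> H2_worm_comp \<beta> j"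
  shows "(\<lambda>n. \<Sum>l=1..4. nsq_L2 line_circle (slice F l (fst (param_seq \<beta> n)) (snd (param_seq \<beta> n)))) \<longlonglongrightarrow> nsq_worm \<beta> F"
  using nsq_worm_lift(2)[OF assms(1) trace_in_H2_strip[OF assms], of j] lift_trace_comp[OF assms] by simp

lemma slice_equivariant:
  assumes eq: "\<And>z1 z2 \<theta>. (z1, z2) \<in> worm \<beta> \<Longrightarrow> F (z1, cis \<theta> * z2) = cis (of_int j * \<theta>) * F (z1, z2)"
    and ts: "(t, s) \<in> worm_params \<beta>"
  shows "slice F l t s (x, \<theta>) = slice F l t s (x, 0) * cis (2 * pi * of_int j * \<theta>)"
proof -
  have "(Complex x (slice_height l t s), of_real (exp (slice_level l s / 2)) * cis 0) \<in> worm \<beta>"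
    by (rule slice_in_worm[OF ts])
  from eq[OF this, of "2 * pi * \<theta>"] show ?thesis
    by (simp add: slice_eq mult_ac)
qed

lemma measurable_slice_0:
  assumes F: "holomorphic2_on F (worm \<beta>)" and ts: "(t, s) \<in> worm_params \<beta>"
  shows "(\<lambda>x. slice F l t s (x, 0)) \<in> borel_measurable borel"
  by (intro borel_measurable_continuous_onI continuous_on_compose2[OF continuous_on_slice[OF F ts]] continuous_intros) auto

lemma nsq_slice_equivariant:
  assumes F: "holomorphic2_on F (worm \<beta>)"
    and eq: "\<And>z1 z2 \<theta>. (z1, z2) \<in> worm \<beta> \<Longrightarrow> F (z1, cis \<theta> * z2) = cis (of_int j * \<theta>) * F (z1, z2)"
    and ts: "(t, s) \<in> worm_params \<beta>"
  shows "nsq_L2 line_circle (slice F l t s) = nsq_L2 lborel (\<lambda>x. slice F l t s (x, 0))"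
proof -
  have "slice F l t s = (\<lambda>(x, \<theta>). slice F l t s (x, 0) * cis (2 * pi * of_int j * \<theta>))"
    by (intro ext, unfold split_paired_all prod.case) (rule slice_equivariant[OF eq ts])
  then have "nsq_L2 line_circle (slice F l t s) = nsq_L2 line_circle (\<lambda>(x, \<theta>). slice F l t s (x, 0) * cis (2 * pi * of_int j * \<theta>))"
    by (rule arg_cong)
  also have "\<dots> = nsq_L2 lborel (\<lambda>x. slice F l t s (x, 0))"
    by (intro nsq_line_circle_character measurable_slice_0[OF F ts])
  finally show ?thesis .
qed

lemma integral_periodic_shift:
  fixes k :: "real \<Rightarrow> complex"
  assumes k: "continuous_on UNIV k" and per: "\<And>\<theta>. k (\<theta> + 1) = k \<theta>"
  shows "integral {0..1} (\<lambda>\<theta>. k (\<theta> + a)) = integral {0..1} k"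
proof -
  have int: "k integrable_on {x..y}" for x y
    by (intro integrable_continuous_interval continuous_on_subset[OF k]) auto
  have per_int: "k (\<theta> + of_int n) = k \<theta>" for \<theta> and n :: int
  proof (induction n arbitrary: \<theta> rule: int_induct[where k = 0])
    case (step1 i)
    then show ?case using per[of "\<theta> + of_int i"] by (simp add: add_ac)
  next
    case (step2 i)
    then show ?case using per[of "\<theta> + of_int (i - 1)"] by (simp add: algebra_simps)
  qed simp
  define b where "b = frac a"
  have b: "0 \<le> b" "b \<le> 1" using frac_lt_1[of a] by (auto simp: b_def less_imp_le)
  have "k (\<theta> + a) = k (\<theta> + b)" for \<theta>
    using per_int[of "\<theta> + b" "\<lfloor>a\<rfloor>"] by (simp add: b_def frac_def)
  then have "integral {0..1} (\<lambda>\<theta>. k (\<theta> + a)) = integral {b - b..(1 + b) - b} (\<lambda>\<theta>. k (\<theta> + b))" by simp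
  also have "\<dots> = integral {b..1 + b} k" by (rule integral_shift_real_ivl)
  also have "\<dots> = integral {b..1} k + integral {1..1 + b} k"
    using b int by (intro Henstock_Kurzweil_Integration.integral_combine[symmetric]) auto
  also have "integral {1..1 + b} k = integral {1 - 1..(1 + b) - 1} (\<lambda>\<theta>. k (\<theta> + 1))"
    by (rule integral_shift_real_ivl[symmetric])
  also have "\<dots> = integral {0..b} k" by (simp add: per)
  also have "integral {b..1} k + integral {0..b} k = integral {0..1} k"
    using b int Henstock_Kurzweil_Integration.integral_combine[of 0 b 1 k] by (simp add: add.commute)
  finally show ?thesis .
qed

definition proj :: "real \<Rightarrow> int \<Rightarrow> (complex \<times> complex \<Rightarrow> complex) \<Rightarrow> complex \<times> complex \<Rightarrow> complex" where
  "proj \<beta> j F z = (if z \<in> worm \<beta> then fourier_coeff (\<lambda>\<theta>. F (fst z, cis (2 * pi * \<theta>) * snd z)) j else 0)"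

lemma continuous_on_rotation:
  assumes "holomorphic2_on F (worm \<beta>)"
  shows "continuous_on (worm \<beta> \<times> T) (\<lambda>(z, \<theta>). F (fst z, cis (2 * pi * \<theta>) * snd z) * cis (c * \<theta>))"
proof -
  have "continuous_on (worm \<beta> \<times> T) (\<lambda>p. F (fst (fst p), cis (2 * pi * snd p) * snd (fst p)) * cis (c * snd p))"
    by (intro continuous_intros continuous_on_compose2[OF holomorphic2_on_imp_continuous_on[OF assms]])
       (auto simp: worm_rotate)
  then show ?thesis by (simp add: split_beta)
qed

lemma continuous_on_rotation_circle:
  assumes "holomorphic2_on F (worm \<beta>)" "(z1, z2) \<in> worm \<beta>"
  shows "continuous_on A (\<lambda>\<theta>. F (z1, cis (2 * pi * \<theta>) * z2))"
  by (intro continuous_intros continuous_on_compose2[OF holomorphic2_on_imp_continuous_on[OF assms(1)]])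
     (auto simp: worm_rotate assms(2))

lemma holomorphic2_on_proj:
  assumes F: "holomorphic2_on F (worm \<beta>)"
  shows "holomorphic2_on (proj \<beta> j F) (worm \<beta>)"
proof (rule holomorphic2_onI[OF open_worm])
  define h where "h z \<theta> = F (fst z, cis (2 * pi * \<theta>) * snd z) * cis (- (2 * pi * of_int j) * \<theta>)" for z \<theta>
  have proj: "proj \<beta> j F z = integral {0..1} (h z)" if "z \<in> worm \<beta>" for z
    using that by (simp add: proj_def fourier_coeff_def h_def[abs_def])
  have h: "continuous_on (worm \<beta> \<times> {0..1}) (\<lambda>(z, \<theta>). h z \<theta>)"
    unfolding h_def by (rule continuous_on_rotation[OF F])
  have "continuous_on (worm \<beta>) (\<lambda>z. integral (cbox 0 1) (h z))"
    by (rule integral_continuous_on_param) (use h in simp)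
  then show "continuous_on (worm \<beta>) (proj \<beta> j F)"
    by (simp add: proj cong: continuous_on_cong)
  show "(\<lambda>z1. proj \<beta> j F (z1, z2)) holomorphic_on {z1. (z1, z2) \<in> worm \<beta>}" for z2
  proof (rule holomorphic_transform)
    show "(\<lambda>z1. integral {0..1} (h (z1, z2))) holomorphic_on {z1. (z1, z2) \<in> worm \<beta>}"
    proof (rule holomorphic_on_integral_param)
      show "open {z1. (z1, z2) \<in> worm \<beta>}"
        using open_vimage[OF open_worm, of "\<lambda>z1. (z1, z2)"] by (simp add: vimage_def continuous_intros)
      have "continuous_on ({z1. (z1, z2) \<in> worm \<beta>} \<times> {0..1}) ((\<lambda>(z, \<theta>). h z \<theta>) \<circ> (\<lambda>p. ((fst p, z2), snd p)))"
        by (intro continuous_on_compose continuous_intros continuous_on_subset[OF h]) auto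
      then show "continuous_on ({z1. (z1, z2) \<in> worm \<beta>} \<times> {0..1}) (\<lambda>(z1, \<theta>). h (z1, z2) \<theta>)"
        by (simp add: o_def split_beta)
      fix \<theta> :: real
      have "(\<lambda>z1. F (z1, cis (2 * pi * \<theta>) * z2)) holomorphic_on {z1. (z1, z2) \<in> worm \<beta>}"
        using holomorphic2_on_fst[OF open_worm F, of "cis (2 * pi * \<theta>) * z2"] by (simp add: worm_rotate)
      then show "(\<lambda>z1. h (z1, z2) \<theta>) holomorphic_on {z1. (z1, z2) \<in> worm \<beta>}"
        unfolding h_def by (auto intro!: holomorphic_intros)
    qed
  qed (simp add: proj)
  show "(\<lambda>z2. proj \<beta> j F (z1, z2)) holomorphic_on {z2. (z1, z2) \<in> worm \<beta>}" for z1
  proof (rule holomorphic_transform)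
    show "(\<lambda>z2. integral {0..1} (h (z1, z2))) holomorphic_on {z2. (z1, z2) \<in> worm \<beta>}"
    proof (rule holomorphic_on_integral_param)
      show "open {z2. (z1, z2) \<in> worm \<beta>}"
        using open_vimage[OF open_worm, of "\<lambda>z2. (z1, z2)"] by (simp add: vimage_def continuous_intros)
      have "continuous_on ({z2. (z1, z2) \<in> worm \<beta>} \<times> {0..1}) ((\<lambda>(z, \<theta>). h z \<theta>) \<circ> (\<lambda>p. ((z1, fst p), snd p)))"
        by (intro continuous_on_compose continuous_intros continuous_on_subset[OF h]) auto
      then show "continuous_on ({z2. (z1, z2) \<in> worm \<beta>} \<times> {0..1}) (\<lambda>(z2, \<theta>). h (z1, z2) \<theta>)"
        by (simp add: o_def split_beta)
      fix \<theta> :: real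
      have "(\<lambda>z2. F (z1, cis (2 * pi * \<theta>) * z2)) holomorphic_on {z2. (z1, z2) \<in> worm \<beta>}"
        by (rule holomorphic_on_compose_gen[OF _ holomorphic2_on_snd[OF open_worm F], unfolded o_def])
           (auto simp: worm_rotate intro!: holomorphic_intros)
      then show "(\<lambda>z2. h (z1, z2) \<theta>) holomorphic_on {z2. (z1, z2) \<in> worm \<beta>}"
        unfolding h_def by (auto intro!: holomorphic_intros)
    qed
  qed (simp add: proj)
qed

lemma proj_equivariant:
  assumes F: "holomorphic2_on F (worm \<beta>)" and z: "(z1, z2) \<in> worm \<beta>"
  shows "proj \<beta> j F (z1, cis \<phi> * z2) = cis (of_int j * \<phi>) * proj \<beta> j F (z1, z2)"
proof -
  define k where "k \<theta> = F (z1, cis (2 * pi * \<theta>) * z2) * cis (- (2 * pi * of_int j * \<theta>))" for \<theta>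
  define a where "a = \<phi> / (2 * pi)"
  have \<phi>: "\<phi> = 2 * pi * a" by (simp add: a_def)
  have "proj \<beta> j F (z1, cis \<phi> * z2)
      = integral {0..1} (\<lambda>\<theta>. F (z1, cis (2 * pi * \<theta>) * (cis \<phi> * z2)) * cis (- (2 * pi * of_int j * \<theta>)))"
    using z by (simp add: proj_def fourier_coeff_def worm_rotate)
  also have "\<dots> = integral {0..1} (\<lambda>\<theta>. cis (of_int j * \<phi>) * k (\<theta> + a))"
  proof (intro Henstock_Kurzweil_Integration.integral_cong)
    fix \<theta> :: real
    have "2 * pi * \<theta> + \<phi> = 2 * pi * (\<theta> + a)" by (simp add: \<phi> distrib_left)
    then have "cis (2 * pi * \<theta>) * (cis \<phi> * z2) = cis (2 * pi * (\<theta> + a)) * z2"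
      by (simp only: mult.assoc[symmetric] cis_mult)
    moreover have "- (2 * pi * of_int j * \<theta>) = of_int j * \<phi> + - (2 * pi * of_int j * (\<theta> + a))"
      by (simp add: \<phi> algebra_simps)
    then have "cis (- (2 * pi * of_int j * \<theta>)) = cis (of_int j * \<phi>) * cis (- (2 * pi * of_int j * (\<theta> + a)))"
      by (simp only: cis_mult)
    ultimately show "F (z1, cis (2 * pi * \<theta>) * (cis \<phi> * z2)) * cis (- (2 * pi * of_int j * \<theta>)) = cis (of_int j * \<phi>) * k (\<theta> + a)"
      by (simp only: k_def mult.left_commute)
  qed
  also have "\<dots> = cis (of_int j * \<phi>) * integral {0..1} (\<lambda>\<theta>. k (\<theta> + a))" by simp
  also have "integral {0..1} (\<lambda>\<theta>. k (\<theta> + a)) = integral {0..1} k"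
  proof (rule integral_periodic_shift)
    show "continuous_on UNIV k"
      unfolding k_def by (intro continuous_intros continuous_on_rotation_circle[OF F z])
    fix \<theta>
    have "cis (2 * pi * (\<theta> + 1)) = cis (2 * pi * \<theta>)"
      by (simp add: distrib_left cis_mult[symmetric])
    moreover have "cis (- (2 * pi * of_int j * (\<theta> + 1))) = cis (- (2 * pi * of_int j * \<theta>))"
    proof -
      have "cis (- (2 * pi * of_int j * (\<theta> + 1))) = cis (- (2 * pi * of_int j * \<theta>)) * cis (2 * pi * of_int (- j))"
        by (simp add: cis_mult algebra_simps)
      also have "cis (2 * pi * of_int (- j)) = 1" by (rule cis_multiple_2pi) (rule Ints_of_int)
      finally show ?thesis by simp
    qed
    ultimately show "k (\<theta> + 1) = k \<theta>" by (simp only: k_def)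
  qed
  also have "integral {0..1} k = proj \<beta> j F (z1, z2)"
    using z by (simp add: proj_def fourier_coeff_def k_def[abs_def])
  finally show ?thesis .
qed

lemma slice_proj_0:
  assumes "(t, s) \<in> worm_params \<beta>"
  shows "slice (proj \<beta> j F) l t s (x, 0) = fourier_coeff (\<lambda>\<theta>. slice F l t s (x, \<theta>)) j"
  using slice_in_worm[OF assms, of x l 0] by (simp add: slice_eq proj_def mult.commute)

lemma Bessel_slice:
  assumes F: "holomorphic2_on F (worm \<beta>)" and ts: "(t, s) \<in> worm_params \<beta>" and "finite A"
  shows "(\<Sum>j\<in>A. nsq_L2 lborel (\<lambda>x. slice (proj \<beta> j F) l t s (x, 0))) \<le> nsq_L2 line_circle (slice F l t s)"
proof -
  note meas = measurable_slice_0[OF holomorphic2_on_proj[OF F] ts]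
  have "(\<Sum>j\<in>A. nsq_L2 lborel (\<lambda>x. slice (proj \<beta> j F) l t s (x, 0)))
      = (\<integral>\<^sup>+x. (\<Sum>j\<in>A. ennreal ((cmod (slice (proj \<beta> j F) l t s (x, 0)))\<^sup>2)) \<partial>lborel)"
    unfolding nsq_L2_def
  proof (rule nn_integral_sum[symmetric])
    show "(\<lambda>x. ennreal ((cmod (slice (proj \<beta> j F) l t s (x, 0)))\<^sup>2)) \<in> borel_measurable lborel" for j
      using meas[of j l] by measurable
  qed
  also have "\<dots> \<le> (\<integral>\<^sup>+x. ennreal (integral {0..1} (\<lambda>\<theta>. (cmod (slice F l t s (x, \<theta>)))\<^sup>2)) \<partial>lborel)"
  proof (rule nn_integral_mono)
    fix x
    have "continuous_on {0..1} (\<lambda>\<theta>. slice F l t s (x, \<theta>))"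
      by (intro continuous_on_compose2[OF continuous_on_slice[OF F ts]] continuous_intros) auto
    from Bessel_inequality[OF this \<open>finite A\<close>]
    show "(\<Sum>j\<in>A. ennreal ((cmod (slice (proj \<beta> j F) l t s (x, 0)))\<^sup>2)) \<le> ennreal (integral {0..1} (\<lambda>\<theta>. (cmod (slice F l t s (x, \<theta>)))\<^sup>2))"
      unfolding slice_proj_0[OF ts] by (subst sum_ennreal) (auto intro: ennreal_leI)
  qed
  also have "\<dots> = nsq_L2 line_circle (slice F l t s)"
    by (rule nsq_line_circle_continuous[OF continuous_on_slice[OF F ts], symmetric])
  finally show ?thesis .
qed

lemma nsq_slice_proj:
  assumes F: "holomorphic2_on F (worm \<beta>)" and ts: "(t, s) \<in> worm_params \<beta>"
  shows "nsq_L2 line_circle (slice (proj \<beta> j F) l t s) = nsq_L2 lborel (\<lambda>x. slice (proj \<beta> j F) l t s (x, 0))"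
  using nsq_slice_equivariant[OF holomorphic2_on_proj[OF F] proj_equivariant[OF F] ts] .

lemma sum_slices_le_nsq_worm:
  "(t, s) \<in> worm_params \<beta> \<Longrightarrow> (\<Sum>l=1..4. nsq_L2 line_circle (slice F l t s)) \<le> nsq_worm \<beta> F"
  unfolding nsq_worm_def by (intro SUP_upper2[of "(t, s)"]) auto

lemma Bessel_slices:
  assumes F: "holomorphic2_on F (worm \<beta>)" and ts: "(t, s) \<in> worm_params \<beta>" and "finite A"
  shows "(\<Sum>j\<in>A. \<Sum>l=1..4. nsq_L2 line_circle (slice (proj \<beta> j F) l t s)) \<le> nsq_worm \<beta> F"
proof -
  have "(\<Sum>j\<in>A. \<Sum>l=1..4. nsq_L2 line_circle (slice (proj \<beta> j F) l t s))
      = (\<Sum>l=1..4. \<Sum>j\<in>A. nsq_L2 lborel (\<lambda>x. slice (proj \<beta> j F) l t s (x, 0)))"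
    by (subst sum.swap) (simp add: nsq_slice_proj[OF F ts])
  also have "\<dots> \<le> (\<Sum>l=1..4. nsq_L2 line_circle (slice F l t s))"
    by (intro sum_mono Bessel_slice[OF F ts \<open>finite A\<close>])
  also have "\<dots> \<le> nsq_worm \<beta> F" by (rule sum_slices_le_nsq_worm[OF ts])
  finally show ?thesis .
qed

lemma nsq_worm_proj_le:
  assumes F: "holomorphic2_on F (worm \<beta>)"
  shows "nsq_worm \<beta> (proj \<beta> j F) \<le> nsq_worm \<beta> F"
proof (rule nsq_worm_le)
  fix t s assume "(t, s) \<in> worm_params \<beta>"
  from Bessel_slices[OF F this, of "{j}"]
  show "(\<Sum>l=1..4. nsq_L2 line_circle (slice (proj \<beta> j F) l t s)) \<le> nsq_worm \<beta> F" by simp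
qed

lemma H2_wormD:
  assumes "F \<in> H2_worm \<beta>"
  shows "holomorphic2_on F (worm \<beta>)" "\<And>z. z \<notin> worm \<beta> \<Longrightarrow> F z = 0" "nsq_worm \<beta> F < \<infinity>"
  using assms by (auto simp: H2_worm_def)

lemma proj_in_comp:
  assumes F: "F \<in> H2_worm \<beta>"
  shows "proj \<beta> j F \<in> H2_worm_comp \<beta> j"
proof -
  have "proj \<beta> j F z = 0" if "z \<notin> worm \<beta>" for z
    using that by (simp add: proj_def)
  then show ?thesis
    unfolding H2_worm_comp_def H2_worm_def
    using holomorphic2_on_proj[OF H2_wormD(1)[OF F]] proj_equivariant[OF H2_wormD(1)[OF F]]
      le_less_trans[OF nsq_worm_proj_le[OF H2_wormD(1)[OF F]] H2_wormD(3)[OF F]]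
    by auto
qed

text \<open>The slice norms of an element of a component converge to its norm along one sequence of
  parameters, common to all components, so Bessel's inequality passes from slices to norms.\<close>

lemma Bessel_worm:
  assumes \<beta>: "\<beta> > pi / 2" and F: "F \<in> H2_worm \<beta>" and "finite A"
  shows "(\<Sum>j\<in>A. nsq_worm \<beta> (proj \<beta> j F)) \<le> nsq_worm \<beta> F"
proof (rule tendsto_upperbound)
  show "(\<lambda>n. \<Sum>j\<in>A. \<Sum>l=1..4. nsq_L2 line_circle (slice (proj \<beta> j F) l (fst (param_seq \<beta> n)) (snd (param_seq \<beta> n))))
      \<longlonglongrightarrow> (\<Sum>j\<in>A. nsq_worm \<beta> (proj \<beta> j F))"
    by (intro tendsto_sum comp_slice_limit[OF \<beta> proj_in_comp[OF F]])
  show "eventually (\<lambda>n. (\<Sum>j\<in>A. \<Sum>l=1..4. nsq_L2 line_circle (slice (proj \<beta> j F) l (fst (param_seq \<beta> n)) (snd (param_seq \<beta> n)))) \<le> nsq_worm \<beta> F) sequentially"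
    using param_seq_in[OF \<beta>] by (intro always_eventually allI Bessel_slices H2_wormD(1)[OF F] \<open>finite A\<close>) simp
qed simp

lemma proj_comp:
  assumes F: "F \<in> H2_worm_comp \<beta> k"
  shows "proj \<beta> j F = (if j = k then F else (\<lambda>z. 0))"
proof (rule ext, clarify)
  fix z1 z2
  show "proj \<beta> j F (z1, z2) = (if j = k then F else (\<lambda>z. 0)) (z1, z2)"
  proof (cases "(z1, z2) \<in> worm \<beta>")
    case True
    have "proj \<beta> j F (z1, z2) = integral {0..1} (\<lambda>\<theta>. F (z1, cis (2 * pi * \<theta>) * z2) * cis (- (2 * pi * of_int j * \<theta>)))"
      using True by (simp add: proj_def fourier_coeff_def)
    also have "\<dots> = integral {0..1} (\<lambda>\<theta>. F (z1, z2) * cis (2 * pi * of_int (k - j) * \<theta>))"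
    proof (intro Henstock_Kurzweil_Integration.integral_cong)
      fix \<theta> :: real
      have "cis (of_int k * (2 * pi * \<theta>)) * cis (- (2 * pi * of_int j * \<theta>)) = cis (2 * pi * of_int (k - j) * \<theta>)"
        by (simp add: cis_mult algebra_simps)
      then show "F (z1, cis (2 * pi * \<theta>) * z2) * cis (- (2 * pi * of_int j * \<theta>)) = F (z1, z2) * cis (2 * pi * of_int (k - j) * \<theta>)"
        unfolding H2_worm_compD(4)[OF F True] by (metis mult.assoc mult.commute)
    qed
    also have "\<dots> = F (z1, z2) * (if k - j = 0 then 1 else 0)"
      unfolding Henstock_Kurzweil_Integration.integral_mult_right integral_cis_period ..
    finally show ?thesis by auto
  next
    case False
    then show ?thesis using H2_worm_compD(2)[OF F] by (simp add: proj_def)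
  qed
qed

lemma proj_diff:
  assumes "holomorphic2_on F (worm \<beta>)" "holomorphic2_on G (worm \<beta>)"
  shows "proj \<beta> j (\<lambda>z. F z - G z) z = proj \<beta> j F z - proj \<beta> j G z"
proof (cases "z \<in> worm \<beta>")
  case True
  then have z: "(fst z, snd z) \<in> worm \<beta>" by simp
  have "integral {0..1} (\<lambda>\<theta>. F (fst z, cis (2 * pi * \<theta>) * snd z) * cis (- (2 * pi * of_int j * \<theta>)) - G (fst z, cis (2 * pi * \<theta>) * snd z) * cis (- (2 * pi * of_int j * \<theta>)))
      = integral {0..1} (\<lambda>\<theta>. F (fst z, cis (2 * pi * \<theta>) * snd z) * cis (- (2 * pi * of_int j * \<theta>))) - integral {0..1} (\<lambda>\<theta>. G (fst z, cis (2 * pi * \<theta>) * snd z) * cis (- (2 * pi * of_int j * \<theta>)))"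
    by (intro Henstock_Kurzweil_Integration.integral_diff integrable_continuous_interval continuous_intros
        continuous_on_rotation_circle[OF assms(1) z] continuous_on_rotation_circle[OF assms(2) z])
  then show ?thesis using True by (simp add: proj_def fourier_coeff_def left_diff_distrib)
qed (simp add: proj_def)

lemma proj_eq_0_imp_eq_0:
  assumes F: "F \<in> H2_worm \<beta>" and zero: "\<And>j z. proj \<beta> j F z = 0"
  shows "F z = 0"
proof (cases "z \<in> worm \<beta>")
  case True
  obtain z1 z2 where z: "z = (z1, z2)" by (cases z)
  define \<phi> where "\<phi> w = F (z1, w * z2)" for w
  have "\<phi> (cis (2 * pi * 0)) = 0"
  proof (rule fourier_coeff_eq_0_imp_eq_0)
    have "(z1, w * z2) \<in> worm \<beta>" if "w \<in> sphere 0 1" for w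
      using that True by (auto simp: z worm_def norm_mult)
    then show "continuous_on (sphere 0 1) \<phi>"
      unfolding \<phi>_def
      by (intro continuous_intros continuous_on_compose2[OF holomorphic2_on_imp_continuous_on[OF H2_wormD(1)[OF F]]]) auto
    show "fourier_coeff (\<lambda>\<theta>. \<phi> (cis (2 * pi * \<theta>))) n = 0" for n
      using zero[of n z] True by (simp add: proj_def \<phi>_def z)
  qed
  then show ?thesis by (simp add: \<phi>_def z)
qed (use H2_wormD(2)[OF F] in auto)

section \<open>Square summable families\<close>

text \<open>The norm of an element of degree \<open>j\<close> controls its lines at all admissible levels. Reading the
  bound at a level shifted by \<open>\<delta>\<close> towards the side where \<open>\<bar>z2 ^ j\<bar>\<close> grows gains the factor
  \<open>exp (- \<delta> \<bar>j\<bar>)\<close>, which makes square summable families summable pointwise.\<close>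

lemma comp_point_bound:
  assumes \<beta>: "\<beta> > pi / 2" and F: "F \<in> H2_worm_comp \<beta> j" and N: "nsq_worm \<beta> F \<le> ennreal N" "0 \<le> N"
    and "\<delta> > 0" "z2 \<noteq> 0" and z: "\<bar>Im z1 - ln ((cmod z2)\<^sup>2)\<bar> < pi / 2 - 2 * \<delta>" "\<bar>ln ((cmod z2)\<^sup>2)\<bar> < \<beta> - pi / 2 - \<delta>"
  shows "cmod (F (z1, z2)) \<le> sqrt (N / (pi * \<delta>)) * exp (- (\<delta> / 2) * \<bar>of_int j\<bar>)"
proof -
  define f where "f = trace \<beta> j F"
  have f: "f \<in> H2_strip \<beta>" unfolding f_def by (rule trace_in_H2_strip[OF \<beta> F])
  have lift: "lift \<beta> j f = F" unfolding f_def by (rule lift_trace_comp[OF \<beta> F])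
  define \<sigma> where "\<sigma> = ln ((cmod z2)\<^sup>2)"
  \<comment> \<open>the level at which the norm is read\<close>
  define \<sigma>' where "\<sigma>' = (if j \<ge> 0 then \<sigma> + \<delta> else \<sigma> - \<delta>)"
  have \<sigma>: "\<bar>Im z1 - \<sigma>\<bar> < pi / 2 - 2 * \<delta>" "\<bar>\<sigma>\<bar> < \<beta> - pi / 2 - \<delta>" using z by (simp_all add: \<sigma>_def)
  have gain: "of_int j * \<sigma> - of_int j * \<sigma>' = - \<delta> * \<bar>of_int j\<bar>"
    by (simp add: \<sigma>'_def algebra_simps)
  have line: "nsq_L2 lborel (\<lambda>x. f (Complex x \<eta>)) \<le> ennreal (exp (- (of_int j * \<sigma>')) * N)"
    if "\<eta> \<in> {Im z1 - \<delta>..Im z1 + \<delta>}" for \<eta>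
  proof -
    have "\<bar>\<sigma>' - \<sigma>\<bar> = \<delta>" using \<open>\<delta> > 0\<close> by (simp add: \<sigma>'_def)
    moreover have "\<bar>\<eta> - Im z1\<bar> \<le> \<delta>" using that by auto
    ultimately have "\<bar>\<eta> - \<sigma>'\<bar> < pi / 2" "\<bar>\<sigma>'\<bar> < \<beta> - pi / 2"
      using \<sigma> by linarith+
    from nsq_line_le_nsq_worm_lift[OF H2_strip_holomorphic[OF f] this, of j]
    have "nsq_L2 lborel (\<lambda>x. f (Complex x \<eta>)) \<le> ennreal (exp (- (of_int j * \<sigma>'))) * nsq_worm \<beta> F"
      by (simp only: lift)
    also have "\<dots> \<le> ennreal (exp (- (of_int j * \<sigma>'))) * ennreal N" by (intro mult_left_mono N) auto
    finally show ?thesis using N(2) by (simp add: ennreal_mult)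
  qed
  have "\<bar>Im z1\<bar> + \<delta> < \<beta>" using \<sigma> \<open>\<delta> > 0\<close> by linarith
  then have "(cmod (f (Complex (Re z1) (Im z1))))\<^sup>2 \<le> (exp (- (of_int j * \<sigma>')) * N) / (pi * \<delta>)"
    using N(2) by (intro strip_point_bound[OF H2_strip_holomorphic[OF f] \<open>\<delta> > 0\<close>] line) auto
  then have f_le: "(cmod (f z1))\<^sup>2 \<le> exp (- (of_int j * \<sigma>')) * (N / (pi * \<delta>))" by simp
  have worm: "(z1, z2) \<in> worm \<beta>"
    using z \<open>\<delta> > 0\<close> \<open>z2 \<noteq> 0\<close> by (auto simp: worm_def)
  have "cmod z2 = exp (\<sigma> / 2)" using \<open>z2 \<noteq> 0\<close> by (simp add: \<sigma>_def ln_realpow)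
  then have "cmod (z2 powi j) = exp (of_int j * (\<sigma> / 2))"
    by (simp add: norm_power_int exp_power_int)
  then have "(cmod (z2 powi j))\<^sup>2 = exp (of_int j * \<sigma>)"
    by (simp add: exp_double[symmetric])
  then have "(cmod (F (z1, z2)))\<^sup>2 = (cmod (f z1))\<^sup>2 * exp (of_int j * \<sigma>)"
    using worm by (subst lift[symmetric]) (simp add: lift_def norm_mult power_mult_distrib)
  also have "\<dots> \<le> (exp (- (of_int j * \<sigma>')) * (N / (pi * \<delta>))) * exp (of_int j * \<sigma>)"
    by (intro mult_right_mono f_le) auto
  also have "\<dots> = (N / (pi * \<delta>)) * (exp (of_int j * \<sigma>) * exp (- (of_int j * \<sigma>')))"
    by (simp only: mult_ac)
  also have "exp (of_int j * \<sigma>) * exp (- (of_int j * \<sigma>')) = exp (- \<delta> * \<bar>of_int j\<bar>)"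
    unfolding exp_add[symmetric] gain[symmetric] by simp
  also have "exp (- \<delta> * \<bar>of_int j\<bar>) = (exp (- (\<delta> / 2) * \<bar>of_int j\<bar>))\<^sup>2"
    by (simp add: exp_double[symmetric])
  finally have "cmod (F (z1, z2)) \<le> sqrt ((N / (pi * \<delta>)) * (exp (- (\<delta> / 2) * \<bar>of_int j\<bar>))\<^sup>2)"
    by (rule real_le_rsqrt)
  then show ?thesis by (simp only: real_sqrt_mult real_sqrt_abs abs_exp_cancel)
qed

lemma worm_margin:
  assumes "(z1, z2) \<in> worm \<beta>"
  obtains \<delta> where "\<delta> > 0" "z2 \<noteq> 0" "\<bar>Im z1 - ln ((cmod z2)\<^sup>2)\<bar> < pi / 2 - 2 * \<delta>" "\<bar>ln ((cmod z2)\<^sup>2)\<bar> < \<beta> - pi / 2 - \<delta>"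
proof -
  define a b where "a = \<bar>Im z1 - ln ((cmod z2)\<^sup>2)\<bar>" and "b = \<bar>ln ((cmod z2)\<^sup>2)\<bar>"
  have ab: "a < pi / 2" "b < \<beta> - pi / 2" "z2 \<noteq> 0"
    using assms by (auto simp: worm_def a_def b_def)
  define \<delta> where "\<delta> = min ((pi / 2 - a) / 4) ((\<beta> - pi / 2 - b) / 2)"
  have *: "\<delta> \<le> (pi / 2 - a) / 4" "\<delta> \<le> (\<beta> - pi / 2 - b) / 2"
    unfolding \<delta>_def by (rule min.cobounded1, rule min.cobounded2)
  have "\<delta> > 0" using ab by (simp add: \<delta>_def)
  moreover have "4 * \<delta> \<le> pi / 2 - a" "2 * \<delta> \<le> \<beta> - pi / 2 - b" using * by simp_all
  then have "a < pi / 2 - 2 * \<delta>" "b < \<beta> - pi / 2 - \<delta>" using ab(1,2) \<open>\<delta> > 0\<close> by linarith+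
  ultimately show ?thesis using that ab(3) by (simp add: a_def b_def)
qed

lemma comp_norm_0:
  assumes \<beta>: "\<beta> > pi / 2" and F: "F \<in> H2_worm_comp \<beta> j" and zero: "nsq_worm \<beta> F \<le> 0"
  shows "F z = 0"
proof (cases "z \<in> worm \<beta>")
  case True
  obtain z1 z2 where z: "z = (z1, z2)" by (cases z)
  obtain \<delta> where "\<delta> > 0" "z2 \<noteq> 0" "\<bar>Im z1 - ln ((cmod z2)\<^sup>2)\<bar> < pi / 2 - 2 * \<delta>" "\<bar>ln ((cmod z2)\<^sup>2)\<bar> < \<beta> - pi / 2 - \<delta>"
    using worm_margin[of z1 z2 \<beta>] True z by blast
  from comp_point_bound[OF \<beta> F _ _ this, of 0] show ?thesis using zero by (simp add: z)
qed (rule H2_worm_compD(2)[OF F])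

lemma summable_on_exp_abs_int:
  fixes c :: real
  assumes "c > 0"
  shows "(\<lambda>j::int. exp (- c * \<bar>of_int j\<bar>)) summable_on UNIV"
proof -
  have geo: "summable (\<lambda>n. exp (- c) ^ n)" using assms by (intro summable_geometric) auto
  have e: "exp (- c * real n) = exp (- c) ^ n" for n
    by (simp add: exp_of_nat_mult[symmetric] mult.commute)
  have "summable (\<lambda>n. exp (- c * \<bar>of_int (int n)\<bar>))"
    using geo by (simp only: of_int_of_nat_eq abs_of_nat e)
  then have "(\<lambda>n. exp (- c * \<bar>of_int (int n)\<bar>)) summable_on UNIV"
    by (subst summable_on_UNIV_nonneg_real_iff) auto
  then have 1: "(\<lambda>j::int. exp (- c * \<bar>of_int j\<bar>)) summable_on range int"
    by (subst summable_on_reindex) (auto simp: o_def inj_on_def)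
  have "summable (\<lambda>n. exp (- c * real (Suc n)))"
    unfolding e using geo by (rule summable_Suc_iff[THEN iffD2])
  then have "summable (\<lambda>n. exp (- c * \<bar>of_int (- int (Suc n))\<bar>))"
    by (simp only: of_int_minus of_int_of_nat_eq abs_minus_cancel abs_of_nat)
  then have "(\<lambda>n. exp (- c * \<bar>of_int (- int (Suc n))\<bar>)) summable_on UNIV"
    by (subst summable_on_UNIV_nonneg_real_iff) auto
  then have 2: "(\<lambda>j::int. exp (- c * \<bar>of_int j\<bar>)) summable_on range (\<lambda>n. - int (Suc n))"
    by (subst summable_on_reindex) (auto simp: o_def inj_on_def)
  have "(\<lambda>j::int. exp (- c * \<bar>of_int j\<bar>)) summable_on (range int \<union> range (\<lambda>n. - int (Suc n)))"
    by (intro summable_on_Un_disjoint 1 2) auto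
  moreover have "range int \<union> range (\<lambda>n. - int (Suc n)) = UNIV"
  proof -
    have "j \<in> range int \<union> range (\<lambda>n. - int (Suc n))" for j by (cases j rule: int_cases) blast+
    then show ?thesis by blast
  qed
  ultimately show ?thesis by simp
qed

lemma lin_subspace_H2_worm: "lin_subspace (H2_worm \<beta>)"
  unfolding lin_subspace_def
proof (intro conjI ballI allI)
  have "nsq_worm \<beta> (\<lambda>z. 0) = 0"
    by (rule antisym[OF nsq_worm_le]) (auto simp: nsq_L2_def slice_def)
  moreover have "holomorphic2_on (\<lambda>z. 0) (worm \<beta>)"
    unfolding holomorphic2_on_def by (intro ballI exI[of _ 0]) (simp add: has_derivative_const)
  ultimately show "(\<lambda>z. 0) \<in> H2_worm \<beta>" by (simp add: H2_worm_def)
next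
  fix F G assume F: "F \<in> H2_worm \<beta>" and G: "G \<in> H2_worm \<beta>"
  have "nsq_worm \<beta> (\<lambda>z. F z + G z) \<le> 2 * nsq_worm \<beta> F + 2 * nsq_worm \<beta> G"
  proof (rule nsq_worm_le)
    fix t s assume ts: "(t, s) \<in> worm_params \<beta>"
    have "(\<Sum>l=1..4. nsq_L2 line_circle (slice (\<lambda>z. F z + G z) l t s))
        \<le> (\<Sum>l=1..4. 2 * nsq_L2 line_circle (slice F l t s) + 2 * nsq_L2 line_circle (slice G l t s))"
    proof (rule sum_mono)
      fix l
      have "slice (\<lambda>z. F z + G z) l t s = (\<lambda>p. slice F l t s p + slice G l t s p)"
        by (auto simp: fun_eq_iff slice_eq)
      then show "nsq_L2 line_circle (slice (\<lambda>z. F z + G z) l t s)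
          \<le> 2 * nsq_L2 line_circle (slice F l t s) + 2 * nsq_L2 line_circle (slice G l t s)"
        using nsq_L2_add_le[OF measurable_slice[OF H2_wormD(1)[OF F] ts] measurable_slice[OF H2_wormD(1)[OF G] ts]]
        by simp
    qed
    also have "\<dots> = 2 * (\<Sum>l=1..4. nsq_L2 line_circle (slice F l t s)) + 2 * (\<Sum>l=1..4. nsq_L2 line_circle (slice G l t s))"
      by (simp only: sum.distrib sum_distrib_left)
    also have "\<dots> \<le> 2 * nsq_worm \<beta> F + 2 * nsq_worm \<beta> G"
      by (intro add_mono mult_left_mono sum_slices_le_nsq_worm[OF ts]) auto
    finally show "(\<Sum>l=1..4. nsq_L2 line_circle (slice (\<lambda>z. F z + G z) l t s)) \<le> 2 * nsq_worm \<beta> F + 2 * nsq_worm \<beta> G" .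
  qed
  also have "\<dots> < \<infinity>" using H2_wormD(3)[OF F] H2_wormD(3)[OF G] by (simp add: ennreal_mult_less_top)
  finally show "(\<lambda>z. F z + G z) \<in> H2_worm \<beta>"
    using H2_wormD[OF F] H2_wormD[OF G] by (simp add: H2_worm_def holomorphic2_on_add)
next
  fix c F assume F: "F \<in> H2_worm \<beta>"
  have "nsq_worm \<beta> (\<lambda>z. c * F z) \<le> ennreal ((cmod c)\<^sup>2) * nsq_worm \<beta> F"
  proof (rule nsq_worm_le)
    fix t s assume ts: "(t, s) \<in> worm_params \<beta>"
    have "(\<Sum>l=1..4. nsq_L2 line_circle (slice (\<lambda>z. c * F z) l t s)) = ennreal ((cmod c)\<^sup>2) * (\<Sum>l=1..4. nsq_L2 line_circle (slice F l t s))"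
      unfolding sum_distrib_left
    proof (rule sum.cong)
      fix l
      have "slice (\<lambda>z. c * F z) l t s = (\<lambda>p. c * slice F l t s p)"
        by (auto simp: fun_eq_iff slice_eq)
      then show "nsq_L2 line_circle (slice (\<lambda>z. c * F z) l t s) = ennreal ((cmod c)\<^sup>2) * nsq_L2 line_circle (slice F l t s)"
        using nsq_L2_cmult[OF measurable_slice[OF H2_wormD(1)[OF F] ts], of c] by simp
    qed simp
    also have "\<dots> \<le> ennreal ((cmod c)\<^sup>2) * nsq_worm \<beta> F"
      by (intro mult_left_mono sum_slices_le_nsq_worm[OF ts]) auto
    finally show "(\<Sum>l=1..4. nsq_L2 line_circle (slice (\<lambda>z. c * F z) l t s)) \<le> ennreal ((cmod c)\<^sup>2) * nsq_worm \<beta> F" .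
  qed
  also have "\<dots> < \<infinity>" using H2_wormD(3)[OF F] by (simp add: ennreal_mult_less_top)
  finally show "(\<lambda>z. c * F z) \<in> H2_worm \<beta>"
    using H2_wormD[OF F] by (simp add: H2_worm_def holomorphic2_on_cmult)
qed

lemma lin_subspace_add:
  assumes "lin_subspace V" "F \<in> V" "G \<in> V"
  shows "(\<lambda>z. F z + G z) \<in> V"
  using assms(1) unfolding lin_subspace_def by (elim conjE) (drule bspec[OF _ assms(2)], erule bspec[OF _ assms(3)])

lemma lin_subspace_cmult:
  assumes "lin_subspace V" "F \<in> V"
  shows "(\<lambda>z. c * F z) \<in> V"
  using assms(1) unfolding lin_subspace_def by (elim conjE) (drule spec[of _ c], erule bspec[OF _ assms(2)])

lemma lin_subspace_H2_worm_comp: "lin_subspace (H2_worm_comp \<beta> j)"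
proof -
  have mem: "F \<in> H2_worm_comp \<beta> j \<longleftrightarrow> F \<in> H2_worm \<beta> \<and> (\<forall>z1 z2 \<theta>. (z1, z2) \<in> worm \<beta> \<longrightarrow>
      F (z1, cis \<theta> * z2) = cis (of_int j * \<theta>) * F (z1, z2))" for F
    unfolding H2_worm_comp_def by blast
  have H: "(\<lambda>z. 0) \<in> H2_worm \<beta>"
    "\<And>F G. F \<in> H2_worm \<beta> \<Longrightarrow> G \<in> H2_worm \<beta> \<Longrightarrow> (\<lambda>z. F z + G z) \<in> H2_worm \<beta>"
    "\<And>c F. F \<in> H2_worm \<beta> \<Longrightarrow> (\<lambda>z. c * F z) \<in> H2_worm \<beta>"
    using lin_subspace_add[OF lin_subspace_H2_worm] lin_subspace_cmult[OF lin_subspace_H2_worm]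
      lin_subspace_H2_worm[of \<beta>] by (simp_all add: lin_subspace_def)
  show ?thesis
    unfolding lin_subspace_def
  proof (intro conjI ballI allI)
    show "(\<lambda>z. 0) \<in> H2_worm_comp \<beta> j" unfolding mem using H(1) by simp
  next
    fix F G assume F: "F \<in> H2_worm_comp \<beta> j" and G: "G \<in> H2_worm_comp \<beta> j"
    then have "(\<lambda>z. F z + G z) \<in> H2_worm \<beta>" unfolding mem by (intro H(2)) blast+
    then show "(\<lambda>z. F z + G z) \<in> H2_worm_comp \<beta> j"
      unfolding mem by (simp add: H2_worm_compD(4)[OF F] H2_worm_compD(4)[OF G] distrib_left)
  next
    fix c F assume F: "F \<in> H2_worm_comp \<beta> j"
    then have "(\<lambda>z. c * F z) \<in> H2_worm \<beta>" unfolding mem by (intro H(3)) blast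
    then show "(\<lambda>z. c * F z) \<in> H2_worm_comp \<beta> j"
      unfolding mem by (simp add: H2_worm_compD(4)[OF F] mult.left_commute)
  qed
qed

lemma lin_subspace_sum:
  assumes "lin_subspace V" "\<And>j. j \<in> A \<Longrightarrow> G j \<in> V"
  shows "(\<lambda>z. \<Sum>j\<in>A. G j z) \<in> V"
  using assms(2)
proof (induction A rule: infinite_finite_induct)
  case (insert j A)
  then have "(\<lambda>z. G j z + (\<Sum>j\<in>A. G j z)) \<in> V"
    by (intro lin_subspace_add[OF assms(1)]) simp_all
  with insert show ?case by simp
qed (use assms(1) in \<open>auto simp: lin_subspace_def\<close>)

lemma lin_subspace_diff:
  assumes "lin_subspace V" "F \<in> V" "G \<in> V"
  shows "(\<lambda>z. F z - G z) \<in> V"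
proof -
  have "(\<lambda>z. F z + (-1) * G z) \<in> V"
    by (intro lin_subspace_add[OF assms(1)] lin_subspace_cmult[OF assms(1)] assms(2,3))
  then show ?thesis by simp
qed

lemma H2_worm_comp_subset: "H2_worm_comp \<beta> j \<subseteq> H2_worm \<beta>"
  by (auto simp: H2_worm_comp_def)

lemma Pythagoras_slice:
  assumes G: "\<And>j. G j \<in> H2_worm_comp \<beta> j" and ts: "(t, s) \<in> worm_params \<beta>" and "finite B"
  shows "nsq_L2 line_circle (slice (\<lambda>z. \<Sum>j\<in>B. G j z) l t s) = (\<Sum>j\<in>B. nsq_L2 line_circle (slice (G j) l t s))"
proof -
  have S: "(\<lambda>z. \<Sum>j\<in>B. G j z) \<in> H2_worm \<beta>"
    by (intro lin_subspace_sum[OF lin_subspace_H2_worm]) (use G H2_worm_comp_subset in blast)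
  have slice: "slice (\<lambda>z. \<Sum>j\<in>B. G j z) l t s (x, \<theta>) = (\<Sum>j\<in>B. slice (G j) l t s (x, 0) * cis (2 * pi * of_int j * \<theta>))" for x \<theta>
  proof -
    have "slice (\<lambda>z. \<Sum>j\<in>B. G j z) l t s (x, \<theta>) = (\<Sum>j\<in>B. slice (G j) l t s (x, \<theta>))"
      by (simp add: slice_eq)
    also have "\<dots> = (\<Sum>j\<in>B. slice (G j) l t s (x, 0) * cis (2 * pi * of_int j * \<theta>))"
      by (intro sum.cong refl slice_equivariant[OF H2_worm_compD(4)[OF G] ts])
    finally show ?thesis .
  qed
  have "nsq_L2 line_circle (slice (\<lambda>z. \<Sum>j\<in>B. G j z) l t s)
      = (\<integral>\<^sup>+x. ennreal (\<Sum>j\<in>B. (cmod (slice (G j) l t s (x, 0)))\<^sup>2) \<partial>lborel)"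
    unfolding nsq_line_circle_continuous[OF continuous_on_slice[OF H2_wormD(1)[OF S] ts]] slice
      Parseval_trigonometric_polynomial[OF \<open>finite B\<close>] ..
  also have "\<dots> = (\<integral>\<^sup>+x. (\<Sum>j\<in>B. ennreal ((cmod (slice (G j) l t s (x, 0)))\<^sup>2)) \<partial>lborel)"
    by (intro nn_integral_cong sum_ennreal[symmetric]) auto
  also have "\<dots> = (\<Sum>j\<in>B. \<integral>\<^sup>+x. ennreal ((cmod (slice (G j) l t s (x, 0)))\<^sup>2) \<partial>lborel)"
  proof (rule nn_integral_sum)
    show "(\<lambda>x. ennreal ((cmod (slice (G j) l t s (x, 0)))\<^sup>2)) \<in> borel_measurable lborel" for j
      using measurable_slice_0[OF H2_worm_compD(1)[OF G] ts, of j l] by measurable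
  qed
  also have "\<dots> = (\<Sum>j\<in>B. nsq_L2 line_circle (slice (G j) l t s))"
    by (intro sum.cong refl) (simp only: nsq_slice_equivariant[OF H2_worm_compD(1,4)[OF G] ts], simp only: nsq_L2_def)
  finally show ?thesis .
qed

lemma ennreal_infsum_tail_le:
  fixes a :: "'i \<Rightarrow> ennreal"
  assumes fin: "(\<Sum>\<^sub>\<infinity>j. a j) < \<infinity>" and "e > 0"
  obtains A0 where "finite A0" "\<And>B. finite B \<Longrightarrow> B \<inter> A0 = {} \<Longrightarrow> sum a B \<le> ennreal e"
proof -
  define T where "T = (\<Sum>\<^sub>\<infinity>j. a j)"
  have sup: "T = (SUP A\<in>{A. finite A \<and> A \<subseteq> UNIV}. sum a A)"
    unfolding T_def by (intro nonneg_infsum_complete) auto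
  have T_le: "sum a A \<le> T" if "finite A" for A
    unfolding sup using that by (intro SUP_upper) auto
  show ?thesis
  proof (cases "T = 0")
    case True
    show ?thesis
    proof (rule that[of "{}"])
      fix B :: "'i set" assume "finite B"
      then show "sum a B \<le> ennreal e" using T_le[of B] True by simp
    qed simp
  next
    case False
    define r where "r = enn2real T"
    have r: "T = ennreal r" "0 < r"
      using fin False by (auto simp: T_def r_def enn2real_positive_iff zero_less_iff_neq_zero)
    have "ennreal (r - e) < T" unfolding r(1) using r(2) \<open>e > 0\<close> by (intro ennreal_lessI) auto
    then obtain A0 where A0: "finite A0" "ennreal (r - e) < sum a A0"
      unfolding sup less_SUP_iff by auto
    have "T \<le> ennreal (r - e) + ennreal e"
    proof (cases "r \<ge> e")
      case True
      then show ?thesis unfolding r(1) using \<open>e > 0\<close> by (subst ennreal_plus[symmetric]) auto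
    next
      case False
      then show ?thesis unfolding r(1) by (intro add_increasing ennreal_leI) auto
    qed
    also have "\<dots> \<le> sum a A0 + ennreal e" using A0(2) by (intro add_right_mono) simp
    finally have T_A0: "T \<le> sum a A0 + ennreal e" .
    show ?thesis
    proof (rule that[OF A0(1)])
      fix B assume B: "finite B" "B \<inter> A0 = {}"
      have "sum a A0 + sum a B = sum a (A0 \<union> B)"
        using A0(1) B by (intro sum.union_disjoint[symmetric]) auto
      also have "\<dots> \<le> T" using A0(1) B by (intro T_le) auto
      also note T_A0
      finally show "sum a B \<le> ennreal e"
        using T_le[OF A0(1)] fin by (subst (asm) ennreal_add_left_cancel_le) (auto simp: T_def top_unique)
    qed
  qed
qed

lemma filterlim_int_interval_finite_subsets:
  "filterlim (\<lambda>k::nat. {- int k..int k}) (finite_subsets_at_top UNIV) sequentially"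
  unfolding filterlim_finite_subsets_at_top
proof (intro allI impI)
  fix X :: "int set" assume X: "finite X \<and> X \<subseteq> UNIV"
  then obtain m where m: "\<And>x. x \<in> X \<Longrightarrow> \<bar>x\<bar> \<le> m"
    by (auto simp: finite_int_iff_bounded_le)
  show "eventually (\<lambda>k. finite {- int k..int k} \<and> X \<subseteq> {- int k..int k} \<and> {- int k..int k} \<subseteq> UNIV) sequentially"
    using eventually_ge_at_top[of "nat m"] by eventually_elim (use m in fastforce)
qed

text \<open>The pointwise bound makes the series converge locally uniformly, so its sum is holomorphic. On each
  slice the partial sums of a tail have norms given by Pythagoras, and Fatou's lemma carries the
  bound to the tail of the sum. Each of the four slices is bounded separately, which costs a factor
  \<open>4\<close> that does not affect convergence.\<close>

lemma sum_in_H2_worm: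
  assumes \<beta>: "\<beta> > pi / 2" and G: "\<And>j. G j \<in> H2_worm_comp \<beta> j"
    and fin: "(\<Sum>\<^sub>\<infinity>j. nsq_worm \<beta> (G j)) < \<infinity>"
  shows "\<exists>F\<in>H2_worm \<beta>. norm_has_sum (nsq_worm \<beta>) G F"
proof -
  define N where "N = enn2real (\<Sum>\<^sub>\<infinity>j. nsq_worm \<beta> (G j))"
  have N: "(\<Sum>\<^sub>\<infinity>j. nsq_worm \<beta> (G j)) = ennreal N" "0 \<le> N" using fin by (auto simp: N_def)
  have sum_le: "(\<Sum>j\<in>B. nsq_worm \<beta> (G j)) \<le> ennreal N" if "finite B" for B
  proof -
    have "ennreal N = (SUP A\<in>{A. finite A \<and> A \<subseteq> UNIV}. \<Sum>j\<in>A. nsq_worm \<beta> (G j))"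
      unfolding N(1)[symmetric] by (intro nonneg_infsum_complete) auto
    then show ?thesis using that by (auto intro: SUP_upper)
  qed
  define S where "S A z = (\<Sum>j\<in>A. G j z)" for A z
  define F where "F z = (\<Sum>\<^sub>\<infinity>j. G j z)" for z
  have S_H2: "S A \<in> H2_worm \<beta>" for A
    unfolding S_def by (intro lin_subspace_sum[OF lin_subspace_H2_worm]) (use G H2_worm_comp_subset in blast)
  have F_0: "F z = 0" if "z \<notin> worm \<beta>" for z
    unfolding F_def using H2_worm_compD(2)[OF G that] by simp
  have loc: "\<exists>V. open V \<and> p \<in> V \<and> uniform_limit V S F (finite_subsets_at_top UNIV)" if p: "p \<in> worm \<beta>" for p
  proof -
    obtain \<delta> where \<delta>: "\<delta> > 0" "snd p \<noteq> 0" "\<bar>Im (fst p) - ln ((cmod (snd p))\<^sup>2)\<bar> < pi / 2 - 2 * \<delta>"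
      "\<bar>ln ((cmod (snd p))\<^sup>2)\<bar> < \<beta> - pi / 2 - \<delta>"
      using worm_margin[of "fst p" "snd p" \<beta>] p by auto
    define V where "V = {z. snd z \<noteq> 0 \<and> \<bar>Im (fst z) - ln ((cmod (snd z))\<^sup>2)\<bar> < pi / 2 - 2 * \<delta> \<and> \<bar>ln ((cmod (snd z))\<^sup>2)\<bar> < \<beta> - pi / 2 - \<delta>}"
    have "uniform_limit V S F (finite_subsets_at_top UNIV)"
      unfolding S_def[abs_def] F_def[abs_def]
    proof (rule Weierstrass_m_test_general)
      fix j z assume "z \<in> V"
      have "nsq_worm \<beta> (G j) \<le> ennreal N" using sum_le[of "{j}"] by simp
      then show "norm (G j z) \<le> sqrt (N / (pi * \<delta>)) * exp (- (\<delta> / 2) * \<bar>of_int j\<bar>)"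
        using comp_point_bound[OF \<beta> G _ N(2) \<delta>(1), of j "snd z" "fst z"] \<open>z \<in> V\<close> by (simp add: V_def)
    next
      show "(\<lambda>j. sqrt (N / (pi * \<delta>)) * exp (- (\<delta> / 2) * \<bar>real_of_int j\<bar>)) summable_on UNIV"
        using summable_on_exp_abs_int[of "\<delta> / 2"] \<delta>(1) by (intro summable_on_cmult_right) simp
    qed
    moreover have "open V" unfolding V_def by (rule open_annular_domain)
    moreover have "p \<in> V" using \<delta> by (simp add: V_def)
    ultimately show ?thesis by blast
  qed
  have F_hol: "holomorphic2_on F (worm \<beta>)"
    by (rule holomorphic2_on_locally_uniform_limit[OF open_worm _ H2_wormD(1)[OF S_H2] loc]) simp_all
  have F_lim: "(\<lambda>k. S {- int k..int k} z) \<longlonglongrightarrow> F z" if "z \<in> worm \<beta>" for z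
  proof -
    obtain V where "z \<in> V" "uniform_limit V S F (finite_subsets_at_top UNIV)" using loc[OF \<open>z \<in> worm \<beta>\<close>] by blast
    then have "((\<lambda>A. S A z) \<longlongrightarrow> F z) (finite_subsets_at_top UNIV)" by (intro tendsto_uniform_limitI)
    then show ?thesis by (rule filterlim_compose[OF _ filterlim_int_interval_finite_subsets])
  qed
  have tail: "nsq_worm \<beta> (\<lambda>z. F z - S A z) \<le> 4 * b"
    if A: "finite A" and b: "\<And>B. finite B \<Longrightarrow> B \<inter> A = {} \<Longrightarrow> (\<Sum>j\<in>B. nsq_worm \<beta> (G j)) \<le> b" for A b
  proof (rule nsq_worm_le)
    fix t s assume ts: "(t, s) \<in> worm_params \<beta>"
    have "nsq_L2 line_circle (slice (\<lambda>z. F z - S A z) l t s) \<le> b" if l: "l \<in> {1..4}" for l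
    proof (rule nsq_L2_Fatou)
      let ?B = "\<lambda>k. {- int k..int k} - A"
      show "slice (S (?B k)) l t s \<in> borel_measurable line_circle" for k
        by (rule measurable_slice[OF H2_wormD(1)[OF S_H2] ts])
      have "(\<lambda>k. slice (S (?B k)) l t s (x, \<theta>)) \<longlonglongrightarrow> slice (\<lambda>z. F z - S A z) l t s (x, \<theta>)" for x \<theta>
      proof -
        define z where "z = (Complex x (slice_height l t s), of_real (exp (slice_level l s / 2)) * cis (2 * pi * \<theta>))"
        have z: "z \<in> worm \<beta>" unfolding z_def by (rule slice_in_worm[OF ts])
        obtain m where m: "\<And>x. x \<in> A \<Longrightarrow> \<bar>x\<bar> \<le> m" using A by (auto simp: finite_int_iff_bounded_le)
        have "eventually (\<lambda>k. S {- int k..int k} z - S A z = S (?B k) z) sequentially"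
          using eventually_ge_at_top[of "nat m"]
        proof eventually_elim
          case (elim k)
          then have "A \<subseteq> {- int k..int k}" using m by fastforce
          then show ?case unfolding S_def by (simp add: sum_diff)
        qed
        moreover have "(\<lambda>k. S {- int k..int k} z - S A z) \<longlonglongrightarrow> F z - S A z"
          by (intro tendsto_intros F_lim[OF z])
        ultimately have "(\<lambda>k. S (?B k) z) \<longlonglongrightarrow> F z - S A z" by (rule Lim_transform_eventually[rotated])
        then show ?thesis by (simp add: slice_eq z_def)
      qed
      then show "AE p in line_circle. (\<lambda>k. slice (S (?B k)) l t s p) \<longlonglongrightarrow> slice (\<lambda>z. F z - S A z) l t s p"
        by (intro AE_I2) (auto simp: split_paired_all)
      fix k :: nat assume "0 \<le> k"
      have "nsq_L2 line_circle (slice (S (?B k)) l t s) = (\<Sum>j\<in>?B k. nsq_L2 line_circle (slice (G j) l t s))"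
        unfolding S_def[abs_def] by (rule Pythagoras_slice[OF G ts]) simp
      also have "\<dots> \<le> (\<Sum>j\<in>?B k. nsq_worm \<beta> (G j))"
        by (intro sum_mono slice_le_nsq_worm[OF l ts])
      also have "\<dots> \<le> b" by (intro b) auto
      finally show "nsq_L2 line_circle (slice (S (?B k)) l t s) \<le> b" .
    qed
    then have "(\<Sum>l=1..4. nsq_L2 line_circle (slice (\<lambda>z. F z - S A z) l t s)) \<le> (\<Sum>l=1..(4::nat). b)"
      by (intro sum_mono)
    then show "(\<Sum>l=1..4. nsq_L2 line_circle (slice (\<lambda>z. F z - S A z) l t s)) \<le> 4 * b" by simp
  qed
  have "nsq_worm \<beta> F \<le> 4 * ennreal N"
    using tail[of "{}" "ennreal N"] sum_le by (simp add: S_def)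
  also have "\<dots> < \<infinity>" by (simp add: ennreal_mult_less_top)
  finally have "F \<in> H2_worm \<beta>" using F_hol F_0 by (simp add: H2_worm_def)
  moreover have "norm_has_sum (nsq_worm \<beta>) G F"
    unfolding norm_has_sum_def tendsto_0_ennreal_iff
  proof (intro allI impI)
    fix e :: real assume "e > 0"
    obtain A0 where A0: "finite A0" "\<And>B. finite B \<Longrightarrow> B \<inter> A0 = {} \<Longrightarrow> (\<Sum>j\<in>B. nsq_worm \<beta> (G j)) \<le> ennreal (e / 4)"
      using ennreal_infsum_tail_le[OF fin, of "e / 4"] \<open>e > 0\<close> by auto
    have "nsq_worm \<beta> (\<lambda>z. F z - (\<Sum>j\<in>A. G j z)) \<le> ennreal e" if "finite A" "A0 \<subseteq> A" for A
    proof -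
      have "nsq_worm \<beta> (\<lambda>z. F z - S A z) \<le> 4 * ennreal (e / 4)"
        by (intro tail that(1) A0(2)) (use that in auto)
      also have "\<dots> = ennreal e"
        by (subst ennreal_numeral[symmetric], subst ennreal_mult[symmetric]) (use \<open>e > 0\<close> in auto)
      finally show ?thesis by (simp add: S_def)
    qed
    then show "eventually (\<lambda>A. nsq_worm \<beta> (\<lambda>z. F z - (\<Sum>j\<in>A. G j z)) \<le> ennreal e) (finite_subsets_at_top UNIV)"
      unfolding eventually_finite_subsets_at_top using A0(1) by blast
  qed
  ultimately show ?thesis by blast
qed

section \<open>Uniqueness of the decomposition\<close>

lemma proj_sum:
  assumes G: "\<And>i. i \<in> A \<Longrightarrow> holomorphic2_on (G i) (worm \<beta>)" and "finite A"
  shows "proj \<beta> j (\<lambda>z. \<Sum>i\<in>A. G i z) z = (\<Sum>i\<in>A. proj \<beta> j (G i) z)"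
proof (cases "z \<in> worm \<beta>")
  case True
  then have z: "(fst z, snd z) \<in> worm \<beta>" by simp
  have "integral {0..1} (\<lambda>\<theta>. \<Sum>i\<in>A. G i (fst z, cis (2 * pi * \<theta>) * snd z) * cis (- (2 * pi * of_int j * \<theta>)))
      = (\<Sum>i\<in>A. integral {0..1} (\<lambda>\<theta>. G i (fst z, cis (2 * pi * \<theta>) * snd z) * cis (- (2 * pi * of_int j * \<theta>))))"
    by (intro Henstock_Kurzweil_Integration.integral_sum \<open>finite A\<close> integrable_continuous_interval continuous_intros
        continuous_on_rotation_circle[OF G z])
  then show ?thesis using True by (simp add: proj_def fourier_coeff_def sum_distrib_right)
qed (simp add: proj_def)

lemma proj_diff_sum_comp:
  assumes F: "F \<in> H2_worm \<beta>" and G: "\<And>j. G j \<in> H2_worm_comp \<beta> j" and A: "finite A" "k \<in> A"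
  shows "proj \<beta> k (\<lambda>z. F z - (\<Sum>j\<in>A. G j z)) = (\<lambda>z. proj \<beta> k F z - G k z)"
proof
  fix z
  have S: "(\<lambda>z. \<Sum>j\<in>A. G j z) \<in> H2_worm \<beta>"
    by (intro lin_subspace_sum[OF lin_subspace_H2_worm]) (use G H2_worm_comp_subset in blast)
  have "proj \<beta> k (\<lambda>z. \<Sum>j\<in>A. G j z) z = (\<Sum>j\<in>A. proj \<beta> k (G j) z)"
    using H2_worm_compD(1)[OF G] A by (intro proj_sum) auto
  also have "\<dots> = (\<Sum>j\<in>A. if j = k then G j z else 0)"
    by (intro sum.cong refl) (simp add: proj_comp[OF G])
  also have "\<dots> = G k z" using A by (simp add: sum.delta)
  finally show "proj \<beta> k (\<lambda>z. F z - (\<Sum>j\<in>A. G j z)) z = proj \<beta> k F z - G k z"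
    by (simp add: proj_diff[OF H2_wormD(1)[OF F] H2_wormD(1)[OF S]])
qed

text \<open>The projection of degree \<open>k\<close> does not increase norms and maps every partial sum that contains the
  index \<open>k\<close> to \<open>G k\<close>.\<close>

lemma norm_has_sum_imp_proj:
  assumes \<beta>: "\<beta> > pi / 2" and F: "F \<in> H2_worm \<beta>" and G: "\<And>j. G j \<in> H2_worm_comp \<beta> j"
    and sum: "norm_has_sum (nsq_worm \<beta>) G F"
  shows "G k = proj \<beta> k F"
proof -
  let ?D = "\<lambda>z. proj \<beta> k F z - G k z"
  have D: "?D \<in> H2_worm_comp \<beta> k"
    by (intro lin_subspace_diff[OF lin_subspace_H2_worm_comp] proj_in_comp F G)
  have le: "nsq_worm \<beta> ?D \<le> nsq_worm \<beta> (\<lambda>z. F z - (\<Sum>j\<in>A. G j z))" if "finite A" "k \<in> A" for A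
  proof -
    have "(\<lambda>z. F z - (\<Sum>j\<in>A. G j z)) \<in> H2_worm \<beta>"
      by (intro lin_subspace_diff[OF lin_subspace_H2_worm] F lin_subspace_sum[OF lin_subspace_H2_worm])
         (use G H2_worm_comp_subset in blast)
    from nsq_worm_proj_le[OF H2_wormD(1)[OF this], of k]
    show ?thesis by (simp only: proj_diff_sum_comp[OF F G that])
  qed
  have "eventually (\<lambda>A. nsq_worm \<beta> ?D \<le> nsq_worm \<beta> (\<lambda>z. F z - (\<Sum>j\<in>A. G j z))) (finite_subsets_at_top UNIV)"
    unfolding eventually_finite_subsets_at_top using le by (intro exI[of _ "{k}"]) auto
  then have "nsq_worm \<beta> ?D \<le> 0"
    using sum unfolding norm_has_sum_def by (intro tendsto_lowerbound[of _ 0 "finite_subsets_at_top UNIV"]) auto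
  from comp_norm_0[OF \<beta> D this] show ?thesis by (auto simp: fun_eq_iff)
qed

lemma eq_if_proj_eq:
  assumes F: "F \<in> H2_worm \<beta>" and G: "G \<in> H2_worm \<beta>" and eq: "\<And>j. proj \<beta> j F = proj \<beta> j G"
  shows "F = G"
proof
  fix z
  have "F z - G z = 0"
  proof (rule proj_eq_0_imp_eq_0)
    show "(\<lambda>z. F z - G z) \<in> H2_worm \<beta>" by (rule lin_subspace_diff[OF lin_subspace_H2_worm F G])
    show "proj \<beta> j (\<lambda>z. F z - G z) z = 0" for j z
      by (simp add: proj_diff[OF H2_wormD(1)[OF F] H2_wormD(1)[OF G]] eq)
  qed
  then show "F z = G z" by simp
qed

text \<open>By Bessel's inequality the projections of \<open>F\<close> have some sum in the space. That sum has the same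
  projections as \<open>F\<close>, hence equals \<open>F\<close>: completeness of the characters enters only through the
  uniqueness of Fourier coefficients.\<close>

lemma proj_has_sum:
  assumes \<beta>: "\<beta> > pi / 2" and F: "F \<in> H2_worm \<beta>"
  shows "norm_has_sum (nsq_worm \<beta>) (\<lambda>j. proj \<beta> j F) F"
proof -
  have "(\<Sum>\<^sub>\<infinity>j. nsq_worm \<beta> (proj \<beta> j F)) = (SUP A\<in>{A. finite A \<and> A \<subseteq> UNIV}. \<Sum>j\<in>A. nsq_worm \<beta> (proj \<beta> j F))"
    by (intro nonneg_infsum_complete) auto
  also have "\<dots> \<le> nsq_worm \<beta> F" by (intro SUP_least Bessel_worm[OF \<beta> F]) auto
  also have "\<dots> < \<infinity>" by (rule H2_wormD(3)[OF F])
  finally obtain F' where F': "F' \<in> H2_worm \<beta>" "norm_has_sum (nsq_worm \<beta>) (\<lambda>j. proj \<beta> j F) F'"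
    using sum_in_H2_worm[OF \<beta>, of "\<lambda>j. proj \<beta> j F"] proj_in_comp[OF F] by blast
  have "proj \<beta> k F = proj \<beta> k F'" for k
    using norm_has_sum_imp_proj[OF \<beta> F'(1) _ F'(2)] proj_in_comp[OF F] by blast
  then have "F = F'" by (rule eq_if_proj_eq[OF F F'(1)])
  with F'(2) show ?thesis by simp
qed

text \<open>A limit of elements of degree \<open>j\<close> has zero projections of all other degrees.\<close>

lemma comp_closed:
  assumes \<beta>: "\<beta> > pi / 2" and F: "F \<in> H2_worm \<beta>" and X: "\<And>n::nat. X n \<in> H2_worm_comp \<beta> j"
    and lim: "(\<lambda>n. nsq_worm \<beta> (\<lambda>z. F z - X n z)) \<longlonglongrightarrow> 0"
  shows "F \<in> H2_worm_comp \<beta> j"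
proof -
  have zero: "proj \<beta> k F = (\<lambda>z. 0)" if "k \<noteq> j" for k
  proof -
    have "nsq_worm \<beta> (proj \<beta> k F) \<le> nsq_worm \<beta> (\<lambda>z. F z - X n z)" for n
    proof -
      have "(\<lambda>z. F z - X n z) \<in> H2_worm \<beta>"
        using X H2_worm_comp_subset by (intro lin_subspace_diff[OF lin_subspace_H2_worm] F) blast
      from nsq_worm_proj_le[OF H2_wormD(1)[OF this], of k]
      show ?thesis
        using \<open>k \<noteq> j\<close> by (simp add: proj_diff[OF H2_wormD(1)[OF F] H2_worm_compD(1)[OF X], abs_def] proj_comp[OF X])
    qed
    then have "nsq_worm \<beta> (proj \<beta> k F) \<le> 0"
      by (intro tendsto_lowerbound[OF lim]) auto
    from comp_norm_0[OF \<beta> proj_in_comp[OF F] this] show ?thesis by blast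
  qed
  have "proj \<beta> k F = proj \<beta> k (proj \<beta> j F)" for k
    using zero by (simp add: proj_comp[OF proj_in_comp[OF F]])
  then have "F = proj \<beta> j F"
    using proj_in_comp[OF F, of j] H2_worm_comp_subset by (intro eq_if_proj_eq[OF F]) blast+
  then show ?thesis using proj_in_comp[OF F, of j] by simp
qed

section \<open>Boundary values and orthogonality\<close>

lemma corner_neq_bot:
  assumes "\<beta> > pi / 2"
  shows "at (pi / 2, \<beta> - pi / 2) within worm_params \<beta> \<noteq> bot"
proof -
  have "(pi / 2, \<beta> - pi / 2) islimpt worm_params \<beta>"
    unfolding islimpt_sequential
  proof (intro exI[of _ "param_seq \<beta>"] conjI allI)
    show "param_seq \<beta> n \<in> worm_params \<beta> - {(pi / 2, \<beta> - pi / 2)}" for n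
      using param_seq_in[OF assms, of n] by (auto simp: worm_params_def)
    have "(\<lambda>n. (pi / 2 * (1 - 1 / real (Suc n)), (\<beta> - pi / 2) * (1 - 1 / real (Suc n)))) \<longlonglongrightarrow> (pi / 2 * (1 - 0), (\<beta> - pi / 2) * (1 - 0))"
      by (intro tendsto_intros LIMSEQ_Suc[OF lim_1_over_n])
    then show "param_seq \<beta> \<longlonglongrightarrow> (pi / 2, \<beta> - pi / 2)"
      by (simp add: param_seq_def[abs_def])
  qed
  then show ?thesis by (simp add: trivial_limit_within)
qed

lemma eventually_in_params:
  "eventually (\<lambda>p. p \<in> worm_params \<beta>) (at q within worm_params \<beta>)"
  by (simp add: eventually_at_filter)

lemma boundary_value_unique:
  assumes \<beta>: "\<beta> > pi / 2" and F: "F \<in> H2_worm \<beta>" and g: "is_boundary_value \<beta> F l g"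
  shows "AE p in line_circle. boundary_value \<beta> F l p = g p"
    and "boundary_value \<beta> F l \<in> borel_measurable line_circle"
proof -
  have b: "is_boundary_value \<beta> F l (boundary_value \<beta> F l)"
    unfolding boundary_value_def using g by (rule someI[of "is_boundary_value \<beta> F l"])
  then show "boundary_value \<beta> F l \<in> borel_measurable line_circle"
    by (simp add: is_boundary_value_def in_L2_def)
  show "AE p in line_circle. boundary_value \<beta> F l p = g p"
  proof (rule nsq_L2_limit_unique[OF corner_neq_bot[OF \<beta>], where u = "\<lambda>(t, s). slice F l t s"])
    show "eventually (\<lambda>i. (case i of (t, s) \<Rightarrow> slice F l t s) \<in> borel_measurable line_circle)
        (at (pi / 2, \<beta> - pi / 2) within worm_params \<beta>)"
      using eventually_in_params by eventually_elim (auto intro: measurable_slice[OF H2_wormD(1)[OF F]])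
  qed (use b g in \<open>auto simp: is_boundary_value_def in_L2_def case_prod_unfold\<close>)
qed

text \<open>The boundary value of an element of degree \<open>j\<close> is a constant times that of its trace on the strip,
  at the corner height, times the character of degree \<open>j\<close>.\<close>

lemma comp_boundary_value:
  assumes \<beta>: "\<beta> > pi / 2" and F: "F \<in> H2_worm_comp \<beta> j"
  obtains a where "a \<in> borel_measurable borel"
    "is_boundary_value \<beta> F l (\<lambda>(x, \<theta>). a x * cis (of_int j * 2 * pi * \<theta>))"
proof -
  define f where "f = trace \<beta> j F"
  have f: "f \<in> H2_strip \<beta>" unfolding f_def by (rule trace_in_H2_strip[OF \<beta> F])
  have lift: "lift \<beta> j f = F" unfolding f_def by (rule lift_trace_comp[OF \<beta> F])
  have "0 < \<beta>" using \<beta> pi_gt_zero by linarith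
  define y0 where "y0 = slice_height l (pi / 2) (\<beta> - pi / 2)"
  have y0: "\<bar>y0\<bar> \<le> \<beta>" using \<beta> pi_gt_zero \<open>0 < \<beta>\<close> by (auto simp: y0_def slice_height_def abs_le_iff)
  obtain g where g: "in_L2 lborel g"
    "((\<lambda>y. nsq_L2 lborel (\<lambda>x. f (Complex x y) - g x)) \<longlongrightarrow> 0) (inf (nhds y0) (principal {-\<beta><..<\<beta>}))"
    using H2_strip_L2_limit[OF f \<open>0 < \<beta>\<close> y0] by metis
  have [measurable]: "g \<in> borel_measurable borel" using g(1) by (simp add: in_L2_def)
  define c where "c s = exp (of_int j * slice_level l s / 2)" for s
  define a where "a x = of_real (c (\<beta> - pi / 2)) * g x" for x
  have [measurable]: "a \<in> borel_measurable borel" unfolding a_def by measurable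
  let ?b = "\<lambda>(x, \<theta>). a x * cis (of_int j * 2 * pi * \<theta>)"
  let ?W = "at (pi / 2, \<beta> - pi / 2) within worm_params \<beta>"
  have b_meas: "?b \<in> borel_measurable line_circle"
  proof (rule borel_measurable_line_circle)
    have "(\<lambda>p. a (fst p) * cis (of_int j * 2 * pi * snd p)) \<in> borel_measurable (borel \<Otimes>\<^sub>M borel)"
      unfolding cis_conv_exp by measurable
    then show "?b \<in> borel_measurable borel" by (simp add: borel_prod case_prod_unfold)
  qed
  have "nsq_L2 line_circle ?b = nsq_L2 lborel a"
    by (intro nsq_line_circle_character) measurable
  moreover have "in_L2 lborel a"
    unfolding a_def by (rule in_L2_cmult[OF g(1)])
  ultimately have b_L2: "in_L2 line_circle ?b" using b_meas by (simp add: in_L2_def)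
  have heights: "filterlim (\<lambda>(t, s). slice_height l t s) (inf (nhds y0) (principal {-\<beta><..<\<beta>})) ?W"
    unfolding filterlim_inf filterlim_principal
  proof
    have "((\<lambda>p. slice_height l (fst p) (snd p)) \<longlongrightarrow> slice_height l (fst (pi / 2, \<beta> - pi / 2)) (snd (pi / 2, \<beta> - pi / 2))) ?W"
    proof -
      obtain p q where pq: "\<And>t s. slice_height l t s = p * s + q * t"
      proof -
        consider "l = 1" | "l = 2" | "l = 3" | "l \<noteq> 1" "l \<noteq> 2" "l \<noteq> 3" by blast
        then show ?thesis
        proof cases
          case 1 then show ?thesis by (intro that[of 1 1]) (simp add: slice_height_def)
        next
          case 2 then show ?thesis by (intro that[of 1 "-1"]) (simp add: slice_height_def)
        next
          case 3 then show ?thesis by (intro that[of "-1" "-1"]) (simp add: slice_height_def)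
        next
          case 4 then show ?thesis by (intro that[of "-1" 1]) (simp add: slice_height_def)
        qed
      qed
      show ?thesis unfolding pq by (intro tendsto_intros)
    qed
    then show "filterlim (\<lambda>(t, s). slice_height l t s) (nhds y0) ?W"
      by (simp add: y0_def case_prod_unfold)
    show "eventually (\<lambda>p. (case p of (t, s) \<Rightarrow> slice_height l t s) \<in> {-\<beta><..<\<beta>}) ?W"
      using eventually_in_params
    proof eventually_elim
      case (elim p)
      then show ?case using slice_height_bound[of "fst p" "snd p" \<beta> l] by (simp add: case_prod_unfold abs_less_iff)
    qed
  qed
  have c_lim: "((\<lambda>(t, s). c s) \<longlongrightarrow> c (\<beta> - pi / 2)) ?W"
  proof -
    have "((\<lambda>p. slice_level l (snd p)) \<longlongrightarrow> slice_level l (snd (pi / 2, \<beta> - pi / 2))) ?W"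
    proof (cases "l = 1 \<or> l = 2")
      case True
      then show ?thesis unfolding slice_level_def if_P[OF True] by (intro tendsto_intros)
    next
      case False
      then show ?thesis unfolding slice_level_def if_not_P[OF False] by (intro tendsto_intros)
    qed
    then have "((\<lambda>p. exp (of_int j * slice_level l (snd p) / 2)) \<longlongrightarrow> exp (of_int j * slice_level l (snd (pi / 2, \<beta> - pi / 2)) / 2)) ?W"
      by (intro tendsto_intros) auto
    then show ?thesis by (simp add: c_def case_prod_unfold)
  qed
  define G where "G = enn2real (nsq_L2 lborel g)"
  have G: "nsq_L2 lborel g = ennreal G" "0 \<le> G" using g(1) by (auto simp: G_def in_L2_def)
  define C where "C = (c (\<beta> - pi / 2) + 1)\<^sup>2"
  have c_ev: "eventually (\<lambda>(t, s). c s < c (\<beta> - pi / 2) + 1) ?W"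
    using order_tendstoD(2)[OF c_lim, of "c (\<beta> - pi / 2) + 1"] by (simp add: case_prod_unfold)
  have bound: "((\<lambda>(t, s). 2 * (ennreal C * nsq_L2 lborel (\<lambda>x. f (Complex x (slice_height l t s)) - g x))
      + 2 * (ennreal ((c s - c (\<beta> - pi / 2))\<^sup>2) * nsq_L2 lborel g)) \<longlongrightarrow> 0) ?W"
  proof -
    have 1: "((\<lambda>(t, s). nsq_L2 lborel (\<lambda>x. f (Complex x (slice_height l t s)) - g x)) \<longlongrightarrow> 0) ?W"
      using filterlim_compose[OF g(2) heights] by (simp add: case_prod_unfold)
    have "((\<lambda>p. ennreal (((case p of (t, s) \<Rightarrow> c s) - c (\<beta> - pi / 2))\<^sup>2 * G)) \<longlongrightarrow> ennreal ((c (\<beta> - pi / 2) - c (\<beta> - pi / 2))\<^sup>2 * G)) ?W"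
      by (intro tendsto_ennrealI tendsto_intros c_lim)
    then have 2: "((\<lambda>(t, s). ennreal ((c s - c (\<beta> - pi / 2))\<^sup>2) * nsq_L2 lborel g) \<longlongrightarrow> 0) ?W"
      using G by (simp add: case_prod_unfold ennreal_mult)
    show ?thesis
      unfolding case_prod_unfold
      by (intro tendsto_0_ennreal_add tendsto_0_ennreal_cmult 1[unfolded case_prod_unfold] 2[unfolded case_prod_unfold]) auto
  qed
  have "((\<lambda>(t, s). nsq_L2 line_circle (\<lambda>p. slice F l t s p - ?b p)) \<longlongrightarrow> 0) ?W"
  proof (rule tendsto_0_ennreal_le[OF bound])
    show "eventually (\<lambda>p. (case p of (t, s) \<Rightarrow> nsq_L2 line_circle (\<lambda>p. slice F l t s p - ?b p))
        \<le> (case p of (t, s) \<Rightarrow> 2 * (ennreal C * nsq_L2 lborel (\<lambda>x. f (Complex x (slice_height l t s)) - g x))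
      + 2 * (ennreal ((c s - c (\<beta> - pi / 2))\<^sup>2) * nsq_L2 lborel g))) ?W"
      using eventually_in_params c_ev
    proof eventually_elim
      case (elim p)
      obtain t s where p: "p = (t, s)" by (cases p)
      have ts: "(t, s) \<in> worm_params \<beta>" and cs: "c s < c (\<beta> - pi / 2) + 1" using elim p by auto
      define h where "h x = f (Complex x (slice_height l t s))" for x
      have [measurable]: "h \<in> borel_measurable borel"
        unfolding h_def by (rule H2_strip_line_measurable[OF f])
      have "slice F l t s = (\<lambda>(x, \<theta>). (of_real (c s) * h x) * cis (of_int j * 2 * pi * \<theta>))"
        using slice_lift[OF ts, of j f l] unfolding lift c_def h_def .
      then have "(\<lambda>p. slice F l t s p - ?b p) = (\<lambda>(x, \<theta>). (of_real (c s) * h x - a x) * cis (of_int j * 2 * pi * \<theta>))"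
        by (auto simp: fun_eq_iff left_diff_distrib)
      then have "nsq_L2 line_circle (\<lambda>p. slice F l t s p - ?b p) = nsq_L2 line_circle (\<lambda>(x, \<theta>). (of_real (c s) * h x - a x) * cis (of_int j * 2 * pi * \<theta>))"
        by (rule arg_cong)
      also have "\<dots> = nsq_L2 lborel (\<lambda>x. of_real (c s) * h x - a x)"
        by (intro nsq_line_circle_character) measurable
      also have "(\<lambda>x. of_real (c s) * h x - a x) = (\<lambda>x. of_real (c s) * (h x - g x) + of_real (c s - c (\<beta> - pi / 2)) * g x)"
        by (auto simp: fun_eq_iff a_def algebra_simps)
      also have "nsq_L2 lborel \<dots> \<le> 2 * nsq_L2 lborel (\<lambda>x. of_real (c s) * (h x - g x)) + 2 * nsq_L2 lborel (\<lambda>x. of_real (c s - c (\<beta> - pi / 2)) * g x)"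
        by (intro nsq_L2_add_le) measurable
      also have "nsq_L2 lborel (\<lambda>x. of_real (c s) * (h x - g x)) = ennreal ((c s)\<^sup>2) * nsq_L2 lborel (\<lambda>x. h x - g x)"
        by (subst nsq_L2_cmult) auto
      also have "nsq_L2 lborel (\<lambda>x. of_real (c s - c (\<beta> - pi / 2)) * g x) = ennreal ((c s - c (\<beta> - pi / 2))\<^sup>2) * nsq_L2 lborel g"
        by (subst nsq_L2_cmult) (auto simp flip: of_real_diff)
      also have "2 * (ennreal ((c s)\<^sup>2) * nsq_L2 lborel (\<lambda>x. h x - g x)) + 2 * (ennreal ((c s - c (\<beta> - pi / 2))\<^sup>2) * nsq_L2 lborel g)
          \<le> 2 * (ennreal C * nsq_L2 lborel (\<lambda>x. h x - g x)) + 2 * (ennreal ((c s - c (\<beta> - pi / 2))\<^sup>2) * nsq_L2 lborel g)"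
        using cs unfolding C_def
        by (intro add_right_mono mult_left_mono mult_right_mono ennreal_leI power_mono) (auto simp: c_def)
      finally show ?case by (simp add: p h_def)
    qed
  qed
  then have "is_boundary_value \<beta> F l ?b" unfolding is_boundary_value_def using b_L2 by blast
  with \<open>a \<in> borel_measurable borel\<close> show ?thesis by (rule that)
qed

lemma circle_integral_character:
  assumes "n \<noteq> (0::int)"
  shows "(LINT \<theta>|restrict_space lborel {0..<1}. cis (2 * pi * of_int n * \<theta>)) = 0"
proof -
  have "(LINT \<theta>|restrict_space lborel {0..<1}. cis (2 * pi * of_int n * \<theta>))
      = (LINT \<theta>|lborel. indicator {0..<1} \<theta> *\<^sub>R cis (2 * pi * of_int n * \<theta>))"
    by (rule integral_restrict_space) simp
  also have "\<dots> = (LINT \<theta>:{0..1}|lborel. cis (2 * pi * of_int n * \<theta>))"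
    unfolding set_lebesgue_integral_def
  proof (rule integral_cong_AE)
    have "AE \<theta> in lborel. \<theta> \<noteq> (1::real)" by (rule AE_lborel_singleton)
    then show "AE \<theta> in lborel. indicator {0..<1} \<theta> *\<^sub>R cis (2 * pi * of_int n * \<theta>) = indicator {0..1} \<theta> *\<^sub>R cis (2 * pi * of_int n * \<theta>)"
      by eventually_elim (auto simp: indicator_def)
  qed (unfold cis_conv_exp, measurable)
  also have "\<dots> = integral {0..1} (\<lambda>\<theta>. cis (2 * pi * of_int n * \<theta>))"
  proof (rule set_borel_integral_eq_integral(2))
    show "set_integrable lborel {0..1} (\<lambda>\<theta>. cis (2 * pi * of_int n * \<theta>))"
      unfolding set_integrable_def by (intro borel_integrable_compact continuous_intros) auto
  qed
  finally show ?thesis using assms by (simp add: integral_cis_period)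
qed

lemma line_circle_orthogonal_characters:
  assumes "j \<noteq> (k::int)"
  shows "ip_L2 line_circle (\<lambda>(x, \<theta>). a x * cis (of_int j * 2 * pi * \<theta>)) (\<lambda>(x, \<theta>). b x * cis (of_int k * 2 * pi * \<theta>)) = 0"
proof -
  define h where "h p = (a (fst p) * cnj (b (fst p))) * cis (2 * pi * of_int (j - k) * snd p)" for p :: "real \<times> real"
  have "ip_L2 line_circle (\<lambda>(x, \<theta>). a x * cis (of_int j * 2 * pi * \<theta>)) (\<lambda>(x, \<theta>). b x * cis (of_int k * 2 * pi * \<theta>))
      = (LINT p|line_circle. h p)"
    unfolding ip_L2_def
  proof (intro Bochner_Integration.integral_cong refl)
    fix p :: "real \<times> real"
    have "cis (of_int j * 2 * pi * snd p) * cis (- (of_int k * 2 * pi * snd p)) = cis (2 * pi * of_int (j - k) * snd p)"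
      by (simp add: cis_mult algebra_simps)
    then show "(case p of (x, \<theta>) \<Rightarrow> a x * cis (of_int j * 2 * pi * \<theta>)) * cnj (case p of (x, \<theta>) \<Rightarrow> b x * cis (of_int k * 2 * pi * \<theta>)) = h p"
      unfolding h_def split_beta complex_cnj_mult cis_cnj by (metis (no_types, opaque_lifting) mult.assoc mult.left_commute)
  qed
  also have "\<dots> = 0"
  proof (cases "integrable line_circle h")
    case True
    then have "(LINT p|line_circle. h p) = (LINT x|lborel. LINT \<theta>|restrict_space lborel {0..<1}. h (x, \<theta>))"
      unfolding line_circle_def by (rule line_circle.integral_fst'[symmetric])
    also have "\<dots> = (LINT x|(lborel :: real measure). 0)"
    proof (intro Bochner_Integration.integral_cong refl)
      fix x :: real
      have "(LINT \<theta>|restrict_space lborel {0..<1}. h (x, \<theta>))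
          = (a x * cnj (b x)) * (LINT \<theta>|restrict_space lborel {0..<1}. cis (2 * pi * of_int (j - k) * \<theta>))"
        unfolding h_def fst_conv snd_conv by (rule integral_mult_right_zero)
      also have "\<dots> = 0" using circle_integral_character[of "j - k"] assms by simp
      finally show "(LINT \<theta>|restrict_space lborel {0..<1}. h (x, \<theta>)) = 0" .
    qed
    finally show ?thesis by simp
  qed (rule not_integrable_integral_eq)
  finally show ?thesis .
qed

lemma comp_orthogonal:
  assumes \<beta>: "\<beta> > pi / 2" and F: "F \<in> H2_worm_comp \<beta> j" and G: "G \<in> H2_worm_comp \<beta> k" and "j \<noteq> k"
  shows "ip_worm \<beta> F G = 0"
proof -
  have FG: "F \<in> H2_worm \<beta>" "G \<in> H2_worm \<beta>" using F G H2_worm_comp_subset by blast+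
  have "ip_L2 line_circle (boundary_value \<beta> F l) (boundary_value \<beta> G l) = 0" for l
  proof -
    obtain a where a: "is_boundary_value \<beta> F l (\<lambda>(x, \<theta>). a x * cis (of_int j * 2 * pi * \<theta>))"
      using comp_boundary_value[OF \<beta> F] by metis
    obtain b where b: "is_boundary_value \<beta> G l (\<lambda>(x, \<theta>). b x * cis (of_int k * 2 * pi * \<theta>))"
      using comp_boundary_value[OF \<beta> G] by metis
    have meas: "(\<lambda>(x, \<theta>). a x * cis (of_int j * 2 * pi * \<theta>)) \<in> borel_measurable line_circle"
      "(\<lambda>(x, \<theta>). b x * cis (of_int k * 2 * pi * \<theta>)) \<in> borel_measurable line_circle"
      using a b by (auto simp: is_boundary_value_def in_L2_def)
    note [measurable] = boundary_value_unique(2)[OF \<beta> FG(1) a] boundary_value_unique(2)[OF \<beta> FG(2) b]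
    have "ip_L2 line_circle (boundary_value \<beta> F l) (boundary_value \<beta> G l)
        = ip_L2 line_circle (\<lambda>(x, \<theta>). a x * cis (of_int j * 2 * pi * \<theta>)) (\<lambda>(x, \<theta>). b x * cis (of_int k * 2 * pi * \<theta>))"
      unfolding ip_L2_def
    proof (rule integral_cong_AE)
      show "(\<lambda>p. boundary_value \<beta> F l p * cnj (boundary_value \<beta> G l p)) \<in> borel_measurable line_circle" by measurable
      show "(\<lambda>p. (case p of (x, \<theta>) \<Rightarrow> a x * cis (of_int j * 2 * pi * \<theta>)) * cnj (case p of (x, \<theta>) \<Rightarrow> b x * cis (of_int k * 2 * pi * \<theta>))) \<in> borel_measurable line_circle"
        by (intro borel_measurable_times meas(1) measurable_compose[OF meas(2) borel_measurable_cnj])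
      show "AE p in line_circle. boundary_value \<beta> F l p * cnj (boundary_value \<beta> G l p)
          = (case p of (x, \<theta>) \<Rightarrow> a x * cis (of_int j * 2 * pi * \<theta>)) * cnj (case p of (x, \<theta>) \<Rightarrow> b x * cis (of_int k * 2 * pi * \<theta>))"
        using boundary_value_unique(1)[OF \<beta> FG(1) a] boundary_value_unique(1)[OF \<beta> FG(2) b]
        by eventually_elim simp
    qed
    also have "\<dots> = 0" by (rule line_circle_orthogonal_characters[OF \<open>j \<noteq> k\<close>])
    finally show ?thesis .
  qed
  then show ?thesis by (simp add: ip_worm_def)
qed

theorem theorem3p2:
  fixes \<beta> :: real
  assumes "\<beta> > pi / 2"
  shows "orthogonal_direct_sum (H2_worm \<beta>) (nsq_worm \<beta>) (ip_worm \<beta>) (H2_worm_comp \<beta>)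
    \<and> (\<forall>j::int. isometric_iso (H2_worm_comp \<beta> j) (nsq_worm \<beta>)
                              (H2_strip \<beta>) (nsq_strip_weighted \<beta> j))"
proof (intro conjI allI)
  show "isometric_iso (H2_worm_comp \<beta> j) (nsq_worm \<beta>) (H2_strip \<beta>) (nsq_strip_weighted \<beta> j)" for j
    by (rule isometric_iso_comp_strip[OF assms])
  have decomposition: "\<exists>!G. (\<forall>j. G j \<in> H2_worm_comp \<beta> j) \<and> norm_has_sum (nsq_worm \<beta>) G F"
    if F: "F \<in> H2_worm \<beta>" for F
  proof (rule ex1I[of _ "\<lambda>j. proj \<beta> j F"])
    show "(\<forall>j. proj \<beta> j F \<in> H2_worm_comp \<beta> j) \<and> norm_has_sum (nsq_worm \<beta>) (\<lambda>j. proj \<beta> j F) F"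
      using proj_in_comp[OF F] proj_has_sum[OF assms F] by blast
    show "G = (\<lambda>j. proj \<beta> j F)" if "(\<forall>j. G j \<in> H2_worm_comp \<beta> j) \<and> norm_has_sum (nsq_worm \<beta>) G F" for G
      using norm_has_sum_imp_proj[OF assms F, of G] that by blast
  qed
  show "orthogonal_direct_sum (H2_worm \<beta>) (nsq_worm \<beta>) (ip_worm \<beta>) (H2_worm_comp \<beta>)"
    unfolding orthogonal_direct_sum_def
  proof (intro conjI allI ballI impI)
    show "F \<in> H2_worm_comp \<beta> j"
      if "F \<in> H2_worm \<beta>" "(\<forall>n. X n \<in> H2_worm_comp \<beta> j) \<and> (\<lambda>n. nsq_worm \<beta> (\<lambda>z. F z - X n z)) \<longlonglongrightarrow> 0" for j F and X :: "nat \<Rightarrow> _"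
      using comp_closed[OF assms that(1), of X j] that(2) by blast
    show "ip_worm \<beta> F G = 0" if "j \<noteq> k" "F \<in> H2_worm_comp \<beta> j" "G \<in> H2_worm_comp \<beta> k" for j k F G
      by (rule comp_orthogonal[OF assms that(2,3,1)])
    show "\<exists>F\<in>H2_worm \<beta>. norm_has_sum (nsq_worm \<beta>) G F"
      if "(\<forall>j. G j \<in> H2_worm_comp \<beta> j) \<and> (\<Sum>\<^sub>\<infinity>j. nsq_worm \<beta> (G j)) < \<infinity>" for G
      using sum_in_H2_worm[OF assms, of G] that by blast
  qed (use lin_subspace_H2_worm lin_subspace_H2_worm_comp H2_worm_comp_subset decomposition in auto)
qed

end
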